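(* Let $M$ be a quasitoric manifold of dimension $2n$ over the $n$-cube $\mathbb I^n$, with acting torus $\mathbb T^n$. Assume that there is a circle subgroup of $\mathbb T^n$ that acts on $M$ semifreely and with isolated fixed points. Then $M$ is equivalent (as a quasitoric manifold) to a Bott tower.
   Context: Quasitoric manifold: a closed smooth $2n$-manifold $M$ with an action of the $n$-torus $\mathbb T^n=(\mathbb S^1)^n$ that is locally standard (locally isomorphic, up to an automorphism of the torus, to the standard coordinatewise action of $\mathbb T^n$ on $\mathbb C^n$) and whose orbit space $M/\mathbb T^n$ is homeomorphic, as a manifold with corners, to a simple $n$-polytope $P$; one says that $M$ is a quasitoric manifold over $P$, with projection $\pi\colon M\to P$. "Over a cube" means $P$ is combinatorially equivalent to $\mathbb I^n$. Semifree: a group action is semifree if it is free on the complement of its fixed point set. Equivalence: two quasitoric manifolds $M_1,M_2$ over the same $P$ are equivalent if there are an automorphism $\theta$ of $\mathbb T^n$ and a homeomorphism $f\colon M_1\to M_2$ with $f(t\cdot x)=\theta(t)\cdot f(x)$ for all $t\in\mathbb T^n$, $x\in M_1$, covering the identity of $P$. Bott tower: a Bott tower of height $n$ is a sequence of complex manifolds $B^2,B^4,\dots,B^{2n}$ with $B^2=\mathbb CP^1$ and $B^{2k}=P(\underline{\mathbb C}\oplus\xi_{k-1})$ for $1<k\le n$, where $\xi_{k-1}$ is a complex line bundle over $B^{2(k-1)}$, $\underline{\mathbb C}$ is the trivial line bundle and $P(\cdot)$ is complex projectivisation; the last stage $B^{2n}$ is also called a Bott tower. A Bott tower $B^{2n}$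 has a natural $\mathbb T^n$-action making it a (projective toric, hence) quasitoric manifold over $\mathbb I^n$, as follows. Let $a_{ij}$ ($1\le i<j\le n$) be the integers with $c_1(\xi_{k-1})=\sum_{i<k}a_{ik}u_i$, where $u_i\in H^2(B^{2i})$ is the degree-2 generator restricting on the fibre $\mathbb CP^1$ to the first Chern class of the canonical line bundle and satisfying $u_i^2=c_1(\xi_{i-1})u_i$ (and $u_1$ is the first Chern class of the canonical line bundle over $B^2$). Then $B^{2n}$ is the quotient of $(S^3)^n=\{(z_1,\dots,z_{2n})\in\mathbb C^{2n}:|z_j|^2+|z_{n+j}|^2=1,\ 1\le j\le n\}$ by the free action of the image of $(t_1,\dots,t_n)\mapsto(t_1,\,t_1^{-a_{12}}t_2,\dots,t_1^{-a_{1n}}\cdots t_{n-1}^{-a_{n-1,n}}t_n,\,t_1,\dots,t_n)\in\mathbb T^{2n}$, and $(t_1,\dots,t_n)\in\mathbb T^n$ acts on it as multiplication by $(t_1,\dots,t_n,1,\dots,1)$. When saying that $M$ is equivalent to a Bott tower, the pairs of opposite facets of the cube may be ordered arbitrarily (i.e. the orbit space of the Bott tower may be identified with $\mathbb I^n$ by any combinatorial equivalence). *)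

theory Defs
  imports "HOL-Analysis.Analysis"
begin

section \<open>Smooth manifolds\<close>

text \<open>\<open>k_times_differentiable_on k f S\<close>, for \<open>S\<close> open in a finite-dimensional space, says that
  \<open>f\<close> is of class \<open>C\<^sup>k\<close> on \<open>S\<close>.\<close>

primrec k_times_differentiable_on ::
    "nat \<Rightarrow> ('a::real_normed_vector \<Rightarrow> 'b::real_normed_vector) \<Rightarrow> 'a set \<Rightarrow> bool" where
  "k_times_differentiable_on 0 f S \<longleftrightarrow> continuous_on S f"
| "k_times_differentiable_on (Suc k) f S \<longleftrightarrow>
     (\<forall>x\<in>S. f differentiable (at x)) \<and>
     (\<forall>v. k_times_differentiable_on k (\<lambda>x. frechet_derivative f (at x) v) S)"

definition smooth_on :: "'a set \<Rightarrow> ('a::real_normed_vector \<Rightarrow> 'b::real_normed_vector) \<Rightarrow> bool" where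
  "smooth_on S f \<longleftrightarrow> (\<forall>k. k_times_differentiable_on k f S)"

type_synonym ('m, 'e) chart = "'m set \<times> ('m \<Rightarrow> 'e)"

definition is_chart :: "'m topology \<Rightarrow> ('m, 'e::euclidean_space) chart \<Rightarrow> bool" where
  "is_chart X c \<longleftrightarrow> (case c of (U, \<phi>) \<Rightarrow>
     openin X U \<and> open (\<phi> ` U) \<and>
     homeomorphic_map (subtopology X U) (top_of_set (\<phi> ` U)) \<phi>)"

definition smoothly_compatible ::
    "('m, 'e::euclidean_space) chart \<Rightarrow> ('m, 'e) chart \<Rightarrow> bool" where
  "smoothly_compatible c d \<longleftrightarrow> (case c of (U, \<phi>) \<Rightarrow> case d of (V, \<psi>) \<Rightarrow>
     smooth_on (\<phi> ` (U \<inter> V)) (\<psi> \<circ> inv_into U \<phi>) \<and>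
     smooth_on (\<psi> ` (U \<inter> V)) (\<phi> \<circ> inv_into V \<psi>))"

text \<open>The atlas is not required to be maximal.\<close>

definition smooth_manifold ::
    "'m topology \<Rightarrow> ('m, 'e::euclidean_space) chart set \<Rightarrow> bool" where
  "smooth_manifold X A \<longleftrightarrow>
     Hausdorff_space X \<and> second_countable X \<and>
     (\<forall>c\<in>A. is_chart X c) \<and> (\<Union>c\<in>A. fst c) = topspace X \<and>
     (\<forall>c\<in>A. \<forall>d\<in>A. smoothly_compatible c d)"

definition closed_smooth_manifold ::
    "'m topology \<Rightarrow> ('m, 'e::euclidean_space) chart set \<Rightarrow> bool" where
  "closed_smooth_manifold X A \<longleftrightarrow> smooth_manifold X A \<and> compact_space X"


section \<open>Torus actions\<close>

type_synonym 'n cspace = "(complex, 'n) vec"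
type_synonym 'n rspace = "(real, 'n) vec"

text \<open>\<open>n\<close> is \<open>CARD('n)\<close>. Multiplication on \<open>complex ^ 'n\<close> is coordinatewise, so \<open>t * s\<close> is the
  product in the torus and \<open>t * z\<close> is the standard action on the complex coordinate space.\<close>

definition torus :: "'n::finite cspace set" where
  "torus = {t. \<forall>i. norm (t $ i) = 1}"

definition torus_automorphism :: "('n::finite cspace \<Rightarrow> 'n cspace) \<Rightarrow> bool" where
  "torus_automorphism \<theta> \<longleftrightarrow>
     bij_betw \<theta> torus torus \<and> continuous_on torus \<theta> \<and>
     (\<forall>s\<in>torus. \<forall>t\<in>torus. \<theta> (s * t) = \<theta> s * \<theta> t)"

definition circle_subgroup :: "'n::finite cspace set \<Rightarrow> bool" where
  "circle_subgroup S \<longleftrightarrow>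
     (\<exists>\<gamma> :: complex \<Rightarrow> 'n cspace.
        continuous_on (sphere 0 1) \<gamma> \<and> inj_on \<gamma> (sphere 0 1) \<and>
        (\<forall>s\<in>sphere 0 1. \<forall>t\<in>sphere 0 1. \<gamma> (s * t) = \<gamma> s * \<gamma> t) \<and>
        \<gamma> ` sphere 0 1 = S \<and> S \<subseteq> torus)"

definition torus_action :: "'m topology \<Rightarrow> ('n::finite cspace \<Rightarrow> 'm \<Rightarrow> 'm) \<Rightarrow> bool" where
  "torus_action X act \<longleftrightarrow>
     continuous_map (prod_topology (top_of_set torus) X) X (\<lambda>(t, x). act t x) \<and>
     (\<forall>x\<in>topspace X. act 1 x = x) \<and>
     (\<forall>s\<in>torus. \<forall>t\<in>torus. \<forall>x\<in>topspace X. act (s * t) x = act s (act t x))"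

definition fixed_points ::
    "'m topology \<Rightarrow> ('n::finite cspace \<Rightarrow> 'm \<Rightarrow> 'm) \<Rightarrow> 'n cspace set \<Rightarrow> 'm set" where
  "fixed_points X act S = {x \<in> topspace X. \<forall>s\<in>S. act s x = x}"

definition semifree ::
    "'m topology \<Rightarrow> ('n::finite cspace \<Rightarrow> 'm \<Rightarrow> 'm) \<Rightarrow> 'n cspace set \<Rightarrow> bool" where
  "semifree X act S \<longleftrightarrow>
     (\<forall>x \<in> topspace X - fixed_points X act S. \<forall>s\<in>S. act s x = x \<longrightarrow> s = 1)"

definition has_isolated_fixed_points ::
    "'m topology \<Rightarrow> ('n::finite cspace \<Rightarrow> 'm \<Rightarrow> 'm) \<Rightarrow> 'n cspace set \<Rightarrow> bool" where
  "has_isolated_fixed_points X act S \<longleftrightarrow>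
     subtopology X (fixed_points X act S) = discrete_topology (fixed_points X act S)"

text \<open>A standard chart is a diffeomorphism, with respect to the smooth structure given by the
  atlas \<open>A\<close>, from an invariant open set onto an open subset of the complex coordinate space; it
  intertwines the action with the standard one up to the torus automorphism \<open>\<theta>\<close>. The existence of
  such charts around every point makes the action smooth.\<close>

definition standard_chart ::
    "'m topology \<Rightarrow> ('m, 'n::finite cspace) chart set \<Rightarrow> ('n cspace \<Rightarrow> 'm \<Rightarrow> 'm) \<Rightarrow>
     'm set \<Rightarrow> ('m \<Rightarrow> 'n cspace) \<Rightarrow> ('n cspace \<Rightarrow> 'n cspace) \<Rightarrow> bool" where
  "standard_chart X A act U \<phi> \<theta> \<longleftrightarrow>
     is_chart X (U, \<phi>) \<and> (\<forall>c\<in>A. smoothly_compatible c (U, \<phi>)) \<and>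
     torus_automorphism \<theta> \<and>
     (\<forall>t\<in>torus. \<forall>x\<in>U. act t x \<in> U \<and> \<phi> (act t x) = \<theta> t * \<phi> x)"

definition locally_standard ::
    "'m topology \<Rightarrow> ('m, 'n::finite cspace) chart set \<Rightarrow> ('n cspace \<Rightarrow> 'm \<Rightarrow> 'm) \<Rightarrow> bool" where
  "locally_standard X A act \<longleftrightarrow>
     (\<forall>x\<in>topspace X. \<exists>U \<phi> \<theta>. x \<in> U \<and> standard_chart X A act U \<phi> \<theta>)"


section \<open>Polytopes\<close>

definition simple_polytope :: "'p::euclidean_space set \<Rightarrow> bool" where
  "simple_polytope P \<longleftrightarrow> polytope P \<and>
     (\<forall>v. v extreme_point_of P \<longrightarrow> int (card {F. F facet_of P \<and> v \<in> F}) = aff_dim P)"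

definition combinatorially_equivalent ::
    "'p::euclidean_space set \<Rightarrow> 'q::euclidean_space set \<Rightarrow> bool" where
  "combinatorially_equivalent P Q \<longleftrightarrow>
     (\<exists>\<Phi>. bij_betw \<Phi> {F. F face_of P} {G. G face_of Q} \<and>
        (\<forall>F F'. F face_of P \<longrightarrow> F' face_of P \<longrightarrow> (\<Phi> F \<subseteq> \<Phi> F' \<longleftrightarrow> F \<subseteq> F')))"

text \<open>A homeomorphism of polytopes that induces a combinatorial equivalence.\<close>

definition face_homeomorphism ::
    "'p::euclidean_space set \<Rightarrow> 'q::euclidean_space set \<Rightarrow> ('p \<Rightarrow> 'q) \<Rightarrow> bool" where
  "face_homeomorphism P Q h \<longleftrightarrow>
     (\<exists>k. homeomorphism P Q h k) \<and> (\<forall>F. F \<subseteq> P \<longrightarrow> (F face_of P \<longleftrightarrow> h ` F face_of Q))"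


section \<open>Quasitoric manifolds\<close>

text \<open>\<open>\<pi>\<close> identifies the orbit space, with its quotient topology, with \<open>P\<close>.\<close>

definition orbit_projection ::
    "'m topology \<Rightarrow> ('n::finite cspace \<Rightarrow> 'm \<Rightarrow> 'm) \<Rightarrow> 'p::euclidean_space set \<Rightarrow> ('m \<Rightarrow> 'p) \<Rightarrow> bool" where
  "orbit_projection X act P \<pi> \<longleftrightarrow>
     quotient_map X (top_of_set P) \<pi> \<and>
     (\<forall>x\<in>topspace X. \<forall>y\<in>topspace X. \<pi> x = \<pi> y \<longleftrightarrow> (\<exists>t\<in>torus. y = act t x))"

text \<open>The orbit space of a locally standard action is a manifold with corners: a standard chart
  \<open>\<phi>\<close> induces the chart \<open>x \<mapsto> (\<bar>\<phi>\<^sub>i x\<bar>)\<^sub>i\<close> of the orbit space into the nonnegative orthant, and the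
  orbit of \<open>x\<close> has as its codimension the number of vanishing coordinates of \<open>\<phi> x\<close>. A point of a
  simple polytope has as its codimension the number of facets through it. A homeomorphism of
  manifolds with corners is a homeomorphism preserving codimensions.\<close>

definition preserves_corners ::
    "'m topology \<Rightarrow> ('m, 'n::finite cspace) chart set \<Rightarrow> ('n cspace \<Rightarrow> 'm \<Rightarrow> 'm) \<Rightarrow>
     'p::euclidean_space set \<Rightarrow> ('m \<Rightarrow> 'p) \<Rightarrow> bool" where
  "preserves_corners X A act P \<pi> \<longleftrightarrow>
     (\<forall>U \<phi> \<theta> x. standard_chart X A act U \<phi> \<theta> \<longrightarrow> x \<in> U \<longrightarrow>
        card {i. \<phi> x $ i = 0} = card {F. F facet_of P \<and> \<pi> x \<in> F})"

text \<open>The manifold is modelled on \<open>complex ^ 'n\<close>, so it has real dimension \<open>2n\<close>.\<close>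

definition quasitoric_manifold ::
    "'m topology \<Rightarrow> ('m, 'n::finite cspace) chart set \<Rightarrow> ('n cspace \<Rightarrow> 'm \<Rightarrow> 'm) \<Rightarrow>
     'p::euclidean_space set \<Rightarrow> ('m \<Rightarrow> 'p) \<Rightarrow> bool" where
  "quasitoric_manifold X A act P \<pi> \<longleftrightarrow>
     closed_smooth_manifold X A \<and> torus_action X act \<and> locally_standard X A act \<and>
     simple_polytope P \<and> aff_dim P = int CARD('n) \<and>
     orbit_projection X act P \<pi> \<and> preserves_corners X A act P \<pi>"

definition equivalent_over ::
    "'m topology \<Rightarrow> ('n::finite cspace \<Rightarrow> 'm \<Rightarrow> 'm) \<Rightarrow> ('m \<Rightarrow> 'p) \<Rightarrow>
     'k topology \<Rightarrow> ('n cspace \<Rightarrow> 'k \<Rightarrow> 'k) \<Rightarrow> ('k \<Rightarrow> 'p) \<Rightarrow> bool" where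
  "equivalent_over X act \<pi> Y act' \<pi>' \<longleftrightarrow>
     (\<exists>\<theta> f. torus_automorphism \<theta> \<and> homeomorphic_map X Y f \<and>
        (\<forall>t\<in>torus. \<forall>x\<in>topspace X. f (act t x) = act' (\<theta> t) (f x)) \<and>
        (\<forall>x\<in>topspace X. \<pi>' (f x) = \<pi> x))"


section \<open>Bott towers\<close>

text \<open>A point \<open>(z\<^sub>1, \<dots>, z\<^sub>2\<^sub>n)\<close> of the product of 3-spheres is written as the pair
  \<open>((z\<^sub>1, \<dots>, z\<^sub>n), (z\<^sub>n\<^sub>+\<^sub>1, \<dots>, z\<^sub>2\<^sub>n))\<close>. Of the integers \<open>a i j\<close>, which are the coefficients of the first
  Chern classes of the line bundles of the tower, only those with \<open>i < j\<close> matter.\<close>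

definition spheres :: "('n::finite cspace \<times> 'n cspace) set" where
  "spheres = {(z, w). \<forall>j. (norm (z $ j))\<^sup>2 + (norm (w $ j))\<^sup>2 = 1}"

definition bott_mult ::
    "('n::{finite,linorder} \<Rightarrow> 'n \<Rightarrow> int) \<Rightarrow> 'n cspace \<Rightarrow>
     'n cspace \<times> 'n cspace \<Rightarrow> 'n cspace \<times> 'n cspace" where
  "bott_mult a t p = (case p of (z, w) \<Rightarrow>
     ((\<chi> j. (\<Prod>i\<in>{..<j}. t $ i powi (- a i j)) * t $ j * z $ j), t * w))"

definition bott_orbit ::
    "('n::{finite,linorder} \<Rightarrow> 'n \<Rightarrow> int) \<Rightarrow> 'n cspace \<times> 'n cspace \<Rightarrow>
     ('n cspace \<times> 'n cspace) set" where
  "bott_orbit a p = (\<lambda>t. bott_mult a t p) ` torus"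

text \<open>The points of the Bott tower are the orbits; it has the quotient topology.\<close>

definition bott_tower ::
    "('n::{finite,linorder} \<Rightarrow> 'n \<Rightarrow> int) \<Rightarrow> ('n cspace \<times> 'n cspace) set topology" where
  "bott_tower a = topology (\<lambda>V. V \<subseteq> bott_orbit a ` spheres \<and>
     openin (top_of_set spheres) {p \<in> spheres. bott_orbit a p \<in> V})"

definition bott_act ::
    "'n::finite cspace \<Rightarrow> ('n cspace \<times> 'n cspace) set \<Rightarrow>
     ('n cspace \<times> 'n cspace) set" where
  "bott_act t q = (\<lambda>(z, w). (t * z, w)) ` q"

text \<open>The projection onto the cube, \<open>[z\<^sub>1, \<dots>, z\<^sub>2\<^sub>n] \<mapsto> (\<bar>z\<^sub>1\<bar>\<^sup>2, \<dots>, \<bar>z\<^sub>n\<bar>\<^sup>2)\<close>.\<close>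

definition bott_proj :: "('n::finite cspace \<times> 'n cspace) set \<Rightarrow> 'n rspace" where
  "bott_proj q = the_elem ((\<lambda>(z, w). \<chi> j. (norm (z $ j))\<^sup>2) ` q)"

lemma openin_bott_tower:
  "openin (bott_tower a) V \<longleftrightarrow> V \<subseteq> bott_orbit a ` spheres \<and>
     openin (top_of_set spheres) {p \<in> spheres. bott_orbit a p \<in> V}"
proof -
  have "istopology (\<lambda>V. V \<subseteq> bott_orbit a ` spheres \<and>
     openin (top_of_set spheres) {p \<in> spheres. bott_orbit a p \<in> V})"
    unfolding istopology_def
  proof (rule conjI; intro allI impI)
    fix S T
    assume S: "S \<subseteq> bott_orbit a ` spheres \<and>
        openin (top_of_set spheres) {p \<in> spheres. bott_orbit a p \<in> S}"
      and T: "T \<subseteq> bott_orbit a ` spheres \<and>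
        openin (top_of_set spheres) {p \<in> spheres. bott_orbit a p \<in> T}"
    have "{p \<in> spheres. bott_orbit a p \<in> S \<inter> T} =
        {p \<in> spheres. bott_orbit a p \<in> S} \<inter> {p \<in> spheres. bott_orbit a p \<in> T}"
      by blast
    with S T show "S \<inter> T \<subseteq> bott_orbit a ` spheres \<and>
        openin (top_of_set spheres) {p \<in> spheres. bott_orbit a p \<in> S \<inter> T}"
      by (metis (no_types, lifting) le_infI1 openin_Int)
  next
    fix K :: "('a cspace \<times> 'a cspace) set set set"
    assume K: "\<forall>V\<in>K. V \<subseteq> bott_orbit a ` spheres \<and>
        openin (top_of_set spheres) {p \<in> spheres. bott_orbit a p \<in> V}"
    have "{p \<in> spheres. bott_orbit a p \<in> \<Union>K} =
        \<Union>((\<lambda>V. {p \<in> spheres. bott_orbit a p \<in> V}) ` K)"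
      by blast
    moreover have "openin (top_of_set spheres)
        (\<Union>((\<lambda>V. {p \<in> spheres. bott_orbit a p \<in> V}) ` K))"
      using K by (intro openin_Union) blast
    ultimately show "\<Union>K \<subseteq> bott_orbit a ` spheres \<and>
        openin (top_of_set spheres) {p \<in> spheres. bott_orbit a p \<in> \<Union>K}"
      using K by auto
  qed
  then show ?thesis
    by (simp add: bott_tower_def topology_inverse')
qed

lemma topspace_bott_tower: "topspace (bott_tower a) = bott_orbit a ` spheres"
proof (rule antisym)
  show "topspace (bott_tower a) \<subseteq> bott_orbit a ` spheres"
    by (metis openin_bott_tower openin_topspace)
  have "{p \<in> spheres. bott_orbit a p \<in> bott_orbit a ` spheres} = spheres"
    by blast
  then have "openin (bott_tower a) (bott_orbit a ` spheres)"
    unfolding openin_bott_tower by simp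
  then show "bott_orbit a ` spheres \<subseteq> topspace (bott_tower a)"
    by (rule openin_subset)
qed

lemma quotient_map_bott_orbit: "quotient_map (top_of_set spheres) (bott_tower a) (bott_orbit a)"
  unfolding quotient_map_def topspace_bott_tower openin_bott_tower by simp

lemma bott_act_orbit: "bott_act s (bott_orbit a (z, w)) = bott_orbit a (s * z, w)"
  unfolding bott_act_def bott_orbit_def bott_mult_def image_image
  by (intro image_cong refl) (simp add: vec_eq_iff mult_ac)

lemma bott_proj_orbit: "bott_proj (bott_orbit a (z, w)) = (\<chi> j. (norm (z $ j))\<^sup>2)"
proof -
  have "(case bott_mult a t (z, w) of (z, w) \<Rightarrow> \<chi> j. (norm (z $ j))\<^sup>2) = (\<chi> j. (norm (z $ j))\<^sup>2)"
    if "t \<in> torus" for t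
    using that
    by (simp add: bott_mult_def torus_def vec_eq_iff norm_mult norm_power_int flip: prod_norm)
  then have "(\<lambda>(z, w). \<chi> j. (norm (z $ j))\<^sup>2) ` bott_orbit a (z, w) =
      (\<lambda>t. \<chi> j. (norm (z $ j))\<^sup>2) ` (torus :: 'a cspace set)"
    unfolding bott_orbit_def image_image by (rule image_cong[OF refl])
  moreover have "(1 :: 'a cspace) \<in> torus"
    by (simp add: torus_def)
  ultimately have "(\<lambda>(z, w). \<chi> j. (norm (z $ j))\<^sup>2) ` bott_orbit a (z, w) =
      {\<chi> j. (norm (z $ j))\<^sup>2}"
    by auto
  then show ?thesis
    unfolding bott_proj_def by (simp only: the_elem_eq)
qed

end

theory Submission
  imports Defs
begin

text \<open>Over an orbit space with the corners of a cube the projection has a continuous section: the cube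
  is cut into small boxes, each lying in the image of a standard chart, and a section is extended from
  box to box. Hence \<open>M\<close> is the quotient of \<open>T\<^sup>n \<times> I\<^sup>n\<close> determined by the isotropy circles of the \<open>2n\<close>
  facets, and it suffices to compare these with the isotropy circles of a Bott tower.

  At a vertex of the cube the isotropy circles of the \<open>n\<close> facets through it split the torus, and
  semifreeness with isolated fixed points says that all weights of the given circle in this splitting
  are \<open>\<plusminus>1\<close>. Choose coordinates at one vertex in which the given circle is the diagonal. Moving along
  the edges from this vertex shows that the circle of the facet opposite to the \<open>j\<close>-th one consists of the
  elements with entry \<open>s\<close> at \<open>j\<close>, entry \<open>s\<^sup>2\<close> at the indices in some set \<open>N j\<close>, and entry \<open>1\<close> elsewhere. A
  set of indices in which every element has a unique predecessor for \<open>N\<close> would contradict the weights at the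
  corresponding vertex, so \<open>N\<close> is acyclic. Sorting the indices topologically gives a Bott tower all
  of whose integers are \<open>-2\<close> or \<open>0\<close>.\<close>

section \<open>Polytopes combinatorially equivalent to the cube\<close>

text \<open>The squares come from comparing weights. Parametrize the circles of the facets once and
  for all; at every vertex the given circle then runs along each of them with a sign. Crossing the
  edge in direction \<open>j\<close> from the base vertex replaces one circle only, and since all
  circles together multiply to the diagonal, the entry of the new one at \<open>i\<close> is
  \<open>s\<close> divided by \<open>s\<close> or by its inverse, so \<open>1\<close> or
  \<open>s\<^sup>2\<close>. In a set with unique predecessors, with \<open>k\<close> the predecessor
  of \<open>i\<close>, the diagonal relation at the corresponding vertex reads e_i + 2 e_k = 1 for
  signs e. Hence e_i = -1 and e_k = 1; but \<open>k\<close> has a predecessor as well, so e_k = -1.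

  The topological obstacle is that the corner condition only equates two cardinalities: the matching
  of facets with vanishing chart coordinates has to be extracted from the connectedness of open
  faces. Sections are extended only from faces on the low side of a box, because there the locus
  where a chart coordinate is nonzero is contractible and its phase has a logarithm.\<close>

definition cube_facet :: "'n::finite \<times> bool \<Rightarrow> 'n rspace set" where
  "cube_facet f = {y \<in> cbox 0 1. y $ fst f = of_bool (snd f)}"

definition cube_facets_at :: "'n::finite rspace \<Rightarrow> ('n \<times> bool) set" where
  "cube_facets_at y = {f. y $ fst f = of_bool (snd f)}"

section \<open>The face lattice of the standard cube\<close>

lemma mem_cube: "y \<in> cbox (0 :: 'n::finite rspace) 1 \<longleftrightarrow> (\<forall>i. 0 \<le> y $ i \<and> y $ i \<le> 1)"
  by (auto simp: mem_box_cart)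

text \<open>Since \<open>y\<close> shares all extreme coordinates of \<open>x\<close>, the segment
  from \<open>y\<close> to \<open>x\<close> can be prolonged a little beyond \<open>x\<close> inside
  the cube. Then \<open>x\<close> is interior to a segment ending in \<open>y\<close>, and a face
  containing \<open>x\<close> contains both ends.\<close>

lemma cube_face_mem:
  fixes F :: "'n::finite rspace set"
  assumes F: "F face_of cbox 0 1" and x: "x \<in> F" and y: "y \<in> cbox 0 1"
    and sub: "cube_facets_at x \<subseteq> cube_facets_at y"
  shows "y \<in> F"
proof (cases "x = y")
  case False
  have xc: "x \<in> cbox 0 1" using F x face_of_imp_subset by blast
  \<comment> \<open>At most the distance of any non-extreme coordinate of \<open>x\<close> from 0
    and from 1. The coordinates of \<open>y - x\<close> have modulus at most 1, so the step by
    \<open>e\<close> away from \<open>y\<close> does not leave the cube.\<close>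
  define e where "e = Min (insert 1 ((\<lambda>i. min (x $ i) (1 - x $ i)) ` {i. 0 < x $ i \<and> x $ i < 1}))"
  have e: "e > 0" "e \<le> 1"
    unfolding e_def by (subst Min_gr_iff; auto) (intro Min_le; auto)
  have ei: "e \<le> x $ i" "e \<le> 1 - x $ i" if "0 < x $ i" "x $ i < 1" for i
  proof -
    have "e \<le> min (x $ i) (1 - x $ i)" unfolding e_def using that by (intro Min_le) auto
    then show "e \<le> x $ i" "e \<le> 1 - x $ i" by auto
  qed
  define z where "z = x - e *\<^sub>R (y - x)"
  have "z $ i \<ge> 0 \<and> z $ i \<le> 1" for i
  proof -
    have x01: "0 \<le> x $ i" "x $ i \<le> 1" and y01: "0 \<le> y $ i" "y $ i \<le> 1"
      using xc y by (auto simp: mem_cube)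
    consider "x $ i = 0" | "x $ i = 1" | "0 < x $ i" "x $ i < 1" using x01 by linarith
    then show ?thesis
    proof cases
      case 1
      then have "(i, False) \<in> cube_facets_at y" using sub by (intro subsetD[OF sub]) (simp add: cube_facets_at_def)
      then show ?thesis using 1 by (simp add: z_def cube_facets_at_def)
    next
      case 2
      then have "(i, True) \<in> cube_facets_at y" using sub by (intro subsetD[OF sub]) (simp add: cube_facets_at_def)
      then show ?thesis using 2 by (simp add: z_def cube_facets_at_def)
    next
      case 3
      have "\<bar>e * (y $ i - x $ i)\<bar> \<le> e * 1"
        unfolding abs_mult using x01 y01 e by (intro mult_mono) auto
      then show ?thesis using ei[OF 3] by (auto simp: z_def)
    qed
  qed
  then have z: "z \<in> cbox 0 1" by (auto simp: mem_cube)
  have zy: "y - z = (1 + e) *\<^sub>R (y - x)" by (simp add: z_def algebra_simps)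
  have "x \<in> open_segment z y"
    unfolding in_segment
  proof (intro conjI exI[of _ "e / (1 + e)"])
    show "z \<noteq> y" using zy False e by auto
    show "0 < e / (1+e)" "e / (1+e) < 1" using e by auto
    have "z + (e/(1+e)) *\<^sub>R (y - z) = x" unfolding zy using e by (simp add: z_def)
    then show "x = (1 - e / (1+e)) *\<^sub>R z + (e / (1+e)) *\<^sub>R y" by (simp add: algebra_simps)
  qed
  with F x y z show ?thesis unfolding face_of_def by blast
qed (use x in simp)

lemma cube_facet_face: "cube_facet f face_of cbox 0 1"
proof (cases "snd f")
  case False
  have "cube_facet f = cbox 0 1 \<inter> {y. axis (fst f) 1 \<bullet> y = 0}"
    using False by (auto simp: cube_facet_def inner_axis')
  then show ?thesis
    using face_of_Int_supporting_hyperplane_ge[of "cbox 0 1" 0 "axis (fst f) (1::real)"]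
    by (auto simp: inner_axis' mem_cube)
next
  case True
  have "cube_facet f = cbox 0 1 \<inter> {y. axis (fst f) 1 \<bullet> y = 1}"
    using True by (auto simp: cube_facet_def inner_axis')
  then show ?thesis
    using face_of_Int_supporting_hyperplane_le[of "cbox 0 1" "axis (fst f) (1::real)" 1]
    by (auto simp: inner_axis' mem_cube)
qed

lemma cube_facet_neq: "cube_facet f \<noteq> cbox 0 1" "cube_facet f \<noteq> {}"
proof -
  have "(\<chi> i. of_bool (\<not> snd f)) \<in> cbox 0 1 - cube_facet f"
    by (auto simp: cube_facet_def mem_cube)
  then show "cube_facet f \<noteq> cbox 0 1" by blast
  have "(\<chi> i. of_bool (snd f)) \<in> cube_facet f" by (auto simp: cube_facet_def mem_cube)
  then show "cube_facet f \<noteq> {}" by blast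
qed

lemma inj_cube_facet: "inj (cube_facet :: 'n::finite \<times> bool \<Rightarrow> _)"
proof (rule injI)
  fix f g :: "'n \<times> bool" assume eq: "cube_facet f = cube_facet g"
  \<comment> \<open>The centre of the facet \<open>f\<close>, which lies on no other facet.\<close>
  define y :: "'n rspace" where "y = (\<chi> i. if i = fst f then of_bool (snd f) else 1/2)"
  have "y \<in> cube_facet f" by (auto simp: cube_facet_def mem_cube y_def)
  then have "y $ fst g = of_bool (snd g)" using eq by (auto simp: cube_facet_def)
  then show "f = g" by (auto simp: y_def prod_eq_iff of_bool_def split: if_splits)
qed

text \<open>A point in the relative interior of \<open>F\<close> decides: if it is on no facet,
  \<open>cube_face_mem\<close> puts the whole cube into \<open>F\<close>; otherwise a facet through
  it contains all of \<open>F\<close>.\<close>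

lemma cube_face_subset_facet:
  assumes F: "F face_of cbox (0 :: 'n::finite rspace) 1" and ne: "F \<noteq> cbox 0 1"
  obtains f where "F \<subseteq> cube_facet f"
proof (cases "F = {}")
  case False
  have "convex F" using F by (rule face_of_imp_convex)
  with False obtain x where x: "x \<in> rel_interior F" using rel_interior_eq_empty by blast
  then have xF: "x \<in> F" using rel_interior_subset by blast
  then have xc: "x \<in> cbox 0 1" using F face_of_imp_subset by blast
  show ?thesis
  proof (cases "cube_facets_at x = {}")
    case True
    then have "cbox 0 1 \<subseteq> F" using cube_face_mem[OF F xF] by blast
    with ne F show ?thesis using face_of_imp_subset by blast
  next
    case False
    then obtain f where "f \<in> cube_facets_at x" by blast
    then have "x \<in> cube_facet f" using xc by (auto simp: cube_facets_at_def cube_facet_def)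
    then have "F \<subseteq> cube_facet f"
      using subset_of_face_of[OF cube_facet_face face_of_imp_subset[OF F]] x by blast
    then show ?thesis by (rule that)
  qed
qed (use that in blast)

lemma cube_facet_maximal:
  assumes F: "F face_of cbox (0 :: 'n::finite rspace) 1" and ne: "F \<noteq> cbox 0 1"
    and sub: "cube_facet f \<subseteq> F"
  shows "F = cube_facet f"
proof -
  obtain g where g: "F \<subseteq> cube_facet g" using cube_face_subset_facet[OF F ne] .
  define y :: "'n rspace" where "y = (\<chi> i. if i = fst f then of_bool (snd f) else 1/2)"
  have "y \<in> cube_facet f" by (auto simp: cube_facet_def mem_cube y_def)
  then have "y \<in> cube_facet g" using sub g by blast
  then have "y $ fst g = of_bool (snd g)" by (auto simp: cube_facet_def)
  then have "f = g" by (auto simp: y_def prod_eq_iff of_bool_def split: if_splits)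
  with g sub show ?thesis by blast
qed

text \<open>Facets become visible in the inclusion order of the faces alone, so an isomorphism of
  face posets carries facets to facets.\<close>

lemma polyhedron_facet_iff_maximal_face:
  assumes P: "polyhedron P" and C: "C \<noteq> {}"
  shows "C facet_of P \<longleftrightarrow>
    C face_of P \<and> C \<noteq> P \<and> (\<forall>F. F face_of P \<longrightarrow> F \<noteq> P \<longrightarrow> C \<subseteq> F \<longrightarrow> F = C)"
proof
  assume fc: "C facet_of P"
  show "C face_of P \<and> C \<noteq> P \<and> (\<forall>F. F face_of P \<longrightarrow> F \<noteq> P \<longrightarrow> C \<subseteq> F \<longrightarrow> F = C)"
  proof (intro conjI allI impI)
    show CF: "C face_of P" using fc facet_of_imp_face_of by blast
    show "C \<noteq> P" using fc by auto
    fix F assume F: "F face_of P" "F \<noteq> P" "C \<subseteq> F"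
    show "F = C"
    proof (rule ccontr)
      assume "F \<noteq> C"
      have cP: "convex P" using P polyhedron_imp_convex by blast
      have "C face_of F" using CF F face_of_subset face_of_imp_subset by metis
      then have "aff_dim C < aff_dim F"
        using face_of_aff_dim_lt face_of_imp_convex F(1) \<open>F \<noteq> C\<close> by blast
      moreover have "aff_dim F < aff_dim P" using face_of_aff_dim_lt F cP by blast
      ultimately show False using fc by (auto simp: facet_of_def)
    qed
  qed
next
  assume *: "C face_of P \<and> C \<noteq> P \<and> (\<forall>F. F face_of P \<longrightarrow> F \<noteq> P \<longrightarrow> C \<subseteq> F \<longrightarrow> F = C)"
  then obtain F where "F facet_of P" "C \<subseteq> F" using face_of_polyhedron_subset_facet[OF P] C by metis
  with * show "C facet_of P" using facet_of_imp_face_of by (metis facet_of_irrefl)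
qed

text \<open>All later arguments see the combinatorial equivalence only through this labelling: an
  index for each pair of opposite facets and a bit for the side.\<close>

definition cubical_facets :: "'p::euclidean_space set \<Rightarrow> ('n::finite \<times> bool \<Rightarrow> 'p set) \<Rightarrow> bool" where
  "cubical_facets P G \<longleftrightarrow> inj G \<and> range G = {F. F facet_of P} \<and>
     (\<forall>i. G (i, False) \<inter> G (i, True) = {}) \<and> (\<forall>b. \<exists>v. (\<Inter>i. G (i, b i)) = {v})"

lemma cubical_facets_exist:
  fixes P :: "'p::euclidean_space set"
  assumes P: "polytope P" and eq: "combinatorially_equivalent P (cbox 0 1 :: ('n::finite rspace) set)"
  obtains G :: "'n::finite \<times> bool \<Rightarrow> 'p set" where "cubical_facets P G"
proof -
  let ?C = "cbox 0 1 :: 'n rspace set"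
  obtain \<Phi> where bij: "bij_betw \<Phi> {F. F face_of P} {G. G face_of ?C}"
    and mono: "\<And>F F'. F face_of P \<Longrightarrow> F' face_of P \<Longrightarrow> \<Phi> F \<subseteq> \<Phi> F' \<longleftrightarrow> F \<subseteq> F'"
    using eq unfolding combinatorially_equivalent_def by blast
  have poly: "polyhedron P" using P polytope_imp_polyhedron by blast
  have cP: "convex P" using P polytope_imp_convex by blast
  have \<Phi>: "\<Phi> F face_of ?C" if "F face_of P" for F using bij that by (auto simp: bij_betw_def)
  have inj: "F = F'" if "F face_of P" "F' face_of P" "\<Phi> F = \<Phi> F'" for F F'
    using mono that by blast
  define \<Psi> where "\<Psi> = inv_into {F. F face_of P} \<Phi>"
  have \<Psi>: "\<Psi> K face_of P" "\<Phi> (\<Psi> K) = K" if "K face_of ?C" for K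
    using bij_betwE[OF bij_betw_inv_into[OF bij]] bij_betw_inv_into_right[OF bij] that
    unfolding \<Psi>_def by auto
  have empty: "\<Phi> {} = {}"
    using mono[of "{}" "\<Psi> {}"] \<Psi>[of "{}"] by auto
  have emptyD: "F = {}" if "F face_of P" "\<Phi> F = {}" for F using inj[of F "{}"] that empty by auto
  have full: "\<Phi> P = ?C"
  proof -
    have "?C face_of ?C" by (simp add: face_of_refl)
    then have "?C \<subseteq> \<Phi> P" using mono[OF \<Psi>(1) face_of_refl[OF cP]] \<Psi> face_of_imp_subset[OF \<Psi>(1)] by auto
    then show ?thesis using \<Phi>[OF face_of_refl[OF cP]] face_of_imp_subset by blast
  qed
  define G where "G f = \<Psi> (cube_facet f)" for f
  have G: "G f face_of P" "\<Phi> (G f) = cube_facet f" for f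
    using \<Psi>[OF cube_facet_face] by (auto simp: G_def)
  have Gne: "G f \<noteq> {}" for f using G(2)[of f] empty cube_facet_neq(2)[of f] by metis
  have "inj G"
    by (rule injI) (use G(2) inj_cube_facet in \<open>metis injD\<close>)
  moreover have "F \<in> range G \<longleftrightarrow> F facet_of P" for F
  proof
    assume "F \<in> range G"
    then obtain f where f: "F = G f" by blast
    have "G f \<noteq> P" using G(2)[of f] full cube_facet_neq(1)[of f] by metis
    moreover have "K = G f" if K: "K face_of P" "K \<noteq> P" "G f \<subseteq> K" for K
    proof -
      have "\<Phi> K \<noteq> ?C" using K(2) inj[OF K(1) face_of_refl[OF cP]] unfolding full by blast
      moreover have "cube_facet f \<subseteq> \<Phi> K" using mono[OF G(1) K(1)] G(2) K(3) by simp
      ultimately have "\<Phi> K = \<Phi> (G f)" using cube_facet_maximal[OF \<Phi>[OF K(1)]] by (simp add: G(2))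
      then show ?thesis by (rule inj[OF K(1) G(1)])
    qed
    ultimately show "F facet_of P"
      unfolding f polyhedron_facet_iff_maximal_face[OF poly Gne] using G(1) by simp
  next
    assume F: "F facet_of P"
    then have ne: "F \<noteq> {}" by (auto simp: facet_of_def)
    then have max: "F face_of P" "F \<noteq> P" "\<And>K. K face_of P \<Longrightarrow> K \<noteq> P \<Longrightarrow> F \<subseteq> K \<Longrightarrow> K = F"
      using F unfolding polyhedron_facet_iff_maximal_face[OF poly ne] by blast+
    have "\<Phi> F \<noteq> ?C" using max(2) inj[OF max(1) face_of_refl[OF cP]] unfolding full by blast
    then obtain f where "\<Phi> F \<subseteq> cube_facet f" by (rule cube_face_subset_facet[OF \<Phi>[OF max(1)]])
    then have "F \<subseteq> G f" using mono[OF max(1) G(1)] G(2) by simp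
    moreover have "G f \<noteq> P" using G(2)[of f] full cube_facet_neq(1)[of f] by metis
    ultimately have "G f = F" by (intro max(3)[OF G(1)])
    then show "F \<in> range G" by blast
  qed
  moreover have "G (i, False) \<inter> G (i, True) = {}" for i
  proof -
    let ?H = "G (i, False) \<inter> G (i, True)"
    have H: "?H face_of P" using G by (simp add: face_of_Int)
    then have "\<Phi> ?H \<subseteq> cube_facet (i, False) \<inter> cube_facet (i, True)"
      using mono[OF H G(1)[of "(i, False)"]] mono[OF H G(1)[of "(i, True)"]] by (simp add: G(2))
    then have "\<Phi> ?H = {}" by (fastforce simp: cube_facet_def)
    then show ?thesis using emptyD H by blast
  qed
  moreover have "\<exists>v. (\<Inter>i. G (i, b i)) = {v}" for b :: "'n \<Rightarrow> bool"
  proof -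
    define H where "H = (\<Inter>i. G (i, b i))"
    define w :: "'n rspace" where "w = (\<chi> i. of_bool (b i))"
    have wc: "w \<in> cube_facet (i, b i)" for i by (auto simp: w_def cube_facet_def mem_cube)
    have only: "(\<Inter>i. cube_facet (i, b i)) = {w}"
      using wc by (auto simp: cube_facet_def w_def vec_eq_iff)
    have "(\<Inter>i. cube_facet (i, b i)) face_of ?C"
      by (rule face_of_Inter) (use cube_facet_face in auto)
    then have wf: "{w} face_of ?C" using only by simp
    have H: "H face_of P" unfolding H_def by (rule face_of_Inter) (use G in auto)
    \<comment> \<open>Faces of \<open>P\<close> inside \<open>H\<close> have image in the single
      vertex \<open>w\<close> of the cube. Hence all nonempty ones coincide, and \<open>H\<close>
      equals any of its extreme points.\<close>
    have sub: "\<Phi> K \<subseteq> {w}" if "K face_of P" "K \<subseteq> H" for K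
    proof -
      have "\<Phi> K \<subseteq> cube_facet (i, b i)" for i
        using mono[OF that(1) G(1)[of "(i, b i)"]] that(2) by (auto simp: H_def G(2))
      then show ?thesis using only by blast
    qed
    have "\<Psi> {w} \<subseteq> G (i, b i)" for i
      using mono[OF \<Psi>(1)[OF wf] G(1)[of "(i, b i)"]] \<Psi>(2)[OF wf] wc[of i] by (simp add: G(2))
    then have "\<Psi> {w} \<subseteq> H" by (auto simp: H_def)
    moreover have "\<Psi> {w} \<noteq> {}" using \<Psi>(2)[OF wf] empty by fastforce
    ultimately have Hne: "H \<noteq> {}" by blast
    have Hpoly: "polytope H" using P H face_of_polytope_polytope by blast
    then obtain v where v: "v extreme_point_of H"
      using Hne extreme_point_exists_convex polytope_imp_compact polytope_imp_convex by blast
    then have vf: "{v} face_of H" by (simp add: face_of_singleton)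
    then have vP: "{v} face_of P" using H face_of_trans by blast
    have "\<Phi> {v} = {w}" using sub[OF vP face_of_imp_subset[OF vf]] emptyD[OF vP] by (metis insert_not_empty subset_singletonD)
    moreover have "\<Phi> H = {w}" using sub[OF H order_refl] emptyD[OF H] Hne by (metis subset_singletonD)
    ultimately have "H = {v}" by (intro inj[OF H vP]) simp
    then show ?thesis unfolding H_def by (rule exI)
  qed
  ultimately show ?thesis by (intro that[of G]) (simp add: cubical_facets_def set_eq_iff[of "range G"])
qed

text \<open>Along a segment from a relative interior point \<open>z\<close> to \<open>w\<close> all
  facet inequalities are strict before \<open>w\<close>. If \<open>w\<close> were outside
  \<open>P\<close>, the part of the segment in \<open>P\<close> would lie in the relative interior,
  so it would be open and closed in the segment, which is connected.\<close>

lemma mem_polyhedron_if_facet_inequalities: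
  fixes P :: "'p::euclidean_space set"
  assumes P: "polyhedron P" and ne: "P \<noteq> {}"
    and sub: "\<And>F. F facet_of P \<Longrightarrow> P \<subseteq> {x. a F \<bullet> x \<ge> b F}"
    and F: "\<And>F. F facet_of P \<Longrightarrow> F = P \<inter> {x. a F \<bullet> x = b F}"
    and w: "w \<in> affine hull P" "\<And>F. F facet_of P \<Longrightarrow> a F \<bullet> w \<ge> b F"
  shows "w \<in> P"
proof (rule ccontr)
  assume wP: "w \<notin> P"
  have cP: "convex P" and clP: "closed P" using P polyhedron_imp_convex polyhedron_imp_closed by auto
  obtain z where z: "z \<in> rel_interior P" using ne cP rel_interior_eq_empty by blast
  then have zP: "z \<in> P" using rel_interior_subset by blast
  have rel: "rel_interior P = P - \<Union>{F. F facet_of P}" by (rule rel_interior_of_polyhedron[OF P])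
  have int: "x \<in> rel_interior P" if x: "x \<in> closed_segment z w" "x \<in> P" for x
  proof -
    obtain u where u: "0 \<le> u" "u \<le> 1" "x = (1 - u) *\<^sub>R z + u *\<^sub>R w" using x by (auto simp: in_segment)
    have "u \<noteq> 1" using u x wP by auto
    have "a F \<bullet> x > b F" if f: "F facet_of P" for F
    proof -
      have "z \<notin> F" using z rel f by blast
      then have "a F \<bullet> z > b F" using sub[OF f] F[OF f] zP by fastforce
      then have "(1 - u) * (a F \<bullet> z) > (1 - u) * b F" using u \<open>u \<noteq> 1\<close> by simp
      moreover have "u * (a F \<bullet> w) \<ge> u * b F" using w(2)[OF f] u by (simp add: mult_left_mono)
      moreover have "a F \<bullet> x = (1 - u) * (a F \<bullet> z) + u * (a F \<bullet> w)" by (simp add: u(3) inner_simps)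
      moreover have "(1 - u) * b F + u * b F = b F" by (simp add: algebra_simps)
      ultimately show ?thesis by linarith
    qed
    then have "x \<notin> F" if "F facet_of P" for F using F[OF that] that by (metis (mono_tags, lifting) IntD2 less_irrefl mem_Collect_eq)
    then show ?thesis unfolding rel using x(2) by blast
  qed
  have zH: "z \<in> affine hull P" using zP hull_subset by (metis subsetD)
  have segH: "closed_segment z w \<subseteq> affine hull P"
    by (rule closed_segment_subset[OF zH w(1) affine_imp_convex[OF affine_affine_hull]])
  obtain T where T: "open T" "rel_interior P = affine hull P \<inter> T"
    using openin_rel_interior[of P] openin_open by blast
  have "closed_segment z w \<inter> P = closed_segment z w \<inter> T"
    using int T(2) segH rel_interior_subset[of P] by blast
  then have o: "openin (top_of_set (closed_segment z w)) (closed_segment z w \<inter> P)" using T(1) by (simp add: openin_open_Int)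
  have c: "closedin (top_of_set (closed_segment z w)) (closed_segment z w \<inter> P)"
    using clP by (simp add: closedin_closed_Int)
  have "closed_segment z w \<inter> P = {} \<or> closed_segment z w \<inter> P = closed_segment z w"
    using connected_segment(1)[of z w] o c unfolding connected_clopen by blast
  then show False using zP wP by auto
qed

text \<open>The combination of \<open>r0\<close> and \<open>r1\<close> that is orthogonal to
  \<open>e\<close>, put into row \<open>k\<close>, makes all rows orthogonal to the nonzero vector
  \<open>e\<close>. Its determinant vanishes, and linearity in that row gives the identity, which
  compares signs when one row is replaced.\<close>

lemma det_row_exchange:
  fixes \<rho> :: "'n::finite \<Rightarrow> real ^ 'n"
  assumes e: "\<And>j. j \<noteq> k \<Longrightarrow> \<rho> j \<bullet> e = 0" and pos: "r0 \<bullet> e > 0"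
  shows "(r1 \<bullet> e) * det (\<chi> i. if i = k then r0 else \<rho> i) = (r0 \<bullet> e) * det (\<chi> i. if i = k then r1 else \<rho> i)"
proof -
  let ?A = "\<chi> i. if i = k then (r1 \<bullet> e) *s r0 + (- (r0 \<bullet> e)) *s r1 else \<rho> i"
  have "?A *v e = 0"
    using e by (auto simp: vec_eq_iff matrix_vector_mul_component inner_simps scalar_mult_eq_scaleR)
  moreover have "e \<noteq> 0" using pos by auto
  ultimately have "det ?A = 0"
    using invertible_det_nz[of ?A] invertible_left_inverse[of ?A] matrix_left_invertible_ker[of ?A] by blast
  moreover have "det ?A = (r1 \<bullet> e) * det (\<chi> i. if i = k then r0 else \<rho> i)
      + (- (r0 \<bullet> e)) * det (\<chi> i. if i = k then r1 else \<rho> i)"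
    unfolding det_row_add[of k "\<lambda>_. (r1 \<bullet> e) *s r0" "\<lambda>_. (- (r0 \<bullet> e)) *s r1" \<rho>]
      det_row_mul[of k _ "\<lambda>_. r0" \<rho>] det_row_mul[of k _ "\<lambda>_. r1" \<rho>] ..
  ultimately show ?thesis by simp
qed

text \<open>The rows are mixed one after the other, with \<open>K\<close> the set of rows already
  treated and \<open>b\<close> arbitrary on the rest. By linearity in a row, each step is a convex
  combination of two determinants already known to have the right sign.\<close>

lemma det_convex_combination_rows:
  fixes R0 R1 :: "'n::finite \<Rightarrow> real ^ 'n"
  assumes pos: "\<And>b. 0 < s * det (\<chi> i. if b i then R1 i else R0 i)"
    and c: "\<And>i. 0 \<le> c i \<and> c i \<le> 1"
  shows "0 < s * det (\<chi> i. (1 - c i) *s R0 i + c i *s R1 i)"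
proof -
  have "0 < s * det (\<chi> i. if i \<in> K then (1 - c i) *s R0 i + c i *s R1 i
      else if b i then R1 i else R0 i)" if "finite K" for K b
    using that
  proof (induction K arbitrary: b rule: finite_induct)
    case empty
    then show ?case using pos by simp
  next
    case (insert k K)
    let ?mix = "\<lambda>i. (1 - c i) *s R0 i + c i *s R1 i"
    let ?\<rho> = "\<lambda>i. if i \<in> K then ?mix i else if b i then R1 i else R0 i"
    let ?D = "\<lambda>r. det (\<chi> i. if i = k then r else ?\<rho> i)"
    have "(\<chi> i. if i \<in> insert k K then ?mix i else if b i then R1 i else R0 i)
        = (\<chi> i. if i = k then (1 - c i) *s R0 i + c i *s R1 i else ?\<rho> i)"
      by (auto simp: vec_eq_iff)
    moreover have "det (\<chi> i. if i = k then (1 - c i) *s R0 i + c i *s R1 i else ?\<rho> i)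
        = det (\<chi> i. if i = k then (1 - c k) *s R0 k + c k *s R1 k else ?\<rho> i)"
      by (rule arg_cong[where f = det]) (auto simp: vec_eq_iff)
    moreover have "\<dots> = (1 - c k) * ?D (R0 k) + c k * ?D (R1 k)"
      unfolding det_row_add[of k "\<lambda>_. (1 - c k) *s R0 k" "\<lambda>_. c k *s R1 k" ?\<rho>]
        det_row_mul[of k _ "\<lambda>_. R0 k" ?\<rho>] det_row_mul[of k _ "\<lambda>_. R1 k" ?\<rho>] ..
    moreover have "?D (R0 k) = det (\<chi> i. if i \<in> K then ?mix i else if (b(k := False)) i then R1 i else R0 i)"
      "?D (R1 k) = det (\<chi> i. if i \<in> K then ?mix i else if (b(k := True)) i then R1 i else R0 i)"
      using insert.hyps by (auto intro!: arg_cong[where f = det] simp: vec_eq_iff)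
    ultimately have eq: "s * det (\<chi> i. if i \<in> insert k K then ?mix i else if b i then R1 i else R0 i)
       = (1 - c k) * (s * ?D (R0 k)) + c k * (s * ?D (R1 k))" and
       p: "0 < s * ?D (R0 k)" "0 < s * ?D (R1 k)"
      using insert.IH[of "b(k := False)"] insert.IH[of "b(k := True)"]
      by (simp_all only: distrib_left mult.left_commute[of s])
    have "0 < (1 - c k) * (s * ?D (R0 k)) + c k * (s * ?D (R1 k))"
    proof (cases "c k = 0")
      case False
      show ?thesis
        by (rule add_nonneg_pos[OF mult_nonneg_nonneg[OF _ less_imp_le[OF p(1)]] mult_pos_pos[OF _ p(2)]])
          (use c[of k] False in auto)
    qed (use p in simp)
    with eq show ?case by (simp only:)
  qed
  from this[of UNIV] show ?thesis by simp
qed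

text \<open>In the application \<open>b\<close> runs over the vertices of a polytope and
  \<open>e\<close> is the direction of the edge between two vertices differing in the bit
  \<open>k\<close>. By \<open>det_row_exchange\<close> the sign is the same at both ends of an edge,
  and flipping bits one by one reaches every vertex.\<close>

lemma det_same_sign:
  fixes R0 R1 :: "'n::finite \<Rightarrow> real ^ 'n"
  assumes nz: "\<And>b. det (\<chi> i. if b i then R1 i else R0 i) \<noteq> 0"
    and e: "\<And>b k. \<exists>e. (\<forall>j. j \<noteq> k \<longrightarrow> (if b j then R1 j else R0 j) \<bullet> e = 0) \<and> R0 k \<bullet> e > 0 \<and> R1 k \<bullet> e > 0"
  obtains s where "\<And>b. 0 < s * det (\<chi> i. if b i then R1 i else R0 i)"
proof -
  let ?D = "\<lambda>b. det (\<chi> i. if b i then R1 i else R0 i)"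
  have "0 < ?D (\<lambda>i. False) * ?D (\<lambda>i. i \<in> K)" if "finite K" for K
    using that
  proof (induction K rule: finite_induct)
    case empty
    have "0 < x * x" if "x \<noteq> 0" for x :: real using that not_real_square_gt_zero by blast
    from this[OF nz[of "\<lambda>i. False"]] show ?case by (simp only: empty_iff)
  next
    case (insert k K)
    let ?\<rho> = "\<lambda>i. if i \<in> K then R1 i else R0 i"
    obtain e where e1: "\<And>j. j \<noteq> k \<Longrightarrow> ?\<rho> j \<bullet> e = 0" "R0 k \<bullet> e > 0" "R1 k \<bullet> e > 0"
      using e[of k "\<lambda>i. i \<in> K"] by blast
    have D: "?D (\<lambda>i. i \<in> K) = det (\<chi> i. if i = k then R0 k else ?\<rho> i)"
      "?D (\<lambda>i. i \<in> insert k K) = det (\<chi> i. if i = k then R1 k else ?\<rho> i)"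
      using insert.hyps by (auto intro!: arg_cong[where f = det] simp: vec_eq_iff)
    have "(R1 k \<bullet> e) * ?D (\<lambda>i. i \<in> K) = (R0 k \<bullet> e) * ?D (\<lambda>i. i \<in> insert k K)"
      unfolding D by (rule det_row_exchange[OF e1(1,2)])
    moreover have "0 < d * q" if "x * p = y * q" "0 < x" "0 < y" "0 < d * p" for x y d p q :: real
    proof -
      have "0 < x * (d * p)" using that by simp
      also have "x * (d * p) = y * (d * q)" using that(1) by (metis mult.left_commute)
      finally show ?thesis using that(3) by (simp add: zero_less_mult_iff)
    qed
    ultimately show ?case using e1(2,3) insert.IH by blast
  qed
  from this[of "{i. b i}" for b] have "0 < ?D (\<lambda>i. False) * ?D b" for b by simp
  then show ?thesis by (rule that)
qed

text \<open>\<open>P\<close> may sit in a space of larger dimension. Coordinates on the direction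
  space of its affine hull allow facet normals to be arranged in square matrices.\<close>

lemma affine_hull_linear_coordinates:
  fixes P :: "'p::euclidean_space set"
  assumes dim: "aff_dim P = int CARD('n::finite)"
  obtains T :: "real ^ 'n::finite \<Rightarrow> 'p" where "linear T" "\<And>u x. x \<in> affine hull P \<Longrightarrow> x + T u \<in> affine hull P"
    "\<And>x y. x \<in> affine hull P \<Longrightarrow> y \<in> affine hull P \<Longrightarrow> \<exists>u. x - y = T u" "\<And>u. T u = 0 \<Longrightarrow> u = 0"
proof -
  have "P \<noteq> {}" using dim by auto
  then obtain p where p: "p \<in> affine hull P" by fastforce
  define L where "L = (\<lambda>x. x - p) ` (affine hull P)"
  have L: "subspace L" unfolding L_def
    using affine_diffs_subspace_subtract[OF affine_affine_hull p] .
  have "aff_dim (affine hull P) = aff_dim L"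
    unfolding L_def using aff_dim_translation_eq_subtract[of p "affine hull P"] by simp
  then have "int (dim L) = int CARD('n)"
    using dim aff_dim_subspace[OF L] by simp
  then have "dim (UNIV :: (real ^ 'n) set) = dim L" by simp
  then obtain T :: "real ^ 'n \<Rightarrow> 'p" where T: "linear T" "T ` UNIV = L" "\<And>x. x \<in> UNIV \<Longrightarrow> norm (T x) = norm x"
    using isometry_subspaces[OF subspace_UNIV L] by metis
  show ?thesis
  proof
    show "linear T" by (rule T(1))
    fix u assume "T u = 0" then show "u = 0" using T(3)[of u] by simp
  next
    fix u x assume x: "x \<in> affine hull P"
    have "T u \<in> L" "x - p \<in> L" using T(2) x L_def by auto
    then have "x - p + T u \<in> L" using L subspace_add by blast
    then show "x + T u \<in> affine hull P" unfolding L_def by (auto simp: algebra_simps)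
  next
    fix x y assume "x \<in> affine hull P" "y \<in> affine hull P"
    then have "x - p \<in> L" "y - p \<in> L" using L_def by auto
    then have "(x - p) - (y - p) \<in> L" using L subspace_diff by blast
    then show "\<exists>u. x - y = T u" using T(2) by auto
  qed
qed

lemma cube_eq_closure:
  fixes y :: "'n::finite rspace"
  assumes "y \<in> cbox 0 1" "closed S" "box 0 1 \<subseteq> S"
  shows "y \<in> S"
proof -
  have "box (0::'n rspace) 1 \<noteq> {}" by (simp add: interval_ne_empty_cart)
  then have "closure (box (0::'n rspace) 1) = cbox 0 1" by (rule closure_box)
  then show ?thesis using assms closure_minimal by blast
qed

text \<open>Faces are determined by incidence with facets, so a homeomorphism that matches the
  facets of \<open>P\<close> with those of the cube matches all faces. Intersecting with
  \<open>P\<close> makes the empty index set yield \<open>P\<close> itself.\<close>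

lemma faces_of_cubical_polytope:
  fixes P :: "'p::euclidean_space set"
  assumes P: "polyhedron P" and G: "cubical_facets P (G :: 'n::finite \<times> bool \<Rightarrow> 'p set)"
    and F: "F \<subseteq> P"
  shows "F face_of P \<longleftrightarrow> F = {} \<or> (\<exists>I. F = P \<inter> (\<Inter>f\<in>I. G f))"
proof
  assume F: "F face_of P"
  show "F = {} \<or> (\<exists>I. F = P \<inter> (\<Inter>f\<in>I. G f))"
  proof (cases "F = {} \<or> F = P")
    case True
    moreover have "P = P \<inter> (\<Inter>f\<in>{}. G f)" by simp
    ultimately show ?thesis by metis
  next
    case False
    then have "F = \<Inter>{C. C facet_of P \<and> F \<subseteq> C}" using face_of_polyhedron[OF P F] by blast
    also have "{C. C facet_of P \<and> F \<subseteq> C} = {C \<in> range G. F \<subseteq> C}"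
      using G unfolding cubical_facets_def by simp
    also have "\<dots> = G ` {f. F \<subseteq> G f}" by blast
    finally have "F = (\<Inter>f\<in>{f. F \<subseteq> G f}. G f)" .
    then have "F = P \<inter> (\<Inter>f\<in>{f. F \<subseteq> G f}. G f)" using face_of_imp_subset[OF F] by (metis inf_absorb2)
    then show ?thesis by (intro disjI2 exI)
  qed
next
  assume *: "F = {} \<or> (\<exists>I. F = P \<inter> (\<Inter>f\<in>I. G f))"
  have "G f face_of P" for f using G facet_of_imp_face_of unfolding cubical_facets_def by blast
  moreover have "P face_of P" using P by (simp add: face_of_refl polyhedron_imp_convex)
  ultimately have "P \<inter> (\<Inter>f\<in>I. G f) face_of P" for I
    using face_of_Inter[of "insert P (G ` I)" P] by force
  with * show "F face_of P" using empty_face_of by blast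
qed

lemma polyhedron_facet_functionals:
  fixes P :: "'p::euclidean_space set"
  assumes P: "polyhedron P"
  obtains a b where "\<And>F. F facet_of P \<Longrightarrow> P \<subseteq> {x. a F \<bullet> x \<ge> b F}"
    "\<And>F. F facet_of P \<Longrightarrow> F = P \<inter> {x. a F \<bullet> x = b F}"
proof -
  have "\<exists>a b. P \<subseteq> {x. a \<bullet> x \<ge> b} \<and> F = P \<inter> {x. a \<bullet> x = b}" if "F facet_of P" for F
  proof -
    obtain a b where "P \<subseteq> {x. a \<bullet> x \<le> b}" "F = P \<inter> {x. a \<bullet> x = b}"
      using facet_of_polyhedron[OF P \<open>F facet_of P\<close>] by metis
    then have "P \<subseteq> {x. (-a) \<bullet> x \<ge> -b} \<and> F = P \<inter> {x. (-a) \<bullet> x = -b}" by auto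
    then show ?thesis by blast
  qed
  then show ?thesis using that by metis
qed

lemma cubical_facets_cube: "cubical_facets (cbox (0 :: 'n::finite rspace) 1) cube_facet"
  unfolding cubical_facets_def
proof (intro conjI allI)
  show "inj cube_facet" by (rule inj_cube_facet)
  show "range cube_facet = {F. F facet_of cbox (0 :: 'n rspace) 1}"
  proof (intro set_eqI iffI)
    fix F :: "'n rspace set" assume "F \<in> range cube_facet"
    then obtain f where F: "F = cube_facet f" by blast
    show "F \<in> {F. F facet_of cbox 0 1}"
      unfolding F mem_Collect_eq
        polyhedron_facet_iff_maximal_face[OF polytope_imp_polyhedron[OF polytope_interval] cube_facet_neq(2)]
      by (intro conjI allI impI cube_facet_face cube_facet_neq(1) cube_facet_maximal)
  next
    fix F :: "'n rspace set" assume "F \<in> {F. F facet_of cbox 0 1}"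
    then have F: "F facet_of cbox 0 1" by simp
    then have ne: "F \<noteq> {}" by (auto simp: facet_of_def)
    have m: "F face_of cbox 0 1" "F \<noteq> cbox 0 1"
      "\<And>K. K face_of cbox 0 1 \<Longrightarrow> K \<noteq> cbox 0 1 \<Longrightarrow> F \<subseteq> K \<Longrightarrow> K = F"
      using F unfolding polyhedron_facet_iff_maximal_face[OF polytope_imp_polyhedron[OF polytope_interval] ne]
      by blast+
    obtain f where "F \<subseteq> cube_facet f" using cube_face_subset_facet[OF m(1,2)] .
    then show "F \<in> range cube_facet" using m(3)[OF cube_facet_face cube_facet_neq(1)] by blast
  qed
  show "cube_facet (i, False) \<inter> cube_facet (i, True) = ({} :: 'n rspace set)" for i
    by (auto simp: cube_facet_def)
  show "\<exists>v. (\<Inter>i. cube_facet (i, b i)) = {v :: 'n rspace}" for b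
    by (rule exI[of _ "\<chi> i. of_bool (b i)"]) (auto simp: cube_facet_def mem_cube vec_eq_iff)
qed

text \<open>The \<open>i\<close>-th coordinate of the inverse homeomorphism is \<open>l\<^sub>0 / (l\<^sub>0 + l\<^sub>1)\<close>, where \<open>l\<^sub>0\<close> and \<open>l\<^sub>1\<close>
  are affine functions cutting out the \<open>i\<close>-th pair of opposite facets. Its fibres are intersections
  of hyperplanes whose normals are convex combinations of the facet normals; the determinants at
  the vertices of \<open>P\<close> all have the same sign, hence so do these, being multilinear.\<close>

lemma cubical_polytope_homeomorphism:
  fixes P :: "'p::euclidean_space set"
  assumes poly: "polytope P" and dim: "aff_dim P = int CARD('n::finite)"
    and G: "cubical_facets P (G :: 'n::finite \<times> bool \<Rightarrow> 'p set)"
  obtains h :: "'n::finite rspace \<Rightarrow> 'p" where "face_homeomorphism (cbox 0 1) P h"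
    "\<And>y f. y \<in> cbox 0 1 \<Longrightarrow> h y \<in> G f \<longleftrightarrow> f \<in> cube_facets_at y"
proof -
  have P: "polyhedron P" using poly polytope_imp_polyhedron by blast
  have ne: "P \<noteq> {}" using dim by auto
  have facet: "G f facet_of P" for f using G unfolding cubical_facets_def by blast
  have facet': "\<exists>f. F = G f" if "F facet_of P" for F using G that unfolding cubical_facets_def by blast
  have GP: "G f \<subseteq> P" for f using facet facet_of_imp_subset by blast
  have disj: "G (i, False) \<inter> G (i, True) = {}" for i using G unfolding cubical_facets_def by blast
  have "\<exists>v. (\<Inter>i. G (i, b i)) = {v}" for b using G unfolding cubical_facets_def by blast
  then obtain v where v: "\<And>b. (\<Inter>i. G (i, b i)) = {v b}" by metis
  have vG: "v b \<in> G (i, b i)" for b i using v[of b] by blast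
  have vP: "v b \<in> P" for b using vG GP by blast
  obtain a' b' where a': "\<And>F. F facet_of P \<Longrightarrow> P \<subseteq> {x. a' F \<bullet> x \<ge> b' F}"
    "\<And>F. F facet_of P \<Longrightarrow> F = P \<inter> {x. a' F \<bullet> x = b' F}"
    using polyhedron_facet_functionals[OF P] by metis
  define a where "a f = a' (G f)" for f
  define l where "l f x = a f \<bullet> x - b' (G f)" for f x
  have l0: "l f x \<ge> 0" if "x \<in> P" for f x using subsetD[OF a'(1)[OF facet[of f]] that] unfolding l_def a_def by simp
  have lG: "x \<in> G f \<longleftrightarrow> l f x = 0" if "x \<in> P" for f x
    using a'(2)[OF facet, of f] that unfolding l_def a_def by auto
  have ldiff: "l f x - l f y = a f \<bullet> (x - y)" for f x y by (simp add: l_def inner_simps)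
  have lP: "x \<in> P" if "x \<in> affine hull P" "\<And>f. l f x \<ge> 0" for x
  proof (rule mem_polyhedron_if_facet_inequalities[OF P ne a' that(1)])
    fix F assume "F facet_of P"
    then obtain f where "F = G f" using facet' by blast
    then show "b' F \<le> a' F \<bullet> x" using that(2)[of f] by (simp add: l_def a_def)
  qed
  have lsum: "l (i, False) x + l (i, True) x > 0" if "x \<in> P" for i x
    using disj[of i] lG[OF that] l0[OF that, of "(i, False)"] l0[OF that, of "(i, True)"]
    by (cases "l (i, False) x = 0"; cases "l (i, True) x = 0") auto
  obtain T :: "real ^ 'n \<Rightarrow> 'p" where T: "linear T"
    "\<And>u x. x \<in> affine hull P \<Longrightarrow> x + T u \<in> affine hull P"
    "\<And>x y. x \<in> affine hull P \<Longrightarrow> y \<in> affine hull P \<Longrightarrow> \<exists>u. x - y = T u" "\<And>u. T u = 0 \<Longrightarrow> u = 0"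
    using affine_hull_linear_coordinates[OF dim] by metis
  have PH: "x \<in> affine hull P" if "x \<in> P" for x using that by (rule hull_inc)
  define r where "r f = adjoint T (a f)" for f
  have r: "r f \<bullet> u = a f \<bullet> T u" for f u unfolding r_def using adjoint_works[OF T(1)] by (simp add: inner_commute)
  define R0 where "R0 i = r (i, False)" for i
  \<comment> \<open>The sign turns both rows towards the side of \<open>(i, True)\<close>. The fibre
    of the \<open>i\<close>-th coordinate over \<open>c\<close> has the equation
    \<open>(1 - c) * l (i, False) x - c * l (i, True) x = 0\<close>, whose linear part is the
    combination of \<open>R0 i\<close> and \<open>R1 i\<close> with weights \<open>1 - c\<close> and
    \<open>c\<close>.\<close>
  define R1 where "R1 i = - r (i, True)" for i
  have nz: "det (\<chi> i. if b i then R1 i else R0 i) \<noteq> 0" for b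
  proof -
    have "u = 0" if u: "(\<chi> i. if b i then R1 i else R0 i) *v u = 0" for u
    proof -
      have ru: "a (i, b i) \<bullet> T u = 0" for i
        using u by (cases "b i") (auto simp: vec_eq_iff matrix_vector_mul_component R0_def R1_def r dest!: spec[of _ i] split: if_splits)
      \<comment> \<open>Small enough for the inequalities that are strict at \<open>v b\<close> to
        survive; the tight ones do not change, as \<open>u\<close> is in the kernel of their
        normals. A nonzero \<open>u\<close> would thus give a second common point of the facets
        \<open>G (i, b i)\<close>.\<close>
      define e where "e = Min (insert 1 ((\<lambda>f. l f (v b) / (1 + \<bar>a f \<bullet> T u\<bar>)) ` {f. l f (v b) > 0}))"
      have "e > 0" unfolding e_def
        by (subst Min_gr_iff) (auto intro!: divide_pos_pos add_pos_nonneg)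
      have "v b + T (e *\<^sub>R u) \<in> P"
      proof (rule lP)
        show "v b + T (e *\<^sub>R u) \<in> affine hull P" using T(2) vP PH by blast
        fix f
        have eq: "l f (v b + T (e *\<^sub>R u)) = l f (v b) + e * (a f \<bullet> T u)"
          by (simp add: l_def inner_simps linear_scale[OF T(1)])
        show "l f (v b + T (e *\<^sub>R u)) \<ge> 0"
        proof (cases "l f (v b) > 0")
          case True
          then have "e \<le> l f (v b) / (1 + \<bar>a f \<bullet> T u\<bar>)" unfolding e_def by (intro Min_le) auto
          then have "e * (1 + \<bar>a f \<bullet> T u\<bar>) \<le> l f (v b)" by (simp add: pos_le_divide_eq add_pos_nonneg)
          moreover have "e * (- (a f \<bullet> T u)) \<le> e * (1 + \<bar>a f \<bullet> T u\<bar>)"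
            using \<open>e > 0\<close> by (intro mult_left_mono) linarith+
          ultimately show ?thesis unfolding eq by simp
        next
          case False
          then have z: "l f (v b) = 0" using l0[OF vP[of b], of f] by linarith
          obtain i c where f: "f = (i, c)" by fastforce
          have "v b \<in> G (i, c)" using lG[OF vP] z f by blast
          then have "c = b i" using vG[of b i] disj[of i] by (cases c; cases "b i") auto
          then show ?thesis unfolding eq using z f ru[of i] by simp
        qed
      qed
      moreover have "l (i, b i) (v b + T (e *\<^sub>R u)) = 0" for i
        using ru[of i] lG[OF vP[of b], of "(i, b i)"] vG[of b i] by (simp add: l_def inner_simps linear_scale[OF T(1)])
      ultimately have "v b + T (e *\<^sub>R u) \<in> (\<Inter>i. G (i, b i))" using lG by blast
      then have "T (e *\<^sub>R u) = 0" unfolding v by simp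
      then show "u = 0" using T(4)[of "e *\<^sub>R u"] \<open>e > 0\<close> by simp
    qed
    then have "invertible (\<chi> i. if b i then R1 i else R0 i)"
      using matrix_left_invertible_ker invertible_left_inverse by blast
    then show ?thesis using invertible_det_nz by blast
  qed
  obtain s where s: "\<And>b. 0 < s * det (\<chi> i. if b i then R1 i else R0 i)"
  proof (rule det_same_sign[OF nz])
    fix b :: "'n \<Rightarrow> bool" and k
    let ?v0 = "v (b(k := False))" and ?v1 = "v (b(k := True))"
    \<comment> \<open>The edge between two vertices that differ in the bit \<open>k\<close> only: it
      stays on the other facets and runs from \<open>G (k, False)\<close> to
      \<open>G (k, True)\<close>.\<close>
    obtain e where e: "?v1 - ?v0 = T e" using T(3) vP PH by blast
    have d: "r f \<bullet> e = l f ?v1 - l f ?v0" for f unfolding r ldiff e ..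
    have "l (j, b j) ?v1 = 0" "l (j, b j) ?v0 = 0" if "j \<noteq> k" for j
      using vG[of "b(k := True)" j] vG[of "b(k := False)" j] that by (simp_all add: lG[OF vP])
    then have "(if b j then R1 j else R0 j) \<bullet> e = 0" if "j \<noteq> k" for j
      using that by (cases "b j") (force simp: R0_def R1_def d)+
    moreover have z: "l (k, False) ?v0 = 0" "l (k, True) ?v1 = 0"
      using vG[of "b(k := True)" k] vG[of "b(k := False)" k] by (simp_all add: lG[OF vP])
    then have "R0 k \<bullet> e > 0" "R1 k \<bullet> e > 0"
      using lsum[OF vP[of "b(k := True)"], of k] lsum[OF vP[of "b(k := False)"], of k]
      by (simp_all add: R0_def R1_def d)
    ultimately show "\<exists>e. (\<forall>j. j \<noteq> k \<longrightarrow> (if b j then R1 j else R0 j) \<bullet> e = 0) \<and> R0 k \<bullet> e > 0 \<and> R1 k \<bullet> e > 0"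
      by blast
  qed auto
  define y where "y x = (\<chi> i. l (i, False) x / (l (i, False) x + l (i, True) x))" for x
  have y01: "0 \<le> y x $ i" "y x $ i \<le> 1" if "x \<in> P" for x i
    using l0[OF that] lsum[OF that, of i] by (auto simp: y_def)
  have yG: "y x $ i = of_bool c \<longleftrightarrow> x \<in> G (i, c)" if "x \<in> P" for x i c
    using lsum[OF that, of i] lG[OF that] by (cases c) (auto simp: y_def field_simps)
  have contl: "continuous_on S (l f)" for S f unfolding l_def by (intro continuous_intros)
  have conty: "continuous_on P y"
  proof -
    have "continuous_on P (\<lambda>x. l (i, False) x / (l (i, False) x + l (i, True) x))" for i
      by (intro continuous_on_divide continuous_on_add contl ballI) (metis lsum less_irrefl)
    then show ?thesis unfolding y_def by (rule continuous_on_vec_lambda)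
  qed
  have injy: "inj_on y P"
  proof (rule inj_onI)
    fix x x' assume x: "x \<in> P" "x' \<in> P" and eq: "y x = y x'"
    define c where "c i = y x $ i" for i
    have c: "(1 - c i) * l (i, False) z - c i * l (i, True) z = 0" if "z = x \<or> z = x'" for i z
    proof -
      have "z \<in> P" "c i = y z $ i" using that x eq by (auto simp: c_def)
      then show ?thesis using lsum[of z i] by (simp add: y_def field_simps)
    qed
    obtain u where u: "x - x' = T u" using T(3) x PH by blast
    let ?M = "\<chi> i. (1 - c i) *s R0 i + c i *s R1 i"
    have "0 < s * det ?M"
      by (rule det_convex_combination_rows[OF s]) (use y01 x in \<open>auto simp: c_def\<close>)
    then have "det ?M \<noteq> 0" by auto
    then have "\<forall>u. ?M *v u = 0 \<longrightarrow> u = 0"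
      using invertible_det_nz invertible_left_inverse matrix_left_invertible_ker by blast
    moreover have "((1 - c i) *s R0 i + c i *s R1 i) \<bullet> u = 0" for i
    proof -
      have *: "R0 i \<bullet> u = l (i, False) x - l (i, False) x'" "R1 i \<bullet> u = - (l (i, True) x - l (i, True) x')"
        unfolding R0_def R1_def r ldiff inner_minus_left u by simp_all
      have "((1 - c i) *s R0 i + c i *s R1 i) \<bullet> u = (1 - c i) * (R0 i \<bullet> u) + c i * (R1 i \<bullet> u)"
        by (simp add: inner_add_left scalar_mult_eq_scaleR)
      also have "\<dots> = ((1 - c i) * l (i, False) x - c i * l (i, True) x)
          - ((1 - c i) * l (i, False) x' - c i * l (i, True) x')"
        unfolding * by (simp add: algebra_simps)
      finally show ?thesis using c by simp
    qed
    then have "?M *v u = 0" by (simp add: vec_eq_iff matrix_vector_mul_component)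
    ultimately have "u = 0" by blast
    then show "x = x'" using u T(1) linear_0 by force
  qed
  have yimg: "y ` P = cbox 0 1"
  proof
    show "y ` P \<subseteq> cbox 0 1" using y01 by (auto simp: mem_cube)
    have rel: "rel_interior P = P - \<Union>{F. F facet_of P}" by (rule rel_interior_of_polyhedron[OF P])
    have inner: "x \<in> rel_interior P \<longleftrightarrow> y x \<in> box 0 1" if "x \<in> P" for x
    proof -
      have "x \<in> rel_interior P \<longleftrightarrow> (\<forall>f. x \<notin> G f)" unfolding rel using that facet facet' by blast
      also have "\<dots> \<longleftrightarrow> (\<forall>i. y x $ i \<noteq> 0 \<and> y x $ i \<noteq> 1)"
        using yG[OF that, of _ False] yG[OF that, of _ True] by (auto simp: split_paired_all all_bool_eq)
      also have "\<dots> \<longleftrightarrow> y x \<in> box 0 1"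
        using y01[OF that] by (auto simp: mem_box_cart less_le)
      finally show ?thesis .
    qed
    have eq: "y ` rel_interior P = box 0 1 \<inter> y ` P"
      using inner rel_interior_subset[of P] by blast
    \<comment> \<open>Surjectivity by connectedness: invariance of domain makes the image of the
      relative interior open, compactness of \<open>P\<close> makes it closed in the open
      cube.\<close>
    have "openin (top_of_set (UNIV :: 'n rspace set)) (y ` rel_interior P)"
    proof (rule invariance_of_domain_affine_sets[OF openin_rel_interior])
      show "aff_dim (UNIV :: 'n rspace set) \<le> aff_dim (affine hull P)" using dim by simp
      show "continuous_on (rel_interior P) y" "inj_on y (rel_interior P)"
        using conty injy rel_interior_subset by (blast intro: continuous_on_subset inj_on_subset)+
    qed auto
    then have "open (y ` rel_interior P)" by simp
    then have o: "openin (top_of_set (box 0 1)) (y ` rel_interior P)"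
      using openin_open_Int[of "y ` rel_interior P" "box 0 1"] eq by (simp add: Int_absorb1)
    have compy: "compact (y ` P)" using conty poly polytope_imp_compact compact_continuous_image by blast
    then have c: "closedin (top_of_set (box 0 1)) (y ` rel_interior P)"
      unfolding eq by (intro closedin_closed_Int compact_imp_closed)
    have "rel_interior P \<noteq> {}" using ne P polyhedron_imp_convex rel_interior_eq_empty by blast
    then have "y ` rel_interior P = box 0 1"
      using convex_connected[OF convex_box(2)[of 0 1]] o c unfolding connected_clopen by blast
    then have "box 0 1 \<subseteq> y ` P" using eq by blast
    then show "cbox 0 1 \<subseteq> y ` P" using cube_eq_closure compact_imp_closed[OF compy] by blast
  qed
  obtain h where h: "homeomorphism P (cbox 0 1) y h"
    using homeomorphism_compact[OF polytope_imp_compact[OF poly] conty yimg injy] by blast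
  then have hs: "homeomorphism (cbox 0 1) P h y" by (rule homeomorphism_sym[THEN iffD1])
  have hP: "h z \<in> P" "y (h z) = z" if "z \<in> cbox 0 1" for z
    using hs that unfolding homeomorphism_def by blast+
  have hG: "h z \<in> G f \<longleftrightarrow> f \<in> cube_facets_at z" if "z \<in> cbox 0 1" for z f
    using yG[OF hP(1)[OF that], of "fst f" "snd f"] hP(2)[OF that] by (simp add: cube_facets_at_def)
  have injh: "inj_on h (cbox 0 1)" using hP(2) by (rule inj_on_inverseI)
  have himg: "h ` cbox 0 1 = P" using hs unfolding homeomorphism_def by blast
  have hI: "h ` (cbox 0 1 \<inter> (\<Inter>f\<in>I. cube_facet f)) = P \<inter> (\<Inter>f\<in>I. G f)" for I
  proof -
    have "cbox 0 1 \<inter> (\<Inter>f\<in>I. cube_facet f) = {z \<in> cbox 0 1. \<forall>f\<in>I. h z \<in> G f}"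
      using hG by (auto simp: cube_facet_def cube_facets_at_def)
    then show ?thesis using himg by auto
  qed
  have faces: "F face_of cbox 0 1 \<longleftrightarrow> h ` F face_of P" if F: "F \<subseteq> cbox 0 1" for F
  proof -
    have "h ` F = P \<inter> (\<Inter>f\<in>I. G f) \<longleftrightarrow> F = cbox 0 1 \<inter> (\<Inter>f\<in>I. cube_facet f)" for I
      unfolding hI[of I, symmetric] by (rule inj_on_image_eq_iff[OF injh F]) blast
    then have I: "(\<exists>I. h ` F = P \<inter> (\<Inter>f\<in>I. G f)) \<longleftrightarrow> (\<exists>I. F = cbox 0 1 \<inter> (\<Inter>f\<in>I. cube_facet f))"
      by (rule ex_cong1)
    have hFP: "h ` F \<subseteq> P" using F himg by blast
    show ?thesis
      unfolding faces_of_cubical_polytope[OF P G hFP] I image_is_empty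
        faces_of_cubical_polytope[OF polytope_imp_polyhedron[OF polytope_interval] cubical_facets_cube F] ..
  qed
  have "face_homeomorphism (cbox 0 1) P h"
    unfolding face_homeomorphism_def by (intro conjI exI[of _ y] hs allI impI faces)
  then show ?thesis using hG by (rule that)
qed

section \<open>Endomorphisms of the circle\<close>

text \<open>The difference \<open>d\<close> from the linear map vanishes on the integers, so it is
  periodic and, being continuous, bounded. A bounded additive map is zero.\<close>

lemma continuous_additive_real_imp_linear:
  fixes g :: "real \<Rightarrow> 'a::real_normed_vector"
  assumes cont: "continuous_on UNIV g" and add: "\<And>x y. g (x + y) = g x + g y"
  shows "g x = x *\<^sub>R g 1"
proof -
  define d where "d t = g t - t *\<^sub>R g 1" for t
  have dadd: "d (x + y) = d x + d y" for x y by (simp add: d_def add algebra_simps)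
  have d1: "d 1 = 0" by (simp add: d_def)
  have dn: "d (of_nat n * x) = of_nat n *\<^sub>R d x" for n x
  proof (induction n)
    case 0
    have "d 0 = 0" using dadd[of 0 0] by simp
    then show ?case by simp
  next
    case (Suc n)
    have "of_nat (Suc n) * x = of_nat n * x + x" by (simp add: distrib_right)
    then have "d (of_nat (Suc n) * x) = d (of_nat n * x + x)" by (simp only:)
    also have "\<dots> = of_nat (Suc n) *\<^sub>R d x" unfolding dadd Suc by (simp add: scaleR_add_left)
    finally show ?case .
  qed
  have dneg: "d (- x) = - d x" for x using dadd[of x "-x"] dadd[of 0 0] by (simp add: eq_neg_iff_add_eq_0 add.commute)
  have dint: "d (of_int k) = 0" for k
    using dn[of "nat k" 1] dn[of "nat (-k)" 1] dneg[of "of_int k"] d1 by (cases "k \<ge> 0") simp_all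
  have "continuous_on {0..1} d" unfolding d_def
    by (intro continuous_intros continuous_on_subset[OF cont]) auto
  then have "bounded (d ` {0..1})"
    using compact_continuous_image compact_imp_bounded compact_Icc by metis
  then obtain B where B: "\<And>x. x \<in> {0..1} \<Longrightarrow> norm (d x) \<le> B" unfolding bounded_iff by blast
  have bnd: "norm (d x) \<le> B" for x
  proof -
    have "d x = d (of_int \<lfloor>x\<rfloor> + frac x)" by (simp add: frac_def)
    also have "\<dots> = d (frac x)" unfolding dadd dint by simp
    finally show ?thesis using B[of "frac x"] frac_lt_1[of x] by (simp add: frac_ge_0 less_imp_le)
  qed
  have "d x = 0"
  proof (rule ccontr)
    assume "d x \<noteq> 0"
    then obtain n where "B < of_nat n * norm (d x)"
      using reals_Archimedean3[of "norm (d x)"] by (auto simp: mult.commute)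
    also have "\<dots> = norm (d (of_nat n * x))" by (simp add: dn)
    finally show False using bnd[of "of_nat n * x"] by simp
  qed
  then show ?thesis by (simp add: d_def)
qed

text \<open>Lift along the exponential. The defect of additivity of the lift \<open>g\<close> takes
  values in a discrete set, so it is constant, and subtracting \<open>g 0\<close> makes the lift
  additive, hence linear. Its value at \<open>2 * pi\<close> gives the exponent.\<close>

lemma continuous_circle_hom_powi:
  fixes f :: "complex \<Rightarrow> complex"
  assumes cont: "continuous_on (sphere 0 1) f" and im: "f \<in> sphere 0 1 \<rightarrow> sphere 0 1"
    and mult: "\<And>z w. z \<in> sphere 0 1 \<Longrightarrow> w \<in> sphere 0 1 \<Longrightarrow> f (z * w) = f z * f w"
  obtains k :: int where "\<And>z. z \<in> sphere 0 1 \<Longrightarrow> f z = z powi k"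
proof -
  have nz: "f (cis x) \<noteq> 0" for x using im by (auto simp: Pi_iff dest!: bspec[of _ _ "cis x"])
  have "continuous_on UNIV (\<lambda>x. f (cis x))"
    by (rule continuous_on_compose2[OF cont]) (auto intro!: continuous_intros)
  then obtain g where g: "continuous_on UNIV g" "\<And>x. f (cis x) = exp (g x)"
    using continuous_logarithm_on_contractible[of UNIV "\<lambda>x::real. f (cis x)"] nz contractible_UNIV by (metis UNIV_I)
  have F1: "f 1 = 1" using mult[of 1 1] nz[of 0] by simp
  have e: "exp (g (x + y) - g x - g y) = 1" for x y
    using mult[of "cis x" "cis y"] nz by (simp add: exp_diff cis_mult flip: g(2))
  have eg0: "exp (g 0) = 1" using g(2)[of 0] F1 by simp
  define h where "h x = g x - g 0" for x
  have cont2: "continuous_on UNIV (\<lambda>z. g (fst z + snd z) - g (fst z) - g (snd z))"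
    by (intro continuous_intros continuous_on_compose2[OF g(1)]) auto
  have "(\<lambda>z. g (fst z + snd z) - g (fst z) - g (snd z)) constant_on UNIV"
  proof (rule continuous_discrete_range_constant[OF connected_UNIV cont2])
    fix x :: "real \<times> real"
    show "\<exists>e>0. \<forall>y. y \<in> UNIV \<and> g (fst y + snd y) - g (fst y) - g (snd y) \<noteq> g (fst x + snd x) - g (fst x) - g (snd x) \<longrightarrow>
        e \<le> norm ((g (fst y + snd y) - g (fst y) - g (snd y)) - (g (fst x + snd x) - g (fst x) - g (snd x)))"
    proof (intro exI[of _ "2 * pi"] conjI allI impI)
      fix y :: "real \<times> real"
      let ?a = "g (fst y + snd y) - g (fst y) - g (snd y)" and ?b = "g (fst x + snd x) - g (fst x) - g (snd x)"
      assume ne: "y \<in> UNIV \<and> ?a \<noteq> ?b"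
      \<comment> \<open>Two different values of the defect differ by a nonzero multiple of
        \<open>2 * pi * \<i>\<close>.\<close>
      have "exp (?a - ?b) = 1" using e[of "fst y" "snd y"] e[of "fst x" "snd x"] by (simp add: exp_diff[of ?a ?b])
      then obtain n :: int where n: "Re (?a - ?b) = 0" "Im (?a - ?b) = of_int (2 * n) * pi" unfolding exp_eq_1 by blast
      have "n \<noteq> 0" using n ne by (auto simp: complex_eq_iff)
      then have "1 \<le> \<bar>real_of_int n\<bar>" by linarith
      then have "2 * pi \<le> \<bar>Im (?a - ?b)\<bar>" unfolding n(2) by (simp add: abs_mult)
      then show "2 * pi \<le> norm (?a - ?b)" using abs_Im_le_cmod order_trans by blast
    qed simp
  qed
  then obtain c where c: "\<And>z. g (fst z + snd z) - g (fst z) - g (snd z) = c" unfolding constant_on_def by auto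
  have "g (x + y) - g x - g y = - g 0" for x y using c[of "(x, y)"] c[of "(0, 0)"] by simp
  then have hadd: "h (x + y) = h x + h y" for x y unfolding h_def by (simp add: algebra_simps)
  have "continuous_on UNIV h" unfolding h_def by (intro continuous_intros g(1))
  then have lin: "h x = x *\<^sub>R h 1" for x using hadd by (rule continuous_additive_real_imp_linear)
  have fh: "f (cis x) = exp (h x)" for x unfolding h_def by (simp add: exp_diff eg0 g(2))
  have "exp (h (2 * pi)) = 1" using fh[of "2 * pi"] F1 by simp
  then obtain k :: int where k: "Re (h (2*pi)) = 0" "Im (h (2*pi)) = of_int (2 * k) * pi" unfolding exp_eq_1 by blast
  have h1: "h 1 = of_int k * \<i>"
    using k by (simp add: lin[of "2*pi"] complex_eq_iff)
  have "f z = z powi k" if "z \<in> sphere 0 1" for z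
  proof -
    have x: "z = cis (Arg z)" using that rcis_cmod_Arg[of z] by (simp add: rcis_def)
    have "f z = exp (h (Arg z))" by (subst x) (rule fh)
    also have "h (Arg z) = \<i> * of_real (real_of_int k * Arg z)" unfolding lin[of "Arg z"] h1 by (simp add: scaleR_conv_of_real mult_ac)
    also have "exp \<dots> = cis (real_of_int k * Arg z)" by (simp add: cis_conv_exp)
    also have "\<dots> = z powi k" by (subst (2) x) (simp add: cis_power_int)
    finally show ?thesis .
  qed
  then show ?thesis by (rule that)
qed

text \<open>The kernel of a power map consists of roots of unity, so it is trivial only for the
  exponents 1 and -1.\<close>

lemma injective_circle_hom:
  fixes f :: "complex \<Rightarrow> complex"
  assumes cont: "continuous_on (sphere 0 1) f" and im: "f \<in> sphere 0 1 \<rightarrow> sphere 0 1"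
    and mult: "\<And>z w. z \<in> sphere 0 1 \<Longrightarrow> w \<in> sphere 0 1 \<Longrightarrow> f (z * w) = f z * f w"
    and inj: "\<And>z. z \<in> sphere 0 1 \<Longrightarrow> f z = 1 \<Longrightarrow> z = 1"
  shows "(\<forall>z\<in>sphere 0 1. f z = z) \<or> (\<forall>z\<in>sphere 0 1. f z = cnj z)"
proof -
  obtain k :: int where k: "\<And>z. z \<in> sphere 0 1 \<Longrightarrow> f z = z powi k"
    using continuous_circle_hom_powi[OF cont im mult] by metis
  have "\<bar>k\<bar> = 1"
  proof (rule ccontr)
    assume k1: "\<bar>k\<bar> \<noteq> 1"
    have "k \<noteq> 0" using inj[of "-1"] k[of "-1"] by auto
    \<comment> \<open>The angle of a primitive root of unity of order \<open>\<bar>k\<bar>\<close>,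
      which lies in the kernel and differs from 1 once \<open>\<bar>k\<bar> \<ge> 2\<close>.\<close>
    define x where "x = 2 * pi / real_of_int \<bar>k\<bar>"
    have "real_of_int k * x = 2 * pi \<or> real_of_int k * x = - (2 * pi)"
      unfolding x_def using \<open>k \<noteq> 0\<close> by (cases "k > 0") auto
    then have "cis (real_of_int k * x) = 1"
    proof
      assume "real_of_int k * x = - (2 * pi)"
      then show ?thesis using cis_inverse[of "2 * pi"] by simp
    qed simp
    then have "f (cis x) = 1" using k[of "cis x"] by (simp add: cis_power_int)
    then have "cis x = 1" using inj[of "cis x"] by simp
    then have "cos x = 1" by (metis cis.simps(1) one_complex.simps(1))
    moreover have "\<bar>k\<bar> \<ge> 2" using k1 \<open>k \<noteq> 0\<close> by linarith
    then have "2 \<le> real_of_int \<bar>k\<bar>" by linarith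
    then have "0 < x" "x \<le> pi" unfolding x_def by (auto simp: field_simps)
    then have "cos x < cos 0" by (intro cos_monotone_0_pi) auto
    ultimately show False by simp
  qed
  then have "k = 1 \<or> k = -1" by linarith
  moreover have "inverse z = cnj z" if "z \<in> sphere 0 1" for z :: complex
    using that complex_norm_square[of z] by (intro inverse_unique) simp
  ultimately show ?thesis using k by (auto simp: power_int_minus)
qed

section \<open>Faces of the cube and automorphisms of the torus\<close>

text \<open>A proper convex combination of two numbers in the unit interval can be 0 or 1 only if
  both of them are.\<close>

lemma cube_facets_at_convex_combination:
  assumes "y \<in> cbox 0 1" "y' \<in> cbox (0 :: 'n::finite rspace) 1" "0 < u" "u < 1"
  shows "cube_facets_at ((1 - u) *\<^sub>R y + u *\<^sub>R y') = cube_facets_at y \<inter> cube_facets_at y'"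
proof -
  have "(1 - u) * a + u * b = of_bool c \<longleftrightarrow> a = of_bool c \<and> b = of_bool c"
    if "0 \<le> a" "a \<le> 1" "0 \<le> b" "b \<le> 1" for a b :: real and c
  proof (cases c)
    case False
    have "0 \<le> (1 - u) * a" "0 \<le> u * b" using assms that by auto
    then have "(1 - u) * a + u * b = 0 \<longleftrightarrow> (1 - u) * a = 0 \<and> u * b = 0" by linarith
    then show ?thesis using False assms by simp
  next
    case True
    have "0 \<le> (1 - u) * (1 - a)" "0 \<le> u * (1 - b)" using assms that by auto
    moreover have "1 - ((1 - u) * a + u * b) = (1 - u) * (1 - a) + u * (1 - b)" by (simp add: algebra_simps)
    ultimately have "(1 - u) * a + u * b = 1 \<longleftrightarrow> (1 - u) * (1 - a) = 0 \<and> u * (1 - b) = 0" by linarith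
    then show ?thesis using True assms by simp
  qed
  then show ?thesis using assms unfolding cube_facets_at_def mem_cube by auto
qed

lemma convex_cube_facets_at: "convex {y \<in> cbox (0 :: 'n::finite rspace) 1. cube_facets_at y = Z}"
  unfolding convex_alt
proof (intro ballI allI impI)
  fix x y :: "'n rspace" and u :: real
  assume x: "x \<in> {y \<in> cbox 0 1. cube_facets_at y = Z}" and y: "y \<in> {y \<in> cbox 0 1. cube_facets_at y = Z}"
    and u: "0 \<le> u \<and> u \<le> 1"
  have "(1 - u) *\<^sub>R x + u *\<^sub>R y \<in> cbox 0 1" using x y u convex_box(1) unfolding convex_alt by blast
  moreover have "cube_facets_at ((1 - u) *\<^sub>R x + u *\<^sub>R y) = Z"
    using cube_facets_at_convex_combination[of x y u] x y u
    by (cases "u = 0"; cases "u = 1") auto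
  ultimately show "(1 - u) *\<^sub>R x + u *\<^sub>R y \<in> {y \<in> cbox 0 1. cube_facets_at y = Z}" by simp
qed

text \<open>Open faces accumulate at every point of their closure: move from \<open>y\<close> a
  little towards the centre \<open>m\<close> of the face cut out by \<open>Z\<close>.\<close>

lemma cube_facets_at_nearby:
  fixes y :: "'n::finite rspace"
  assumes y: "y \<in> cbox 0 1" and Z: "Z \<subseteq> cube_facets_at y" and e: "e > 0"
  obtains y' where "y' \<in> cbox 0 1" "dist y' y < e" "cube_facets_at y' = Z"
proof -
  define m :: "'n rspace" where "m = (\<chi> i. if (i, False) \<in> Z then 0 else if (i, True) \<in> Z then 1 else 1/2)"
  have m: "m \<in> cbox 0 1" by (auto simp: mem_cube m_def)
  have nb: "\<not> ((i, False) \<in> Z \<and> (i, True) \<in> Z)" for i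
  proof
    assume "(i, False) \<in> Z \<and> (i, True) \<in> Z"
    then have "(i, False) \<in> cube_facets_at y" "(i, True) \<in> cube_facets_at y" using Z by blast+
    then show False by (simp add: cube_facets_at_def)
  qed
  have "(i, c) \<in> cube_facets_at m \<longleftrightarrow> (i, c) \<in> Z" for i c
    using nb[of i] by (cases c) (auto simp: m_def cube_facets_at_def)
  then have Zm: "cube_facets_at m = Z" by auto
  define u where "u = min (1/2) (e / (2 * (1 + dist m y)))"
  have u: "0 < u" "u < 1" unfolding u_def using e by (auto intro!: divide_pos_pos add_pos_nonneg)
  have "u * (1 + dist m y) \<le> e / 2"
  proof -
    have "u \<le> e / (2 * (1 + dist m y))" by (simp add: u_def)
    then show ?thesis by (simp add: pos_le_divide_eq add_pos_nonneg algebra_simps)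
  qed
  moreover have "u * dist m y \<le> u * (1 + dist m y)" using u by (intro mult_left_mono) auto
  ultimately have ud: "u * dist m y < e" using e by linarith
  define z where "z = (1 - u) *\<^sub>R y + u *\<^sub>R m"
  have "z - y = u *\<^sub>R (m - y)" by (simp add: z_def algebra_simps)
  then have "dist z y < e" using ud u by (simp add: dist_norm)
  moreover have "z \<in> cbox 0 1" using convexD_alt[OF convex_box(1) y m] u unfolding z_def by simp
  moreover have "cube_facets_at z = Z"
    unfolding z_def using cube_facets_at_convex_combination[OF y m u] Zm Z by auto
  ultimately show ?thesis using that by blast
qed

lemma cube_facets_at_upper_semicontinuous:
  fixes y :: "'n::finite rspace"
  obtains e where "e > 0" "\<And>y'. dist y' y < e \<Longrightarrow> cube_facets_at y' \<subseteq> cube_facets_at y"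
proof -
  define e where "e = Min (insert 1 ((\<lambda>f. \<bar>y $ fst f - of_bool (snd f)\<bar>) ` (- cube_facets_at y)))"
  have "e > 0" unfolding e_def by (subst Min_gr_iff) (auto simp: cube_facets_at_def)
  moreover have "cube_facets_at y' \<subseteq> cube_facets_at y" if d: "dist y' y < e" for y'
  proof
    fix f assume f: "f \<in> cube_facets_at y'"
    show "f \<in> cube_facets_at y"
    proof (rule ccontr)
      assume "f \<notin> cube_facets_at y"
      then have "e \<le> \<bar>y $ fst f - of_bool (snd f)\<bar>" unfolding e_def by (intro Min_le) auto
      also have "\<dots> = dist (y' $ fst f) (y $ fst f)" using f by (simp add: cube_facets_at_def dist_real_def)
      also have "\<dots> \<le> dist y' y" by (rule dist_vec_nth_le)
      finally show False using d by simp
    qed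
  qed
  ultimately show ?thesis using that by blast
qed

text \<open>The vanishing coordinates other than \<open>j\<close> are made nonzero by a small
  amount. So a point with several vanishing coordinates is a limit of points with any prescribed one
  of them as the only zero.\<close>

lemma perturb_zero_coordinates:
  fixes w :: "'n::finite cspace"
  assumes W: "open W" "w \<in> W" and j: "w $ j = 0" and e: "e > 0"
  obtains v where "v \<in> W" "dist v w < e" "{i. v $ i = 0} = {j}"
proof -
  define d :: "'n cspace" where "d = (\<chi> i. if w $ i = 0 \<and> i \<noteq> j then 1 else 0)"
  obtain e' where e': "e' > 0" "ball w e' \<subseteq> W" using W open_contains_ball by blast
  define r where "r = min e e' / (2 * (1 + norm d))"
  have r: "r > 0" unfolding r_def using e e' by (auto intro!: divide_pos_pos add_pos_nonneg)
  have "r * (1 + norm d) = min e e' / 2" unfolding r_def by (simp add: field_simps add_nonneg_eq_0_iff)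
  moreover have "r * norm d \<le> r * (1 + norm d)" using r by (intro mult_left_mono) auto
  ultimately have "r * norm d < min e e'" using e e' by linarith
  then have d: "dist (w + r *\<^sub>R d) w < min e e'" using r by (simp add: dist_norm)
  have "{i. (w + r *\<^sub>R d) $ i = 0} = {j}"
    using r j by (auto simp: d_def split: if_splits)
  moreover have "w + r *\<^sub>R d \<in> W" using d e'(2) by (auto simp: dist_commute)
  ultimately show ?thesis using d that[of "w + r *\<^sub>R d"] by auto
qed

section \<open>The torus and its automorphisms\<close>

lemma torus_mult: "s \<in> torus \<Longrightarrow> t \<in> torus \<Longrightarrow> s * t \<in> torus"
  by (simp add: torus_def norm_mult)

lemma torus_one: "1 \<in> torus"
  by (simp add: torus_def)

text \<open>On the torus this is inversion.\<close>

definition torus_cnj :: "'n::finite cspace \<Rightarrow> 'n cspace" where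
  "torus_cnj t = (\<chi> i. cnj (t $ i))"

lemma torus_cnj: "t \<in> torus \<Longrightarrow> torus_cnj t \<in> torus" "t \<in> torus \<Longrightarrow> t * torus_cnj t = 1"
  by (simp_all add: torus_def torus_cnj_def vec_eq_iff flip: complex_norm_square)

lemma torus_automorphism_in: "torus_automorphism \<theta> \<Longrightarrow> t \<in> torus \<Longrightarrow> \<theta> t \<in> torus"
  unfolding torus_automorphism_def bij_betw_def by blast

lemma torus_automorphism_one: 
  assumes "torus_automorphism \<theta>" shows "\<theta> 1 = 1"
proof -
  have "\<theta> (1 * 1) = \<theta> 1 * \<theta> 1" using assms torus_one unfolding torus_automorphism_def by blast
  moreover have "\<theta> 1 \<in> torus" using torus_automorphism_in[OF assms torus_one] .
  ultimately show ?thesis by (simp add: vec_eq_iff torus_def) (metis norm_zero zero_neq_one)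
qed

lemma torus_automorphism_compose:
  assumes "torus_automorphism \<theta>" "torus_automorphism \<psi>" shows "torus_automorphism (\<theta> \<circ> \<psi>)"
  unfolding torus_automorphism_def
proof (intro conjI ballI)
  show "bij_betw (\<theta> \<circ> \<psi>) torus torus" using assms bij_betw_trans unfolding torus_automorphism_def by blast
  show "continuous_on torus (\<theta> \<circ> \<psi>)"
    by (rule continuous_on_compose) (use assms in \<open>auto simp: torus_automorphism_def bij_betw_def\<close>)
  fix s t :: "'a cspace" assume "s \<in> torus" "t \<in> torus"
  then show "(\<theta> \<circ> \<psi>) (s * t) = (\<theta> \<circ> \<psi>) s * (\<theta> \<circ> \<psi>) t"
    using assms torus_automorphism_in[OF assms(2)] unfolding torus_automorphism_def by simp
qed

lemma torus_automorphism_permute: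
  fixes \<tau> :: "'n::finite \<Rightarrow> 'n"
  assumes \<tau>: "bij \<tau>" shows "torus_automorphism (\<lambda>t. \<chi> i. t $ \<tau> i)"
  unfolding torus_automorphism_def
proof (intro conjI ballI)
  show "bij_betw (\<lambda>t. \<chi> i. t $ \<tau> i) torus (torus :: 'n cspace set)"
    by (rule bij_betwI[where g = "\<lambda>t. \<chi> i. t $ inv \<tau> i"])
      (use \<tau> in \<open>auto simp: torus_def vec_eq_iff bij_is_surj bij_is_inj surj_f_inv_f inv_f_f\<close>)
  show "continuous_on torus (\<lambda>t :: 'n cspace. \<chi> i. t $ \<tau> i)" by (intro continuous_intros)
qed (simp add: vec_eq_iff)

lemma torus_automorphism_flip:
  "torus_automorphism (\<lambda>t. \<chi> i. if N i then cnj (t $ i) else t $ i)"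
  unfolding torus_automorphism_def
proof (intro conjI ballI)
  show "bij_betw (\<lambda>t. \<chi> i. if N i then cnj (t $ i) else t $ i) torus (torus :: 'a cspace set)"
    by (rule bij_betwI[where g = "\<lambda>t. \<chi> i. if N i then cnj (t $ i) else t $ i"])
      (auto simp: torus_def vec_eq_iff)
  have "continuous_on torus (\<lambda>t :: 'a cspace. if N i then cnj (t $ i) else t $ i)" for i
    by (cases "N i") (auto intro!: continuous_intros)
  then show "continuous_on torus (\<lambda>t :: 'a cspace. \<chi> i. if N i then cnj (t $ i) else t $ i)"
    by (rule continuous_on_vec_lambda)
qed (simp add: vec_eq_iff)

lemma compact_torus: "compact (torus :: 'n::finite cspace set)"
proof -
  have "torus = (\<Inter>i. {t :: 'n cspace. norm (t $ i) = 1})" by (auto simp: torus_def)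
  moreover have "closed {t :: 'n cspace. norm (t $ i) = 1}" for i
    by (intro closed_Collect_eq continuous_intros)
  ultimately have "closed (torus :: 'n cspace set)" using closed_INT[of UNIV "\<lambda>i. {t :: 'n cspace. norm (t $ i) = 1}"] by simp
  moreover have "bounded (torus :: 'n cspace set)"
    unfolding bounded_iff
  proof (intro exI ballI)
    fix t :: "'n cspace" assume "t \<in> torus"
    then have "(\<Sum>i\<in>UNIV. norm (t $ i)) = CARD('n)" by (simp add: torus_def)
    then show "norm t \<le> CARD('n)" using L2_set_le_sum[of UNIV "\<lambda>i. norm (t $ i)"] by (simp add: norm_vec_def)
  qed
  ultimately show ?thesis by (simp add: compact_eq_bounded_closed)
qed

lemma torus_automorphism_inv:
  fixes \<theta> :: "'n::finite cspace \<Rightarrow> 'n cspace"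
  assumes \<theta>: "torus_automorphism \<theta>" shows "torus_automorphism (inv_into torus \<theta>)"
proof -
  have b: "bij_betw \<theta> torus torus" and c: "continuous_on torus \<theta>"
    and m: "\<And>s t. s \<in> torus \<Longrightarrow> t \<in> torus \<Longrightarrow> \<theta> (s * t) = \<theta> s * \<theta> t"
    using \<theta> unfolding torus_automorphism_def by auto
  have inj: "inj_on \<theta> torus" and im: "\<theta> ` torus = torus" using b unfolding bij_betw_def by auto
  show ?thesis unfolding torus_automorphism_def
  proof (intro conjI ballI)
    show "bij_betw (inv_into torus \<theta>) torus torus" by (rule bij_betw_inv_into[OF b])
    have "continuous_on (\<theta> ` torus) (inv_into torus \<theta>)"
      by (rule continuous_on_inv[OF c compact_torus]) (simp add: inv_into_f_f[OF inj])
    then show "continuous_on torus (inv_into torus \<theta>)" by (simp add: im)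
    fix s t :: "'n cspace" assume st: "s \<in> torus" "t \<in> torus"
    have in': "inv_into torus \<theta> s \<in> torus" "inv_into torus \<theta> t \<in> torus"
      using st im by (auto intro: inv_into_into)
    have "\<theta> (inv_into torus \<theta> s * inv_into torus \<theta> t) = s * t"
      unfolding m[OF in'] using f_inv_into_f[of _ \<theta> torus, unfolded im] st by metis
    then show "inv_into torus \<theta> (s * t) = inv_into torus \<theta> s * inv_into torus \<theta> t"
      by (rule inv_into_f_eq[OF inj torus_mult[OF in']])
  qed
qed

section \<open>Torus actions over the cube\<close>

text \<open>A standard chart seen topologically, with the corner condition built in as an equality
  of cardinalities. Which coordinate belongs to which facet is recovered in
  \<open>chart_corner_structure\<close>.\<close>

definition orbit_chart ::
    "'m topology \<Rightarrow> ('n::finite cspace \<Rightarrow> 'm \<Rightarrow> 'm) \<Rightarrow> ('m \<Rightarrow> 'n rspace) \<Rightarrow>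
     'm set \<Rightarrow> ('m \<Rightarrow> 'n cspace) \<Rightarrow> ('n cspace \<Rightarrow> 'n cspace) \<Rightarrow> bool" where
  "orbit_chart X act p U \<phi> \<theta> \<longleftrightarrow>
     is_chart X (U, \<phi>) \<and> torus_automorphism \<theta> \<and>
     (\<forall>t\<in>torus. \<forall>x\<in>U. act t x \<in> U \<and> \<phi> (act t x) = \<theta> t * \<phi> x) \<and>
     (\<forall>x\<in>U. card {i. \<phi> x $ i = 0} = card (cube_facets_at (p x)))"

text \<open>The orbit space is already the standard cube, so facets are pairs of an index and a
  side. In the application \<open>p\<close> is the projection to \<open>P\<close> followed by a
  homeomorphism from \<open>P\<close> to the cube.\<close>

locale torus_manifold_over_cube =
  fixes X :: "'m topology" and act :: "'n::finite cspace \<Rightarrow> 'm \<Rightarrow> 'm" and p :: "'m \<Rightarrow> 'n rspace"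
  assumes Hausdorff: "Hausdorff_space X" and compact: "compact_space X"
    and action: "torus_action X act"
    and quotient: "quotient_map X (top_of_set (cbox 0 1)) p"
    and orbits: "\<And>x y. x \<in> topspace X \<Longrightarrow> y \<in> topspace X \<Longrightarrow> p x = p y \<longleftrightarrow> (\<exists>t\<in>torus. y = act t x)"
    and charts: "\<And>x. x \<in> topspace X \<Longrightarrow> \<exists>U \<phi> \<theta>. x \<in> U \<and> orbit_chart X act p U \<phi> \<theta>"
begin

section \<open>The action and its orbit projection\<close>

lemma continuous_act: "continuous_map (prod_topology (top_of_set torus) X) X (\<lambda>(t, x). act t x)"
  using action unfolding torus_action_def by blast

lemma act_one: "x \<in> topspace X \<Longrightarrow> act 1 x = x"
  using action unfolding torus_action_def by blast

lemma act_mult: "s \<in> torus \<Longrightarrow> t \<in> torus \<Longrightarrow> x \<in> topspace X \<Longrightarrow> act (s * t) x = act s (act t x)"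
  using action unfolding torus_action_def by blast

lemma act_in: 
  assumes "t \<in> torus" "x \<in> topspace X" shows "act t x \<in> topspace X"
proof -
  have "(t, x) \<in> topspace (prod_topology (top_of_set torus) X)" using assms by simp
  then have "(\<lambda>(t, x). act t x) (t, x) \<in> topspace X"
    using continuous_act continuous_map_image_subset_topspace by blast
  then show ?thesis by simp
qed

lemma continuous_act_fixed:
  assumes "t \<in> torus" shows "continuous_map X X (act t)"
proof -
  have "continuous_map X (prod_topology (top_of_set torus) X) (\<lambda>x. (t, x))"
    using assms by (intro continuous_map_pairedI) auto
  from continuous_map_compose[OF this continuous_act] show ?thesis by (simp add: o_def)
qed

lemma continuous_p: "continuous_map X (top_of_set (cbox 0 1)) p"
  using quotient quotient_imp_continuous_map by blast

lemma p_in: "x \<in> topspace X \<Longrightarrow> p x \<in> cbox 0 1"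
  using continuous_map_image_subset_topspace[OF continuous_p] by auto

lemma p_surj: assumes "y \<in> cbox 0 1" obtains x where "x \<in> topspace X" "p x = y"
proof -
  have "p ` topspace X = cbox 0 1" using quotient_imp_surjective_map[OF quotient] by simp
  with assms that show thesis by (metis imageE)
qed

lemma p_act: "t \<in> torus \<Longrightarrow> x \<in> topspace X \<Longrightarrow> p (act t x) = p x"
  using orbits[of x "act t x"] act_in by metis

lemma p_eqD:
  assumes "x \<in> topspace X" "y \<in> topspace X" "p x = p y" obtains t where "t \<in> torus" "y = act t x"
  using orbits assms by metis

text \<open>The points lying over the image of \<open>W\<close> form the union of the translates of
  \<open>W\<close>.\<close>

lemma open_p:
  assumes W: "openin X W" shows "openin (top_of_set (cbox 0 1)) (p ` W)"
proof -
  have WX: "W \<subseteq> topspace X" using W openin_subset by blast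
  have "{x \<in> topspace X. p x \<in> p ` W} = (\<Union>t\<in>torus. {x \<in> topspace X. act t x \<in> W})"
  proof (intro set_eqI iffI)
    fix x assume "x \<in> {x \<in> topspace X. p x \<in> p ` W}"
    then obtain w where w: "x \<in> topspace X" "w \<in> W" "p x = p w" by auto
    then obtain t where "t \<in> torus" "w = act t x" using p_eqD[of x w] WX by blast
    then show "x \<in> (\<Union>t\<in>torus. {x \<in> topspace X. act t x \<in> W})" using w by auto
  next
    fix x assume "x \<in> (\<Union>t\<in>torus. {x \<in> topspace X. act t x \<in> W})"
    then obtain t where "t \<in> torus" "x \<in> topspace X" "act t x \<in> W" by blast
    then show "x \<in> {x \<in> topspace X. p x \<in> p ` W}" using p_act[of t x] by (metis (mono_tags, lifting) image_eqI mem_Collect_eq)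
  qed
  moreover have "openin X (\<Union>t\<in>torus. {x \<in> topspace X. act t x \<in> W})"
    using openin_continuous_map_preimage[OF continuous_act_fixed W] by (intro openin_Union) auto
  ultimately have o: "openin X {x \<in> topspace X. p x \<in> p ` W}" by simp
  have "p ` W \<subseteq> cbox 0 1" using WX p_in by blast
  then have "openin X {x \<in> topspace X. p x \<in> p ` W} \<longleftrightarrow> openin (top_of_set (cbox 0 1)) (p ` W)"
    using quotient unfolding quotient_map_def topspace_euclidean_subtopology by blast
  with o show ?thesis by blast
qed

section \<open>Stabilizers and invariant charts\<close>

definition stab :: "'m \<Rightarrow> 'n cspace set" where
  "stab x = {t \<in> torus. act t x = x}"

lemma stab_subset: "stab x \<subseteq> torus" by (auto simp: stab_def)

text \<open>Stabilizers along an orbit are conjugate, hence equal in a commutative group.\<close>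

lemma stab_orbit:
  assumes "x \<in> topspace X" "y \<in> topspace X" "p x = p y" shows "stab x = stab y"
proof -
  have sub: "stab x \<subseteq> stab (act s x)" if "s \<in> torus" "x \<in> topspace X" for s x
  proof
    fix t assume "t \<in> stab x"
    then have t: "t \<in> torus" "act t x = x" by (auto simp: stab_def)
    have "act t (act s x) = act (s * t) x" using act_mult[OF t(1) that] by (simp add: mult.commute)
    also have "\<dots> = act s x" using act_mult[OF that(1) t(1) that(2)] t(2) by simp
    finally show "t \<in> stab (act s x)" using t by (simp add: stab_def)
  qed
  obtain s where "s \<in> torus" "y = act s x" using p_eqD assms by blast
  moreover obtain s' where "s' \<in> torus" "x = act s' y" using p_eqD[of y x] assms by metis
  ultimately show ?thesis using sub[of s x] sub[of s' y] assms by auto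
qed

lemma orbit_chartD:
  assumes "orbit_chart X act p U \<phi> \<theta>"
  shows "openin X U" "open (\<phi> ` U)" "homeomorphic_map (subtopology X U) (top_of_set (\<phi> ` U)) \<phi>"
    "torus_automorphism \<theta>" "\<And>t x. t \<in> torus \<Longrightarrow> x \<in> U \<Longrightarrow> act t x \<in> U"
    "\<And>t x. t \<in> torus \<Longrightarrow> x \<in> U \<Longrightarrow> \<phi> (act t x) = \<theta> t * \<phi> x"
    "\<And>x. x \<in> U \<Longrightarrow> card {i. \<phi> x $ i = 0} = card (cube_facets_at (p x))"
    "U \<subseteq> topspace X" "inj_on \<phi> U"
proof -
  show hm: "openin X U" "open (\<phi> ` U)" "homeomorphic_map (subtopology X U) (top_of_set (\<phi> ` U)) \<phi>"
    "torus_automorphism \<theta>" "\<And>t x. t \<in> torus \<Longrightarrow> x \<in> U \<Longrightarrow> act t x \<in> U"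
    "\<And>t x. t \<in> torus \<Longrightarrow> x \<in> U \<Longrightarrow> \<phi> (act t x) = \<theta> t * \<phi> x"
    "\<And>x. x \<in> U \<Longrightarrow> card {i. \<phi> x $ i = 0} = card (cube_facets_at (p x))"
    using assms unfolding orbit_chart_def is_chart_def by auto
  show UX: "U \<subseteq> topspace X" using hm(1) openin_subset by blast
  show "inj_on \<phi> U" using homeomorphic_imp_injective_map[OF hm(3)] UX by (simp add: inf.absorb2)
qed

lemma chart_saturated:
  assumes c: "orbit_chart X act p U \<phi> \<theta>" and x: "x \<in> U" and y: "y \<in> topspace X" "p y = p x"
  shows "y \<in> U" "norm (\<phi> y $ i) = norm (\<phi> x $ i)"
proof -
  obtain t where t: "t \<in> torus" "y = act t x"
    using p_eqD[of x y] x y orbit_chartD(8)[OF c] by (metis subsetD)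
  show "y \<in> U" unfolding t(2) by (rule orbit_chartD(5)[OF c t(1) x])
  have "\<theta> t \<in> torus" using torus_automorphism_in orbit_chartD(4)[OF c] t(1) by blast
  then have "norm (\<theta> t $ i) = 1" by (simp add: torus_def)
  then show "norm (\<phi> y $ i) = norm (\<phi> x $ i)"
    unfolding t(2) orbit_chartD(6)[OF c t(1) x] by (simp add: norm_mult)
qed

lemma chart_inverse:
  assumes c: "orbit_chart X act p U \<phi> \<theta>"
  obtains g where "continuous_map (top_of_set (\<phi> ` U)) X g" "\<And>x. x \<in> U \<Longrightarrow> g (\<phi> x) = x"
    "\<And>v. v \<in> \<phi> ` U \<Longrightarrow> g v \<in> U" "\<And>v. v \<in> \<phi> ` U \<Longrightarrow> \<phi> (g v) = v" "continuous_on (\<phi> ` U) (\<lambda>v. p (g v))"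
proof -
  obtain g where g: "homeomorphic_maps (subtopology X U) (top_of_set (\<phi> ` U)) \<phi> g"
    using orbit_chartD(3)[OF c] homeomorphic_map_maps by blast
  then have cg: "continuous_map (top_of_set (\<phi> ` U)) (subtopology X U) g"
    and 1: "\<And>x. x \<in> U \<Longrightarrow> g (\<phi> x) = x" and 2: "\<And>v. v \<in> \<phi> ` U \<Longrightarrow> \<phi> (g v) = v"
    using orbit_chartD(8)[OF c] unfolding homeomorphic_maps_def by auto
  have cX: "continuous_map (top_of_set (\<phi> ` U)) X g" and gU: "\<And>v. v \<in> \<phi> ` U \<Longrightarrow> g v \<in> U"
    using cg 1 by (auto simp: continuous_map_in_subtopology)
  have "continuous_map (top_of_set (\<phi> ` U)) (top_of_set (cbox 0 1)) (p \<circ> g)"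
    using continuous_map_compose[OF cX continuous_p] .
  then have "continuous_on (\<phi> ` U) (\<lambda>v. p (g v))" by (simp add: continuous_map_in_subtopology o_def)
  then show thesis using that cX 1 gU 2 by blast
qed

text \<open>Rotating coordinates keeps their moduli, so these depend on the orbit only, whichever
  representative \<open>SOME\<close> picks. Openness of \<open>p\<close> makes them continuous on
  the orbit space.\<close>

lemma chart_moduli:
  assumes c: "orbit_chart X act p U \<phi> \<theta>"
  obtains r :: "'n rspace \<Rightarrow> 'n \<Rightarrow> real" where "\<And>x i. x \<in> U \<Longrightarrow> r (p x) i = norm (\<phi> x $ i)"
    "\<And>i. continuous_on (p ` U) (\<lambda>y. r y i)"
proof -
  define r where "r y i = norm (\<phi> (SOME x. x \<in> U \<and> p x = y) $ i)" for y i
  have UX: "U \<subseteq> topspace X" by (rule orbit_chartD(8)[OF c])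
  have r: "r (p x) i = norm (\<phi> x $ i)" if "x \<in> U" for x i
  proof -
    let ?z = "SOME z. z \<in> U \<and> p z = p x"
    have "?z \<in> U \<and> p ?z = p x" by (rule someI[of _ x]) (use that in simp)
    then show ?thesis unfolding r_def using chart_saturated(2)[OF c that, of ?z i] UX by blast
  qed
  have "continuous_on (p ` U) (\<lambda>y. r y i)" for i
    unfolding continuous_openin_preimage_eq
  proof (intro allI impI)
    fix T :: "real set" assume T: "open T"
    have "continuous_map (subtopology X U) (top_of_set (\<phi> ` U)) \<phi>"
      using orbit_chartD(3)[OF c] homeomorphic_imp_continuous_map by blast
    then have c\<phi>: "continuous_map (subtopology X U) euclidean \<phi>" by (simp add: continuous_map_in_subtopology)
    have "continuous_map euclidean euclidean (\<lambda>v :: 'n cspace. norm (v $ i))"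
      unfolding continuous_map_iff_continuous2 by (intro continuous_intros)
    from continuous_map_compose[OF c\<phi> this]
    have "continuous_map (subtopology X U) euclidean (\<lambda>x. norm (\<phi> x $ i))" by (simp add: o_def)
    then have "openin (subtopology X U) {x \<in> topspace (subtopology X U). norm (\<phi> x $ i) \<in> T}"
      using T by (intro openin_continuous_map_preimage) auto
    moreover have "{x \<in> topspace (subtopology X U). norm (\<phi> x $ i) \<in> T} = {x \<in> U. norm (\<phi> x $ i) \<in> T}"
      using UX by auto
    ultimately have "openin X {x \<in> U. norm (\<phi> x $ i) \<in> T}"
      using orbit_chartD(1)[OF c] openin_open_subtopology by metis
    then have "openin (top_of_set (cbox 0 1)) (p ` {x \<in> U. norm (\<phi> x $ i) \<in> T})" by (rule open_p)
    moreover have "p ` {x \<in> U. norm (\<phi> x $ i) \<in> T} = p ` U \<inter> (\<lambda>y. r y i) -` T" using r by auto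
    moreover have "p ` U \<subseteq> cbox 0 1" using UX p_in by blast
    ultimately show "openin (top_of_set (p ` U)) (p ` U \<inter> (\<lambda>y. r y i) -` T)"
      by (metis Int_lower1 openin_subset_trans)
  qed
  then show thesis using that r by blast
qed

text \<open>\<open>\<sigma>\<close> matches facets with vanishing coordinates, although a chart only
  records how many coordinates vanish. Over the points that lie on the single facet \<open>f\<close>
  exactly one coordinate vanishes, and by connectedness it is always the same one,
  \<open>\<sigma> f\<close>. Points on several facets are limits of such points; approaching them in
  the cube gives one inclusion, approaching them in the chart the other.\<close>

lemma chart_corner_structure:
  assumes c: "orbit_chart X act p U \<phi> \<theta>" and x0: "x0 \<in> U"
  obtains d \<sigma> where "d > 0" "inj_on \<sigma> (cube_facets_at (p x0))"
    "\<And>x. x \<in> topspace X \<Longrightarrow> dist (p x) (p x0) < d \<Longrightarrow> x \<in> U"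
    "\<And>x. x \<in> topspace X \<Longrightarrow> dist (p x) (p x0) < d \<Longrightarrow> {i. \<phi> x $ i = 0} = \<sigma> ` cube_facets_at (p x)"
    "\<And>x. x \<in> topspace X \<Longrightarrow> dist (p x) (p x0) < d \<Longrightarrow> cube_facets_at (p x) \<subseteq> cube_facets_at (p x0)"
proof -
  define y0 where "y0 = p x0"
  have UX: "U \<subseteq> topspace X" by (rule orbit_chartD(8)[OF c])
  then have y0: "y0 \<in> cbox 0 1" using x0 p_in y0_def by blast
  have WC: "p ` U \<subseteq> cbox 0 1" using UX p_in by blast
  obtain r where r: "\<And>x i. x \<in> U \<Longrightarrow> r (p x) i = norm (\<phi> x $ i)"
    and contr: "\<And>i. continuous_on (p ` U) (\<lambda>y. r y i)" using chart_moduli[OF c] by metis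
  obtain g where g: "\<And>x. x \<in> U \<Longrightarrow> g (\<phi> x) = x" "\<And>v. v \<in> \<phi> ` U \<Longrightarrow> g v \<in> U"
    "\<And>v. v \<in> \<phi> ` U \<Longrightarrow> \<phi> (g v) = v" and contg: "continuous_on (\<phi> ` U) (\<lambda>v. p (g v))"
    using chart_inverse[OF c] by metis
  define R where "R y = {i. r y i = 0}" for y
  have R: "R (p x) = {i. \<phi> x $ i = 0}" if "x \<in> U" for x using r[OF that] by (simp add: R_def)
  have cardR: "card (R y) = card (cube_facets_at y)" if "y \<in> p ` U" for y
    using that R orbit_chartD(7)[OF c] by auto
  obtain e1 where e1: "e1 > 0" "\<And>y. y \<in> cbox 0 1 \<Longrightarrow> dist y y0 < e1 \<Longrightarrow> y \<in> p ` U"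
    using open_p[OF orbit_chartD(1)[OF c]] x0 unfolding openin_euclidean_subtopology_iff y0_def by blast
  obtain e2 where e2: "e2 > 0" "\<And>y. dist y y0 < e2 \<Longrightarrow> cube_facets_at y \<subseteq> cube_facets_at y0"
    using cube_facets_at_upper_semicontinuous[of y0] by metis
  define d where "d = min e1 e2"
  have d: "d > 0" using e1 e2 by (simp add: d_def)
  define V where "V = cbox 0 1 \<inter> ball y0 d"
  have V: "y \<in> p ` U" "cube_facets_at y \<subseteq> cube_facets_at y0" if "y \<in> V" for y
    using that e1(2)[of y] e2(2)[of y] by (auto simp: V_def d_def dist_commute)
  have Vo: "\<exists>e>0. \<forall>y'\<in>cbox 0 1. dist y' y < e \<longrightarrow> y' \<in> V" if y: "y \<in> V" for y
  proof (intro exI[of _ "d - dist y0 y"] conjI ballI impI)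
    show "0 < d - dist y0 y" using y by (simp add: V_def)
    fix y' assume "y' \<in> cbox 0 1" "dist y' y < d - dist y0 y"
    then show "y' \<in> V" using dist_triangle[of y0 y' y] by (simp add: V_def dist_commute)
  qed
  define E where "E f = {y \<in> V. cube_facets_at y = {f}}" for f
  have EV: "E f \<subseteq> V" for f by (auto simp: E_def)
  have E_eq: "E f = {y \<in> cbox 0 1. cube_facets_at y = {f}} \<inter> ball y0 d" for f by (auto simp: E_def V_def)
  have "convex (E f)" for f
    unfolding E_eq by (intro convex_Int convex_cube_facets_at convex_ball)
  then have Econ: "connected (E f)" for f by (rule convex_connected)
  have near: "\<exists>y'\<in>E f. dist y' y < e" if y: "y \<in> V" and f: "f \<in> cube_facets_at y" and e: "e > 0" for y f e
  proof -
    obtain e' where e': "e' > 0" "\<And>y'. y' \<in> cbox 0 1 \<Longrightarrow> dist y' y < e' \<Longrightarrow> y' \<in> V" using Vo[OF y] by blast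
    have yc: "y \<in> cbox 0 1" using y by (simp add: V_def)
    have fs: "{f} \<subseteq> cube_facets_at y" using f by simp
    have mp: "0 < min e e'" using e' e by simp
    obtain y' where "y' \<in> cbox 0 1" "dist y' y < min e e'" "cube_facets_at y' = {f}"
      using cube_facets_at_nearby[OF yc fs mp] .
    then show ?thesis using e' by (auto simp: E_def)
  qed
  \<comment> \<open>The zero sets of the finitely many moduli are closed and partition
    \<open>E f\<close>, so each of them is open too.\<close>
  have "\<exists>i. \<forall>y\<in>E f. R y = {i}" for f
  proof (cases "E f = {}")
    case False
    then obtain y1 where y1: "y1 \<in> E f" by blast
    have single: "\<exists>i. R y = {i}" if "y \<in> E f" for y
      using cardR[of y] V(1)[of y] that unfolding E_def by (auto simp: card_1_singleton_iff)
    then obtain i where i: "R y1 = {i}" using y1 by blast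
    have contE: "continuous_on (E f) (\<lambda>y. r y k)" for k
      using contr[of k] V(1) EV by (meson continuous_on_subset subset_iff)
    have cl: "closedin (top_of_set (E f)) {y \<in> E f. r y k = 0}" for k
      using continuous_closedin_preimage_constant[OF contE, of k 0] by simp
    have op: "E f - {y \<in> E f. r y i = 0} = (\<Union>k\<in>-{i}. {y \<in> E f. r y k = 0})"
    proof (intro set_eqI iffI)
      fix y assume y: "y \<in> E f - {y \<in> E f. r y i = 0}"
      then obtain k where "R y = {k}" using single by blast
      then show "y \<in> (\<Union>k\<in>-{i}. {y \<in> E f. r y k = 0})" using y by (auto simp: R_def)
    next
      fix y assume "y \<in> (\<Union>k\<in>-{i}. {y \<in> E f. r y k = 0})"
      then obtain k where k: "k \<noteq> i" "y \<in> E f" "k \<in> R y" by (auto simp: R_def)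
      then have "i \<notin> R y" using single[of y] by auto
      then show "y \<in> E f - {y \<in> E f. r y i = 0}" using k by (auto simp: R_def)
    qed
    have "closedin (top_of_set (E f)) (\<Union>k\<in>-{i}. {y \<in> E f. r y k = 0})"
      using cl by (intro closedin_Union) auto
    then have "openin (top_of_set (E f)) {y \<in> E f. r y i = 0}"
      unfolding op[symmetric] by (simp add: openin_closedin_eq)
    then have "{y \<in> E f. r y i = 0} = {} \<or> {y \<in> E f. r y i = 0} = E f"
      using Econ[of f] cl[of i] unfolding connected_clopen by blast
    moreover have "y1 \<in> {y \<in> E f. r y i = 0}" using i y1 by (auto simp: R_def)
    ultimately have "\<forall>y\<in>E f. i \<in> R y" by (auto simp: R_def)
    then have "\<forall>y\<in>E f. R y = {i}" using single by fastforce
    then show ?thesis by blast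
  qed auto
  then obtain \<sigma> where \<sigma>: "\<And>f y. y \<in> E f \<Longrightarrow> R y = {\<sigma> f}" by metis
  \<comment> \<open>A point of the facet \<open>f\<close> is a limit of points of
    \<open>E f\<close>, on which the modulus with index \<open>\<sigma> f\<close> is zero.\<close>
  have sub1: "\<sigma> ` cube_facets_at y \<subseteq> R y" if y: "y \<in> V" for y
  proof
    fix i assume "i \<in> \<sigma> ` cube_facets_at y"
    then obtain f where f: "f \<in> cube_facets_at y" "i = \<sigma> f" by blast
    show "i \<in> R y"
    proof (rule ccontr)
      assume "i \<notin> R y"
      then have "\<bar>r y i\<bar> > 0" by (simp add: R_def)
      then obtain e where e: "e > 0" "\<And>y'. y' \<in> p ` U \<Longrightarrow> dist y' y < e \<Longrightarrow> dist (r y' i) (r y i) < \<bar>r y i\<bar>"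
        using contr[of i] V(1)[OF y] unfolding continuous_on_iff by blast
      obtain y' where y': "y' \<in> E f" "dist y' y < e" using near[OF y f(1) e(1)] by blast
      then have "r y' i = 0" using \<sigma>[OF y'(1)] f(2) by (auto simp: R_def)
      moreover have "y' \<in> p ` U" using V(1) y' EV by blast
      ultimately show False using e(2)[OF _ y'(2)] by (simp add: dist_real_def)
    qed
  qed
  \<comment> \<open>Move inside the chart until \<open>j\<close> is the only vanishing coordinate.
    The image then lies on exactly one facet \<open>f\<close>; being close to \<open>y\<close> it
    lies on no facet that misses \<open>y\<close>, and \<open>\<sigma> f\<close> can only be
    \<open>j\<close>.\<close>
  have sub2: "R y \<subseteq> \<sigma> ` cube_facets_at y" if y: "y \<in> V" for y
  proof
    fix j assume j: "j \<in> R y"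
    obtain x where x: "x \<in> U" "y = p x" using V(1)[OF y] by blast
    have j0: "\<phi> x $ j = 0" using j R[OF x(1)] x(2) by simp
    obtain ea where ea: "ea > 0" "\<And>y'. y' \<in> cbox 0 1 \<Longrightarrow> dist y' y < ea \<Longrightarrow> y' \<in> V" using Vo[OF y] by blast
    obtain eb where eb: "eb > 0" "\<And>y'. dist y' y < eb \<Longrightarrow> cube_facets_at y' \<subseteq> cube_facets_at y"
      using cube_facets_at_upper_semicontinuous[of y] by metis
    have "\<phi> x \<in> \<phi> ` U" "p (g (\<phi> x)) = y" using x g(1) by auto
    moreover have "0 < min ea eb" using ea eb by simp
    ultimately obtain \<eta> where \<eta>: "\<eta> > 0"
      "\<And>v. v \<in> \<phi> ` U \<Longrightarrow> dist v (\<phi> x) < \<eta> \<Longrightarrow> dist (p (g v)) y < min ea eb"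
      using contg unfolding continuous_on_iff by metis
    obtain v where v: "v \<in> \<phi> ` U" "dist v (\<phi> x) < \<eta>" "{i. v $ i = 0} = {j}"
      using perturb_zero_coordinates[OF orbit_chartD(2)[OF c] \<open>\<phi> x \<in> \<phi> ` U\<close> j0 \<eta>(1)] .
    define q where "q = p (g v)"
    have gv: "g v \<in> U" by (rule g(2)[OF v(1)])
    have qd: "dist q y < ea" "dist q y < eb" using \<eta>(2)[OF v(1,2)] by (auto simp: q_def)
    have qV: "q \<in> V" by (rule ea(2)[OF _ qd(1)]) (use gv UX p_in q_def in blast)
    have Rq: "R q = {j}" unfolding q_def R[OF gv] g(3)[OF v(1)] by (rule v(3))
    then have "card (cube_facets_at q) = 1" using cardR[OF V(1)[OF qV]] by simp
    then obtain f where f: "cube_facets_at q = {f}" using card_1_singleton_iff[of "cube_facets_at q"] by auto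
    then have "q \<in> E f" using qV by (simp add: E_def)
    then have "j = \<sigma> f" using \<sigma>[of q f] Rq by simp
    moreover have "f \<in> cube_facets_at y" using eb(2)[OF qd(2)] f by simp
    ultimately show "j \<in> \<sigma> ` cube_facets_at y" by blast
  qed
  have Req: "R y = \<sigma> ` cube_facets_at y" if "y \<in> V" for y using sub1[OF that] sub2[OF that] by blast
  have y0V: "y0 \<in> V" using y0 d by (simp add: V_def)
  have "card (\<sigma> ` cube_facets_at y0) = card (cube_facets_at y0)"
    using cardR[OF V(1)[OF y0V]] Req[OF y0V] by simp
  \<comment> \<open>At the centre the corner condition equates the cardinalities of the set of
    facets and of its image.\<close>
  then have inj: "inj_on \<sigma> (cube_facets_at y0)" by (intro eq_card_imp_inj_on) simp_all
  have inV: "p x \<in> V" if "x \<in> topspace X" "dist (p x) y0 < d" for x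
    using that p_in by (simp add: V_def dist_commute)
  have inU: "x \<in> U" if xX: "x \<in> topspace X" and xV: "p x \<in> V" for x
  proof -
    obtain z where "z \<in> U" "p x = p z" using V(1)[OF xV] by blast
    then show ?thesis using chart_saturated(1)[OF c] xX by blast
  qed
  show thesis
  proof (rule that[of d \<sigma>])
    show "d > 0" by (rule d)
    show "inj_on \<sigma> (cube_facets_at (p x0))" using inj by (simp add: y0_def)
    fix x assume x: "x \<in> topspace X" "dist (p x) (p x0) < d"
    then have pV: "p x \<in> V" using inV by (simp add: y0_def)
    show xU: "x \<in> U" by (rule inU[OF x(1) pV])
    show "{i. \<phi> x $ i = 0} = \<sigma> ` cube_facets_at (p x)" using Req[OF pV] R[OF xU] by simp
    show "cube_facets_at (p x) \<subseteq> cube_facets_at (p x0)" using V(2)[OF pV] by (simp add: y0_def)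
  qed
qed

lemma chart_stab:
  assumes c: "orbit_chart X act p U \<phi> \<theta>" and x: "x \<in> U"
  shows "stab x = {t \<in> torus. \<forall>i. \<phi> x $ i \<noteq> 0 \<longrightarrow> \<theta> t $ i = 1}"
proof -
  have "act t x = x \<longleftrightarrow> (\<forall>i. \<phi> x $ i \<noteq> 0 \<longrightarrow> \<theta> t $ i = 1)" if t: "t \<in> torus" for t
  proof -
    have "act t x = x \<longleftrightarrow> \<phi> (act t x) = \<phi> x"
      using inj_on_eq_iff[OF orbit_chartD(9)[OF c] orbit_chartD(5)[OF c t x] x] by simp
    also have "\<dots> \<longleftrightarrow> (\<forall>i. \<theta> t $ i * \<phi> x $ i = \<phi> x $ i)"
      unfolding orbit_chartD(6)[OF c t x] by (simp add: vec_eq_iff)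
    also have "\<dots> \<longleftrightarrow> (\<forall>i. \<phi> x $ i \<noteq> 0 \<longrightarrow> \<theta> t $ i = 1)" by auto
    finally show ?thesis .
  qed
  then show ?thesis unfolding stab_def by blast
qed

text \<open>Near a point of an open face the stabilizer is read off from one chart and from the set
  of vanishing coordinates, which depends on the face only. So it is locally constant over a convex
  set.\<close>

lemma stab_constant_on_faces:
  assumes x: "x \<in> topspace X" and x': "x' \<in> topspace X" and eq: "cube_facets_at (p x) = cube_facets_at (p x')"
  shows "stab x = stab x'"
proof -
  define Z where "Z = cube_facets_at (p x)"
  define E where "E = {y \<in> cbox 0 1. cube_facets_at y = Z}"
  define lift where "lift y = (SOME x. x \<in> topspace X \<and> p x = y)" for y
  have lift: "lift y \<in> topspace X" "p (lift y) = y" if y: "y \<in> cbox 0 1" for y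
  proof -
    obtain x where x: "x \<in> topspace X" "p x = y" using p_surj[OF y] .
    have "lift y \<in> topspace X \<and> p (lift y) = y" unfolding lift_def by (rule someI[of _ x]) (use x in simp)
    then show "lift y \<in> topspace X" "p (lift y) = y" by auto
  qed
  have "(\<lambda>y. stab (lift y)) constant_on E"
  proof (rule locally_constant_imp_constant)
    show "connected E" unfolding E_def by (rule convex_connected[OF convex_cube_facets_at])
    fix a assume a: "a \<in> E"
    then have ac: "a \<in> cbox 0 1" and aZ: "cube_facets_at a = Z" by (auto simp: E_def)
    obtain U \<phi> \<theta> where c: "lift a \<in> U" "orbit_chart X act p U \<phi> \<theta>" using charts[OF lift(1)[OF ac]] by blast
    obtain d \<sigma> where d: "d > 0"
      "\<And>x. x \<in> topspace X \<Longrightarrow> dist (p x) (p (lift a)) < d \<Longrightarrow> x \<in> U"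
      "\<And>x. x \<in> topspace X \<Longrightarrow> dist (p x) (p (lift a)) < d \<Longrightarrow> {i. \<phi> x $ i = 0} = \<sigma> ` cube_facets_at (p x)"
      using chart_corner_structure[OF c(2,1)] by metis
    have st: "stab (lift y) = {t \<in> torus. \<forall>i. i \<notin> \<sigma> ` Z \<longrightarrow> \<theta> t $ i = 1}" if y: "y \<in> E" "dist y a < d" for y
    proof -
      have yc: "y \<in> cbox 0 1" "cube_facets_at y = Z" using y by (auto simp: E_def)
      have yd: "dist (p (lift y)) (p (lift a)) < d" using y(2) lift(2)[OF yc(1)] lift(2)[OF ac] by simp
      have "{i. \<phi> (lift y) $ i = 0} = \<sigma> ` Z"
        using d(3)[OF lift(1)[OF yc(1)] yd] lift(2)[OF yc(1)] yc(2) by simp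
      then have "\<phi> (lift y) $ i \<noteq> 0 \<longleftrightarrow> i \<notin> \<sigma> ` Z" for i by blast
      then show ?thesis
        unfolding chart_stab[OF c(2) d(2)[OF lift(1)[OF yc(1)] yd]] by simp
    qed
    show "\<exists>T. openin (top_of_set E) T \<and> a \<in> T \<and> (\<forall>y\<in>T. stab (lift y) = stab (lift a))"
    proof (intro exI[of _ "E \<inter> ball a d"] conjI ballI)
      show "openin (top_of_set E) (E \<inter> ball a d)" by (simp add: openin_open_Int)
      show "a \<in> E \<inter> ball a d" using a d(1) by simp
      fix y assume "y \<in> E \<inter> ball a d"
      then show "stab (lift y) = stab (lift a)" using st[of y] st[of a] a d(1) by (simp add: dist_commute)
    qed
  qed
  moreover have "p x \<in> E" "p x' \<in> E" using x x' eq p_in by (auto simp: E_def Z_def)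
  ultimately have "stab (lift (p x)) = stab (lift (p x'))" unfolding constant_on_def by metis
  moreover have "stab (lift (p z)) = stab z" if "z \<in> topspace X" for z
    using stab_orbit lift[OF p_in[OF that]] that by blast
  ultimately show ?thesis using x x' by simp
qed

section \<open>Isotropy at the vertices of the cube\<close>

definition vertex :: "('n \<Rightarrow> bool) \<Rightarrow> 'n rspace" where
  "vertex b = (\<chi> i. of_bool (b i))"

lemma vertex: "vertex b \<in> cbox 0 1" "cube_facets_at (vertex b) = {(i, b i) | i. True}"
  by (auto simp: vertex_def mem_cube cube_facets_at_def of_bool_def split: if_splits)

text \<open>A chart around the fixed point over the vertex, with its coordinates renamed after the
  facets they belong to, turns stabilizers into coordinate subtori.\<close>

lemma vertex_automorphism:
  obtains \<theta> where "torus_automorphism \<theta>"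
    "\<And>x. x \<in> topspace X \<Longrightarrow> cube_facets_at (p x) \<subseteq> cube_facets_at (vertex b) \<Longrightarrow>
       stab x = {t \<in> torus. \<forall>i. (i, b i) \<notin> cube_facets_at (p x) \<longrightarrow> \<theta> t $ i = 1}"
proof -
  obtain x0 where x0: "x0 \<in> topspace X" "p x0 = vertex b" using p_surj[OF vertex(1)] .
  obtain U \<phi> \<theta> where c: "x0 \<in> U" "orbit_chart X act p U \<phi> \<theta>" using charts[OF x0(1)] by blast
  obtain d \<sigma> where d: "d > 0" "inj_on \<sigma> (cube_facets_at (p x0))"
    "\<And>x. x \<in> topspace X \<Longrightarrow> dist (p x) (p x0) < d \<Longrightarrow> x \<in> U"
    "\<And>x. x \<in> topspace X \<Longrightarrow> dist (p x) (p x0) < d \<Longrightarrow> {i. \<phi> x $ i = 0} = \<sigma> ` cube_facets_at (p x)"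
    using chart_corner_structure[OF c(2,1)] by metis
  define \<tau> where "\<tau> i = \<sigma> (i, b i)" for i
  have inj\<sigma>: "inj_on \<sigma> {(i, b i) | i. True}" using d(2) unfolding x0(2) vertex(2) .
  have "inj \<tau>" unfolding \<tau>_def by (rule injI) (use inj_onD[OF inj\<sigma>] in blast)
  then have bij: "bij \<tau>" by (simp add: bij_betw_def finite_UNIV_inj_surj)
  show thesis
  proof (rule that[of "(\<lambda>t. \<chi> i. t $ \<tau> i) \<circ> \<theta>"])
    show "torus_automorphism ((\<lambda>t. \<chi> i. t $ \<tau> i) \<circ> \<theta>)"
      by (rule torus_automorphism_compose[OF torus_automorphism_permute[OF bij] orbit_chartD(4)[OF c(2)]])
    fix x assume x: "x \<in> topspace X" and sub: "cube_facets_at (p x) \<subseteq> cube_facets_at (vertex b)"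
    \<comment> \<open>The open face of \<open>p x\<close> has the vertex in its closure, so
      \<open>x\<close> can be traded for a point inside the chart that has the same
      stabilizer.\<close>
    obtain y where y: "y \<in> cbox 0 1" "dist y (vertex b) < d" "cube_facets_at y = cube_facets_at (p x)"
      using cube_facets_at_nearby[OF vertex(1) sub d(1)] .
    obtain x' where x': "x' \<in> topspace X" "p x' = y" using p_surj[OF y(1)] .
    have xd: "dist (p x') (p x0) < d" using y x' x0 by simp
    have "stab x = stab x'" using stab_constant_on_faces[OF x x'(1)] x'(2) y(3) by simp
    also have "\<dots> = {t \<in> torus. \<forall>i. \<phi> x' $ i \<noteq> 0 \<longrightarrow> \<theta> t $ i = 1}"
      by (rule chart_stab[OF c(2) d(3)[OF x'(1) xd]])
    also have "\<dots> = {t \<in> torus. \<forall>i. (i, b i) \<notin> cube_facets_at (p x) \<longrightarrow> ((\<lambda>t. \<chi> i. t $ \<tau> i) \<circ> \<theta>) t $ i = 1}"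
    proof -
      have Zx': "{i. \<phi> x' $ i = 0} = \<sigma> ` cube_facets_at (p x)" using d(4)[OF x'(1) xd] x'(2) y(3) by simp
      have "\<phi> x' $ \<tau> i = 0 \<longleftrightarrow> (i, b i) \<in> cube_facets_at (p x)" for i
      proof -
        have "\<phi> x' $ \<tau> i = 0 \<longleftrightarrow> \<sigma> (i, b i) \<in> \<sigma> ` cube_facets_at (p x)" unfolding Zx'[symmetric] by (simp add: \<tau>_def)
        also have "\<dots> \<longleftrightarrow> (i, b i) \<in> cube_facets_at (p x)"
          by (rule inj_on_image_mem_iff[OF inj\<sigma>]) (use sub vertex(2) in auto)
        finally show ?thesis .
      qed
      then have "(\<forall>i. \<phi> x' $ i \<noteq> 0 \<longrightarrow> \<theta> t $ i = 1) \<longleftrightarrow> (\<forall>i. (i, b i) \<notin> cube_facets_at (p x) \<longrightarrow> \<theta> t $ \<tau> i = 1)" for t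
        using bij_pointE[OF bij] by metis
      then show ?thesis by simp
    qed
    finally show "stab x = {t \<in> torus. \<forall>i. (i, b i) \<notin> cube_facets_at (p x) \<longrightarrow> ((\<lambda>t. \<chi> i. t $ \<tau> i) \<circ> \<theta>) t $ i = 1}" .
  qed
qed

end

section \<open>Weights of a semifree circle\<close>

context torus_manifold_over_cube
begin

text \<open>The kernel of the \<open>i\<close>-th weight fixes the points over the edge leaving the
  vertex in direction \<open>i\<close>. These are not fixed by the whole circle, or fixed points
  would accumulate over the vertex. So semifreeness makes the weight injective, that is 1 or -1, and
  conjugating the coordinates of weight -1 makes the circle diagonal.\<close>

lemma semifree_vertex_automorphism:
  assumes cont: "continuous_on (sphere 0 1) \<gamma>" and inj: "inj_on \<gamma> (sphere 0 1)"
    and mult: "\<And>s t. s \<in> sphere 0 1 \<Longrightarrow> t \<in> sphere 0 1 \<Longrightarrow> \<gamma> (s * t) = \<gamma> s * \<gamma> t"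
    and sub: "\<gamma> ` sphere 0 1 \<subseteq> torus"
    and semifree: "semifree X act (\<gamma> ` sphere 0 1)"
    and isolated: "has_isolated_fixed_points X act (\<gamma> ` sphere 0 1)"
  obtains \<theta> where "torus_automorphism \<theta>"
    "\<And>x. x \<in> topspace X \<Longrightarrow> cube_facets_at (p x) \<subseteq> cube_facets_at (vertex b) \<Longrightarrow>
       stab x = {t \<in> torus. \<forall>i. (i, b i) \<notin> cube_facets_at (p x) \<longrightarrow> \<theta> t $ i = 1}"
    "\<And>s. s \<in> sphere 0 1 \<Longrightarrow> \<theta> (\<gamma> s) = (\<chi> i. s)"
proof -
  obtain \<theta> where \<theta>: "torus_automorphism \<theta>"
    and st: "\<And>x. x \<in> topspace X \<Longrightarrow> cube_facets_at (p x) \<subseteq> cube_facets_at (vertex b) \<Longrightarrow>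
       stab x = {t \<in> torus. \<forall>i. (i, b i) \<notin> cube_facets_at (p x) \<longrightarrow> \<theta> t $ i = 1}"
  proof (rule vertex_automorphism[of b])
    fix \<theta> assume 1: "torus_automorphism \<theta>" and
      2: "\<And>x. x \<in> topspace X \<Longrightarrow> cube_facets_at (p x) \<subseteq> cube_facets_at (vertex b) \<Longrightarrow>
       stab x = {t \<in> torus. \<forall>i. (i, b i) \<notin> cube_facets_at (p x) \<longrightarrow> \<theta> t $ i = 1}"
    show thesis by (rule that[OF 1 2])
  qed
  have \<gamma>t: "\<gamma> s \<in> torus" if "s \<in> sphere 0 1" for s using sub that by blast
  have mem1: "(1 :: complex) \<in> sphere 0 1" by simp
  have \<gamma>1: "\<gamma> 1 = 1"
  proof -
    have "\<gamma> 1 = \<gamma> 1 * \<gamma> 1" using mult[OF mem1 mem1] by simp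
    then show ?thesis using \<gamma>t[OF mem1] by (simp add: vec_eq_iff torus_def) (metis norm_zero zero_neq_one)
  qed
  have \<theta>m: "\<theta> (s * t) = \<theta> s * \<theta> t" if "s \<in> torus" "t \<in> torus" for s t
    using \<theta> that unfolding torus_automorphism_def by blast
  have f: "(\<forall>s\<in>sphere 0 1. \<theta> (\<gamma> s) $ i = s) \<or> (\<forall>s\<in>sphere 0 1. \<theta> (\<gamma> s) $ i = cnj s)" for i
  proof (rule injective_circle_hom)
    have "continuous_on (sphere 0 1) (\<lambda>s. \<theta> (\<gamma> s))"
      by (rule continuous_on_compose2[OF _ cont sub]) (use \<theta> in \<open>simp add: torus_automorphism_def\<close>)
    then show "continuous_on (sphere 0 1) (\<lambda>s. \<theta> (\<gamma> s) $ i)" by (rule continuous_on_component)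
    show "(\<lambda>s. \<theta> (\<gamma> s) $ i) \<in> sphere 0 1 \<rightarrow> sphere 0 1"
      using torus_automorphism_in[OF \<theta> \<gamma>t] by (auto simp: torus_def)
    show "\<theta> (\<gamma> (z * w)) $ i = \<theta> (\<gamma> z) $ i * \<theta> (\<gamma> w) $ i" if "z \<in> sphere 0 1" "w \<in> sphere 0 1" for z w
      using mult[OF that] \<theta>m[OF \<gamma>t \<gamma>t] that by simp
    fix s :: complex assume s: "s \<in> sphere 0 1" "\<theta> (\<gamma> s) $ i = 1"
    \<comment> \<open>The facets containing the edge that leaves \<open>vertex b\<close> in
      direction \<open>i\<close>.\<close>
    define Z where "Z = cube_facets_at (vertex b) - {(i, b i)}"
    have Zs: "Z \<subseteq> cube_facets_at (vertex b)" by (auto simp: Z_def)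
    have stZ: "stab x = {t \<in> torus. \<theta> t $ i = 1}" if "x \<in> topspace X" "cube_facets_at (p x) = Z" for x
    proof -
      have "(j, b j) \<notin> Z \<longleftrightarrow> j = i" for j unfolding Z_def vertex(2) by auto
      then show ?thesis using st[OF that(1)] that(2) Zs by simp
    qed
    obtain y where y: "y \<in> cbox 0 1" "cube_facets_at y = Z" using cube_facets_at_nearby[OF vertex(1) Zs zero_less_one] .
    obtain x where x: "x \<in> topspace X" "p x = y" using p_surj[OF y(1)] .
    have stx: "stab x = {t \<in> torus. \<theta> t $ i = 1}" using stZ[OF x(1)] x(2) y(2) by simp
    then have "\<gamma> s \<in> stab x" using s \<gamma>t by blast
    then have fix_s: "act (\<gamma> s) x = x" by (simp add: stab_def)
    have "x \<notin> fixed_points X act (\<gamma> ` sphere 0 1)"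
    proof
      assume xF: "x \<in> fixed_points X act (\<gamma> ` sphere 0 1)"
      have all: "\<theta> (\<gamma> s') $ i = 1" if s': "s' \<in> sphere 0 1" for s'
      proof -
        have "act (\<gamma> s') x = x" using xF s' unfolding fixed_points_def by blast
        then have "\<gamma> s' \<in> stab x" using \<gamma>t[OF s'] by (simp add: stab_def)
        then show ?thesis using stx by blast
      qed
      obtain xv where xv: "xv \<in> topspace X" "p xv = vertex b" using p_surj[OF vertex(1)] .
      have "stab xv = torus" using st[OF xv(1)] xv(2) vertex(2)[of b] by auto
      then have xvF: "xv \<in> fixed_points X act (\<gamma> ` sphere 0 1)"
        using xv(1) sub unfolding fixed_points_def stab_def by blast
      \<comment> \<open>If the \<open>i\<close>-th weight were trivial, all points over the edge
        would be fixed, including those arbitrarily close to \<open>xv\<close>.\<close>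
      have "openin (subtopology X (fixed_points X act (\<gamma> ` sphere 0 1))) {xv}"
        using isolated xvF unfolding has_isolated_fixed_points_def by simp
      then obtain W where W: "openin X W" "{xv} = W \<inter> fixed_points X act (\<gamma> ` sphere 0 1)"
        unfolding openin_subtopology by blast
      have "vertex b \<in> p ` W" using W(2) xv(2) by (metis IntE imageI singletonI)
      then obtain e where e: "e > 0" "\<And>y. y \<in> cbox 0 1 \<Longrightarrow> dist y (vertex b) < e \<Longrightarrow> y \<in> p ` W"
        using open_p[OF W(1)] unfolding openin_euclidean_subtopology_iff by blast
      obtain y' where y': "y' \<in> cbox 0 1" "dist y' (vertex b) < e" "cube_facets_at y' = Z"
        using cube_facets_at_nearby[OF vertex(1) Zs e(1)] .
      obtain x' where x': "x' \<in> W" "p x' = y'" using e(2)[OF y'(1,2)] by blast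
      have x'X: "x' \<in> topspace X" using x'(1) W(1) openin_subset by blast
      have "stab x' = {t \<in> torus. \<theta> t $ i = 1}" using stZ[OF x'X] x'(2) y'(3) by simp
      then have "x' \<in> fixed_points X act (\<gamma> ` sphere 0 1)"
        using all \<gamma>t x'X unfolding fixed_points_def stab_def by blast
      then have "x' = xv" using W(2) x'(1) by blast
      then have "Z = cube_facets_at (vertex b)" using x'(2) xv(2) y'(3) by simp
      then show False unfolding Z_def vertex(2) by blast
    qed
    then have "\<gamma> s = 1" using semifree x(1) fix_s s(1) unfolding semifree_def by blast
    then show "s = 1" using inj_onD[OF inj, of s 1] \<gamma>1 s(1) mem1 by metis
  qed
  define N where "N i \<longleftrightarrow> \<not> (\<forall>s\<in>sphere 0 1. \<theta> (\<gamma> s) $ i = s)" for i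
  have eq1: "((\<lambda>t. \<chi> i. if N i then cnj (t $ i) else t $ i) \<circ> \<theta>) t $ i = 1 \<longleftrightarrow> \<theta> t $ i = 1" for t i
    using complex_cnj_cancel_iff[of "\<theta> t $ i" 1] by simp
  show thesis
  proof (rule that[of "(\<lambda>t. \<chi> i. if N i then cnj (t $ i) else t $ i) \<circ> \<theta>"])
    show "torus_automorphism ((\<lambda>t. \<chi> i. if N i then cnj (t $ i) else t $ i) \<circ> \<theta>)"
      by (rule torus_automorphism_compose[OF torus_automorphism_flip \<theta>])
    show "((\<lambda>t. \<chi> i. if N i then cnj (t $ i) else t $ i) \<circ> \<theta>) (\<gamma> s) = (\<chi> i. s)" if "s \<in> sphere 0 1" for s
    proof -
      have "N i \<Longrightarrow> \<theta> (\<gamma> s) $ i = cnj s" "\<not> N i \<Longrightarrow> \<theta> (\<gamma> s) $ i = s" for i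
        using f[of i] that N_def by blast+
      then show ?thesis by (simp add: vec_eq_iff)
    qed
    fix x assume "x \<in> topspace X" "cube_facets_at (p x) \<subseteq> cube_facets_at (vertex b)"
    then show "stab x = {t \<in> torus. \<forall>i. (i, b i) \<notin> cube_facets_at (p x) \<longrightarrow>
        ((\<lambda>t. \<chi> i. if N i then cnj (t $ i) else t $ i) \<circ> \<theta>) t $ i = 1}"
      unfolding eq1 by (rule st)
  qed
qed

end

text \<open>Read \<open>i \<in> N j\<close> as: \<open>j\<close> precedes \<open>i\<close>. A
  smallest nonempty set whose elements have predecessors inside it works: the image of any choice of
  predecessors is again such a set, so every choice permutes \<open>K'\<close>, and this leaves no
  freedom at a single element.\<close>

lemma unique_predecessor_subset:
  fixes N :: "'n \<Rightarrow> 'n set"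
  assumes "finite K" "K \<noteq> {}" "\<forall>i\<in>K. \<exists>j\<in>K. i \<in> N j"
  obtains K' where "K' \<noteq> {}" "\<And>i. i \<in> K' \<Longrightarrow> \<exists>!j. j \<in> K' \<and> i \<in> N j"
proof -
  let ?bad = "\<lambda>K. K \<noteq> {} \<and> finite K \<and> (\<forall>i\<in>K. \<exists>j\<in>K. i \<in> N j)"
  have "?bad K" using assms by blast
  then have "\<exists>K'. ?bad K' \<and> (\<forall>L. ?bad L \<longrightarrow> card K' \<le> card L)" by (rule ex_has_least_nat)
  then obtain K' where *: "?bad K' \<and> (\<forall>L. ?bad L \<longrightarrow> card K' \<le> card L)" by (rule exE)
  have K': "?bad K'" by (rule conjunct1[OF *])
  have min: "card K' \<le> card L" if "?bad L" for L
    by (rule mp[OF spec[OF conjunct2[OF *]] that])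
  have surj: "q ` K' = K'" if q: "\<And>i. i \<in> K' \<Longrightarrow> q i \<in> K' \<and> i \<in> N (q i)" for q
  proof (rule card_subset_eq)
    have "?bad (q ` K')" using K' q by auto
    then have "card K' \<le> card (q ` K')" by (rule min)
    moreover have "card (q ` K') \<le> card K'" using K' by (intro card_image_le) blast
    ultimately show "card (q ` K') = card K'" by (rule le_antisym[rotated])
    show "q ` K' \<subseteq> K'" using q by blast
  qed (use K' in blast)
  have "\<forall>i\<in>K'. \<exists>j. j \<in> K' \<and> i \<in> N j" using K' by blast
  then obtain q where q: "\<And>i. i \<in> K' \<Longrightarrow> q i \<in> K' \<and> i \<in> N (q i)" by metis
  have "q ` K' = K'" by (rule surj) (rule q)
  then have injq: "inj_on q K'" using K' by (intro eq_card_imp_inj_on) simp_all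
  show thesis
  proof (rule that[of K'])
    show "K' \<noteq> {}" using K' by blast
    fix i assume i: "i \<in> K'"
    show "\<exists>!j. j \<in> K' \<and> i \<in> N j"
    proof (rule ex1I[of _ "q i"])
      show "q i \<in> K' \<and> i \<in> N (q i)" using q i by blast
      fix v assume v: "v \<in> K' \<and> i \<in> N v"
      show "v = q i"
      proof (rule ccontr)
        assume ne: "v \<noteq> q i"
        \<comment> \<open>Redirecting the choice at \<open>i\<close> must again give a permutation,
          but nothing is sent to \<open>q i\<close> any more, \<open>q\<close> being
          injective.\<close>
        have "(q(i := v)) ` K' = K'" by (rule surj) (use q v in auto)
        then have "q i \<in> (q(i := v)) ` K'" using q[OF i] by simp
        then obtain k where k: "k \<in> K'" "q i = (q(i := v)) k" by blast
        show False
        proof (cases "k = i")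
          case True then show ?thesis using k ne by simp
        next
          case False
          then have "q i = q k" using k by simp
          then show ?thesis using inj_onD[OF injq] i k(1) False by blast
        qed
      qed
    qed
  qed
qed

text \<open>Repeatedly take out an element without predecessor among the remaining ones.
  \<open>\<rho>\<close> sends each entry of the resulting list to the entry at the same position in
  the given order of the index type, which is the order a Bott tower refers to.\<close>

lemma topological_sort:
  fixes N :: "'n::{finite,linorder} \<Rightarrow> 'n set"
  assumes acyclic: "\<And>K. K \<noteq> {} \<Longrightarrow> \<exists>i\<in>K. \<forall>j\<in>K. i \<notin> N j"
  obtains \<rho> :: "'n \<Rightarrow> 'n" where "bij \<rho>" "\<And>i j. i \<in> N j \<Longrightarrow> \<rho> j < \<rho> i"
proof -
  have ex: "\<exists>xs. distinct xs \<and> set xs = S \<and> sorted_wrt (\<lambda>x y. x \<notin> N y) xs" if "finite S" for S :: "'n set"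
    using that
  proof (induction "card S" arbitrary: S)
    case 0
    then show ?case by simp
  next
    case (Suc m)
    then have "S \<noteq> {}" by auto
    then obtain i where i: "i \<in> S" "\<forall>j\<in>S. i \<notin> N j" using acyclic by blast
    have "m = card (S - {i})" using Suc.hyps(2) i(1) Suc.prems by simp
    then obtain xs where "distinct xs" "set xs = S - {i}" "sorted_wrt (\<lambda>x y. x \<notin> N y) xs"
      using Suc.hyps(1) Suc.prems by blast
    then show ?case using i by (intro exI[of _ "i # xs"]) auto
  qed
  then obtain xs :: "'n list" where xs: "distinct xs" "set xs = UNIV" "sorted_wrt (\<lambda>x y. x \<notin> N y) xs"
    using ex[OF finite_class.finite_UNIV] by metis
  define ys :: "'n list" where "ys = sorted_list_of_set UNIV"
  have ys: "distinct ys" "set ys = UNIV" "sorted_wrt (<) ys"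
    by (simp_all add: ys_def sorted_list_of_set.strict_sorted_key_list_of_set)
  have len: "length xs = CARD('n)" "length ys = CARD('n)"
    using distinct_card[OF xs(1)] distinct_card[OF ys(1)] xs(2) ys(2) by simp_all
  have bx: "bij_betw ((!) xs) {..<CARD('n)} UNIV" using bij_betw_nth[OF xs(1)] len xs(2) by simp
  have bys: "bij_betw ((!) ys) {..<CARD('n)} UNIV" using bij_betw_nth[OF ys(1)] len ys(2) by simp
  define pos where "pos = inv_into {..<CARD('n)} ((!) xs)"
  have bp: "bij_betw pos UNIV {..<CARD('n)}" unfolding pos_def by (rule bij_betw_inv_into[OF bx])
  have pos: "xs ! pos i = i" "pos i < CARD('n)" for i
    using bij_betw_inv_into_right[OF bx] bij_betwE[OF bp] unfolding pos_def by auto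
  show thesis
  proof (rule that[of "\<lambda>i. ys ! pos i"])
    show "bij (\<lambda>i. ys ! pos i)" using bij_betw_trans[OF bp bys] by (simp add: o_def)
    fix i j assume ij: "i \<in> N j"
    have "i \<noteq> j" using acyclic[of "{i}"] ij by auto
    have "\<not> pos i < pos j"
      using sorted_wrt_nth_less[OF xs(3), of "pos i" "pos j"] pos len ij by auto
    moreover have "pos i \<noteq> pos j" using \<open>i \<noteq> j\<close> pos by metis
    ultimately have "pos j < pos i" by simp
    then show "ys ! pos j < ys ! pos i" using sorted_wrt_nth_less[OF ys(3)] pos len by simp
  qed
qed

section \<open>Coordinate circles and a normal form for the isotropy\<close>

definition coordinate_circle :: "'n::finite \<Rightarrow> complex \<Rightarrow> 'n cspace" where
  "coordinate_circle i s = (\<chi> j. if j = i then s else 1)"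

lemma coordinate_circle: "s \<in> sphere 0 1 \<Longrightarrow> coordinate_circle i s \<in> torus"
  "coordinate_circle i (s * t) = coordinate_circle i s * coordinate_circle i t"
  "coordinate_circle i s $ j = (if j = i then s else 1)"
  by (auto simp: coordinate_circle_def torus_def vec_eq_iff)

lemma prod_vec_nth: "(\<Prod>i\<in>S. f i :: 'n::finite cspace) $ j = (\<Prod>i\<in>S. f i $ j)"
  by (induction S rule: infinite_finite_induct) auto

lemma torus_coordinate_product: "(\<Prod>i\<in>UNIV. coordinate_circle i (t $ i)) = (t :: 'n::finite cspace)"
  by (simp add: vec_eq_iff prod_vec_nth coordinate_circle(3))

lemma torus_prod: "finite S \<Longrightarrow> (\<And>i. i \<in> S \<Longrightarrow> f i \<in> torus) \<Longrightarrow> (\<Prod>i\<in>S. f i) \<in> torus"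
  by (induction S rule: finite_induct) (auto intro: torus_mult torus_one)

lemma torus_automorphism_prod:
  assumes "torus_automorphism \<theta>" "finite S" "\<And>i. i \<in> S \<Longrightarrow> f i \<in> torus"
  shows "\<theta> (\<Prod>i\<in>S. f i) = (\<Prod>i\<in>S. \<theta> (f i))"
  using assms(2,3)
proof (induction S rule: finite_induct)
  case empty
  then show ?case using torus_automorphism_one[OF assms(1)] by simp
next
  case (insert x F)
  have "f x \<in> torus" "(\<Prod>i\<in>F. f i) \<in> torus" using insert by (auto intro: torus_prod)
  then have "\<theta> (f x * (\<Prod>i\<in>F. f i)) = \<theta> (f x) * \<theta> (\<Prod>i\<in>F. f i)"
    using assms(1) unfolding torus_automorphism_def by blast
  then show ?case using insert by simp
qed

text \<open>\<open>M b i\<close> is the circle of the facet \<open>(i, b i)\<close>, parametrized at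
  the vertex \<open>b\<close> and written in the coordinates \<open>\<theta>\<close> of the base
  vertex. Up to inversion of the parameter it depends on \<open>b i\<close> alone, and for each
  \<open>b\<close> these circles multiply to the diagonal. \<open>N j\<close> collects the indices
  whose circle is inverted when the edge \<open>j\<close> is crossed from the base vertex.\<close>

lemma vertex_automorphisms_normal_form:
  fixes \<Theta> :: "('n::finite \<Rightarrow> bool) \<Rightarrow> 'n cspace \<Rightarrow> 'n cspace"
  assumes auto: "\<And>b. torus_automorphism (\<Theta> b)"
    and facet: "\<And>b b' i. b i = b' i \<Longrightarrow> {t \<in> torus. \<forall>j. j \<noteq> i \<longrightarrow> \<Theta> b t $ j = 1} = {t \<in> torus. \<forall>j. j \<noteq> i \<longrightarrow> \<Theta> b' t $ j = 1}"
    and \<gamma>: "\<And>s. s \<in> sphere 0 1 \<Longrightarrow> \<gamma> s \<in> torus" "\<And>s b. s \<in> sphere 0 1 \<Longrightarrow> \<Theta> b (\<gamma> s) = (\<chi> i. s)"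
  obtains N :: "'n \<Rightarrow> 'n set" where "\<And>K. K \<noteq> {} \<Longrightarrow> \<exists>i\<in>K. \<forall>j\<in>K. i \<notin> N j"
    "\<And>b A. \<Theta> (\<lambda>_. False) ` {t \<in> torus. \<forall>i. i \<notin> A \<longrightarrow> \<Theta> b t $ i = 1} =
      {t. \<exists>s\<in>torus. (\<forall>i. i \<notin> A \<longrightarrow> s $ i = 1) \<and> t = (\<chi> j. s $ j * (\<Prod>i\<in>{i. b i \<and> j \<in> N i}. (s $ i)\<^sup>2))}"
proof -
  let ?C = "sphere (0 :: complex) 1"
  define \<theta> where "\<theta> = \<Theta> (\<lambda>_. False)"
  define I where "I b = inv_into torus (\<Theta> b)" for b
  define M where "M b i s = \<theta> (I b (coordinate_circle i s))" for b i s
  have \<theta>: "torus_automorphism \<theta>" unfolding \<theta>_def by (rule auto)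
  have I: "torus_automorphism (I b)" for b unfolding I_def by (rule torus_automorphism_inv[OF auto])
  have It: "I b t \<in> torus" if "t \<in> torus" for b t by (rule torus_automorphism_in[OF I that])
  have bij: "bij_betw (\<Theta> b) torus torus" for b using auto unfolding torus_automorphism_def by blast
  have \<Theta>I: "\<Theta> b (I b t) = t" if "t \<in> torus" for b t
    unfolding I_def by (rule bij_betw_inv_into_right[OF bij that])
  have I\<Theta>: "I b (\<Theta> b t) = t" if "t \<in> torus" for b t
    unfolding I_def by (rule bij_betw_inv_into_left[OF bij that])
  have cc: "coordinate_circle i s \<in> torus" if "s \<in> ?C" for i s by (rule coordinate_circle(1)[OF that])
  have M0: "M (\<lambda>_. False) i s = coordinate_circle i s" if "s \<in> ?C" for i s
    unfolding M_def \<theta>_def by (rule \<Theta>I[OF cc[OF that]])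
  have Mprod: "\<theta> (I b t) = (\<Prod>i\<in>UNIV. M b i (t $ i))" if t: "t \<in> torus" for b t
  proof -
    have ti: "t $ i \<in> ?C" for i using t by (simp add: torus_def)
    have "\<theta> (I b t) = \<theta> (I b (\<Prod>i\<in>UNIV. coordinate_circle i (t $ i)))" by (simp only: torus_coordinate_product)
    also have "\<dots> = \<theta> (\<Prod>i\<in>UNIV. I b (coordinate_circle i (t $ i)))"
      by (subst torus_automorphism_prod[OF I]) (auto intro: cc[OF ti])
    also have "\<dots> = (\<Prod>i\<in>UNIV. \<theta> (I b (coordinate_circle i (t $ i))))"
      by (subst torus_automorphism_prod[OF \<theta>]) (auto intro: It cc[OF ti])
    finally show ?thesis unfolding M_def .
  qed
  have diag: "\<theta> (I b (\<chi> i. s)) = (\<chi> i. s)" if s: "s \<in> ?C" for b s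
  proof -
    have "I b (\<chi> i. s) = \<gamma> s" using I\<Theta>[OF \<gamma>(1)[OF s], of b] unfolding \<gamma>(2)[OF s] .
    then show ?thesis unfolding \<theta>_def by (simp only: \<gamma>(2)[OF s])
  qed
  \<comment> \<open>Two parametrizations of the same facet circle differ by an automorphism of the
    circle, so by the identity or by inversion.\<close>
  have Mflip: "(\<forall>s\<in>?C. M b i s = M b' i s) \<or> (\<forall>s\<in>?C. M b i s = M b' i (cnj s))" if bi: "b i = b' i" for b b' i
  proof -
    define f where "f s = \<Theta> b' (I b (coordinate_circle i s)) $ i" for s
    have other: "\<Theta> b' (I b (coordinate_circle i s)) $ j = 1" if s: "s \<in> ?C" and j: "j \<noteq> i" for s j
    proof -
      have "I b (coordinate_circle i s) \<in> {t \<in> torus. \<forall>j. j \<noteq> i \<longrightarrow> \<Theta> b t $ j = 1}"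
        using It[OF cc[OF s]] by (simp add: \<Theta>I[OF cc[OF s]] coordinate_circle(3))
      then have "I b (coordinate_circle i s) \<in> {t \<in> torus. \<forall>j. j \<noteq> i \<longrightarrow> \<Theta> b' t $ j = 1}"
        unfolding facet[where b = b and b' = b' and i = i, OF bi] .
      then show ?thesis using j by blast
    qed
    have cf: "\<Theta> b' (I b (coordinate_circle i s)) = coordinate_circle i (f s)" if s: "s \<in> ?C" for s
      using other[OF s] by (simp add: vec_eq_iff coordinate_circle(3) f_def)
    have tor: "\<Theta> b' (I b (coordinate_circle i s)) \<in> torus" if s: "s \<in> ?C" for s
      by (rule torus_automorphism_in[OF auto It[OF cc[OF s]]])
    have fC: "f s \<in> ?C" if s: "s \<in> ?C" for s using tor[OF s] by (simp add: f_def torus_def)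
    have comp: "torus_automorphism (\<Theta> b' \<circ> I b)" by (rule torus_automorphism_compose[OF auto I])
    have "(\<forall>s\<in>?C. f s = s) \<or> (\<forall>s\<in>?C. f s = cnj s)"
    proof (rule injective_circle_hom)
      have "continuous_on ?C (\<lambda>s. if j = i then s else 1)" for j by (cases "j = i") simp_all
      then have "continuous_on ?C (coordinate_circle i)"
        unfolding coordinate_circle_def by (rule continuous_on_vec_lambda)
      moreover have "continuous_on torus (\<Theta> b' \<circ> I b)" using comp unfolding torus_automorphism_def by blast
      ultimately have "continuous_on ?C (\<lambda>s. (\<Theta> b' \<circ> I b) (coordinate_circle i s))"
        using cc by (intro continuous_on_compose2[of torus "\<Theta> b' \<circ> I b" ?C "coordinate_circle i"]) auto
      then show "continuous_on ?C f" unfolding f_def by (intro continuous_on_component) simp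
      show "f \<in> ?C \<rightarrow> ?C" using fC by blast
      show "f (z * w) = f z * f w" if "z \<in> ?C" "w \<in> ?C" for z w
      proof -
        have "(\<Theta> b' \<circ> I b) (coordinate_circle i z * coordinate_circle i w)
          = (\<Theta> b' \<circ> I b) (coordinate_circle i z) * (\<Theta> b' \<circ> I b) (coordinate_circle i w)"
          using comp cc[OF that(1)] cc[OF that(2)] unfolding torus_automorphism_def by blast
        then show ?thesis unfolding f_def coordinate_circle(2) by simp
      qed
      fix s assume s: "s \<in> ?C" "f s = 1"
      have "\<Theta> b' (I b (coordinate_circle i s)) = 1"
        unfolding cf[OF s(1)] s(2) by (simp add: vec_eq_iff coordinate_circle(3))
      then have "I b' 1 = I b (coordinate_circle i s)" using I\<Theta>[OF It[OF cc[OF s(1)]], of b'] by metis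
      then have "I b (coordinate_circle i s) = 1" using torus_automorphism_one[OF I] by metis
      then have "coordinate_circle i s = 1" using \<Theta>I[OF cc[OF s(1)], of b] torus_automorphism_one[OF auto] by metis
      then have "coordinate_circle i s $ i = 1" by simp
      then show "s = 1" by (simp add: coordinate_circle(3))
    qed
    moreover have "M b i s = M b' i (f s)" if s: "s \<in> ?C" for s
    proof -
      have "I b' (\<Theta> b' (I b (coordinate_circle i s))) = I b (coordinate_circle i s)"
        by (rule I\<Theta>[OF It[OF cc[OF s]]])
      then show ?thesis unfolding M_def cf[OF s] by simp
    qed
    ultimately show ?thesis by auto
  qed
  have Mflip0: "(\<forall>s\<in>?C. M b i s = coordinate_circle i s) \<or> (\<forall>s\<in>?C. M b i s = coordinate_circle i (cnj s))"
    if "\<not> b i" for b i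
    using Mflip[of b i "\<lambda>_. False"] that M0 by (auto simp: M0)
  define N where "N j = {i. i \<noteq> j \<and> (\<forall>s\<in>?C. M (\<lambda>k. k = j) i s $ i = cnj s)}" for j
  define \<Lambda> where "\<Lambda> j = M (\<lambda>k. k = j) j" for j
  have sc: "s * cnj s = 1" if "s \<in> ?C" for s using that by (simp flip: complex_norm_square)
  \<comment> \<open>At the neighbour across the edge \<open>j\<close>, only the factors
    \<open>i\<close> and \<open>j\<close> can differ from 1 in entry \<open>i\<close>. The diagonal
    relation therefore determines the new circle.\<close>
  have \<Lambda>: "\<Lambda> j s $ i = (if i = j then s else if i \<in> N j then s\<^sup>2 else 1)" if s: "s \<in> ?C" for j i s
  proof -
    let ?b = "\<lambda>k. k = j"
    have tor: "(\<chi> i. s) \<in> torus" using s by (simp add: torus_def)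
    have "s = (\<Prod>k\<in>UNIV. M ?b k s $ i)"
      using diag[OF s, of ?b] unfolding Mprod[OF tor] by (simp add: vec_eq_iff prod_vec_nth)
    also have "\<dots> = (\<Prod>k\<in>{i, j}. M ?b k s $ i)"
    proof (rule prod.mono_neutral_right)
      show "\<forall>k\<in>UNIV - {i, j}. M ?b k s $ i = 1"
      proof
        fix k assume "k \<in> UNIV - {i, j}"
        then show "M ?b k s $ i = 1" using Mflip0[of ?b k] s by (auto simp: coordinate_circle(3))
      qed
    qed auto
    finally have eq: "s = (\<Prod>k\<in>{i, j}. M ?b k s $ i)" .
    show ?thesis
    proof (cases "i = j")
      case True
      then show ?thesis using eq by (simp add: \<Lambda>_def)
    next
      case False
      then have eq2: "s = M ?b i s $ i * \<Lambda> j s $ i" using eq by (simp add: \<Lambda>_def)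
      have or: "(\<forall>s\<in>?C. M ?b i s $ i = s) \<or> (\<forall>s\<in>?C. M ?b i s $ i = cnj s)"
        using Mflip0[of ?b i] False by (auto simp: coordinate_circle(3))
      show ?thesis
      proof (cases "i \<in> N j")
        case True
        then have "s = cnj s * \<Lambda> j s $ i" using eq2 s by (simp add: N_def)
        then have "s * s = s * cnj s * \<Lambda> j s $ i" by (simp add: mult.assoc)
        then show ?thesis using True \<open>i \<noteq> j\<close> sc[OF s] by (simp add: power2_eq_square)
      next
        case False
        then have "M ?b i s $ i = s" using or s \<open>i \<noteq> j\<close> unfolding N_def by blast
        moreover have "s \<noteq> 0" using s by auto
        ultimately have "\<Lambda> j s $ i = 1" using eq2 by simp
        then show ?thesis using False \<open>i \<noteq> j\<close> by simp
      qed
    qed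
  qed
  \<comment> \<open>At a general vertex every circle is a coordinate circle or some
    \<open>\<Lambda> i\<close>, up to inversion; \<open>fl\<close> records the inversions.\<close>
  have \<Phi>: "\<exists>fl :: 'n \<Rightarrow> bool. \<forall>t\<in>torus. \<theta> (I b t) =
      (\<chi> j. (if fl j then cnj (t $ j) else t $ j) * (\<Prod>i\<in>{i. b i \<and> j \<in> N i}. (if fl i then cnj (t $ i) else t $ i)\<^sup>2))" for b
  proof -
    define L where "L i = (if b i then \<Lambda> i else coordinate_circle i)" for i
    have "\<exists>fl. \<forall>s\<in>?C. M b i s = L i (if fl then cnj s else s)" for i
    proof -
      have "(\<forall>s\<in>?C. M b i s = L i s) \<or> (\<forall>s\<in>?C. M b i s = L i (cnj s))"
        using Mflip0[of b i] Mflip[of b i "\<lambda>k. k = i"] by (auto simp: L_def \<Lambda>_def)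
      then show ?thesis
      proof
        assume "\<forall>s\<in>?C. M b i s = L i s"
        then show ?thesis by (intro exI[of _ False]) simp
      next
        assume "\<forall>s\<in>?C. M b i s = L i (cnj s)"
        then show ?thesis by (intro exI[of _ True]) simp
      qed
    qed
    then obtain fl where fl: "\<And>i s. s \<in> ?C \<Longrightarrow> M b i s = L i (if fl i then cnj s else s)" by metis
    show ?thesis
    proof (intro exI[of _ fl] ballI)
      fix t :: "'n cspace" assume t: "t \<in> torus"
      define x where "x i = (if fl i then cnj (t $ i) else t $ i)" for i
      have ti: "t $ i \<in> ?C" for i using t by (simp add: torus_def)
      have xi: "x i \<in> ?C" for i using ti[of i] by (simp add: x_def)
      have Lx: "L i (x i) $ j = (if i = j then x i else 1) * (if b i \<and> j \<in> N i then (x i)\<^sup>2 else 1)" for i j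
        unfolding L_def using \<Lambda>[OF xi[of i], of i j] by (auto simp: coordinate_circle(3) N_def)
      have "\<theta> (I b t) $ j = x j * (\<Prod>i\<in>{i. b i \<and> j \<in> N i}. (x i)\<^sup>2)" for j
      proof -
        have "\<theta> (I b t) $ j = (\<Prod>i\<in>UNIV. M b i (t $ i) $ j)" unfolding Mprod[OF t] by (rule prod_vec_nth)
        also have "\<dots> = (\<Prod>i\<in>UNIV. L i (x i) $ j)" unfolding fl[OF ti] x_def ..
        also have "\<dots> = (\<Prod>i\<in>UNIV. if i = j then x i else 1) * (\<Prod>i\<in>UNIV. if b i \<and> j \<in> N i then (x i)\<^sup>2 else 1)"
          unfolding Lx by (rule prod.distrib)
        also have "(\<Prod>i\<in>UNIV. if i = j then x i else 1) = x j" by simp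
        also have "(\<Prod>i\<in>UNIV. if b i \<and> j \<in> N i then (x i)\<^sup>2 else 1) = (\<Prod>i\<in>{i. b i \<and> j \<in> N i}. (x i)\<^sup>2)"
          by (simp add: prod.If_cases)
        finally show ?thesis .
      qed
      then show "\<theta> (I b t) = (\<chi> j. (if fl j then cnj (t $ j) else t $ j) * (\<Prod>i\<in>{i. b i \<and> j \<in> N i}. (if fl i then cnj (t $ i) else t $ i)\<^sup>2))"
        by (simp add: vec_eq_iff x_def)
    qed
  qed
  have acyclic: "\<exists>i\<in>K. \<forall>j\<in>K. i \<notin> N j" if Kne: "K \<noteq> {}" for K
  proof (rule ccontr)
    assume "\<not> (\<exists>i\<in>K. \<forall>j\<in>K. i \<notin> N j)"
    then have bad: "\<forall>i\<in>K. \<exists>j\<in>K. i \<in> N j" by blast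
    obtain K' where K': "K' \<noteq> {}" "\<And>i. i \<in> K' \<Longrightarrow> \<exists>!j. j \<in> K' \<and> i \<in> N j"
      using unique_predecessor_subset[OF finite Kne bad] by metis
    \<comment> \<open>A point of the circle with \<open>s ^ 4 \<noteq> 1\<close>, which separates
      the exponent 1 from the exponents 3, -1 and -3 that are excluded in
      \<open>key\<close>.\<close>
    define s where "s = Complex (3/5) (4/5)"
    have s: "s \<in> ?C" by (simp add: s_def cmod_def power2_eq_square)
    have tor: "(\<chi> i. s) \<in> torus" using s by (simp add: torus_def)
    obtain fl where fl': "\<forall>t\<in>torus. \<theta> (I (\<lambda>i. i \<in> K') t) =
      (\<chi> j. (if fl j then cnj (t $ j) else t $ j) * (\<Prod>i\<in>{i. i \<in> K' \<and> j \<in> N i}. (if fl i then cnj (t $ i) else t $ i)\<^sup>2))"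
      using \<Phi>[of "\<lambda>i. i \<in> K'"] by (rule exE)
    note fl = bspec[OF fl']
    \<comment> \<open>A sign plus twice a sign equals 1 only as -1 + 2.\<close>
    have key: "fl i \<and> \<not> fl k" if i: "i \<in> K'" and k: "k \<in> K'" "i \<in> N k" for i k
    proof -
      have set: "{j. j \<in> K' \<and> i \<in> N j} = {k}" using K'(2)[OF i] k by blast
      have "\<theta> (I (\<lambda>i. i \<in> K') (\<chi> i. s)) $ i = s" by (simp add: diag[OF s])
      then have "s = (if fl i then cnj s else s) * (if fl k then cnj s else s)\<^sup>2"
        unfolding fl[OF tor] vec_lambda_beta set by simp
      then show ?thesis by (cases "fl i"; cases "fl k") (simp_all add: s_def complex_eq_iff power2_eq_square)
    qed
    obtain i where i: "i \<in> K'" using K'(1) by blast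
    obtain k where k: "k \<in> K'" "i \<in> N k" using K'(2)[OF i] by blast
    obtain l where l: "l \<in> K'" "k \<in> N l" using K'(2)[OF k(1)] by blast
    show False using key[OF i k] key[OF k(1) l] by blast
  qed
  \<comment> \<open>Inverting some parameters permutes the elements of a coordinate subtorus, so
    \<open>fl\<close> disappears from the image.\<close>
  have image: "\<theta> ` {t \<in> torus. \<forall>i. i \<notin> A \<longrightarrow> \<Theta> b t $ i = 1} =
      {t. \<exists>s\<in>torus. (\<forall>i. i \<notin> A \<longrightarrow> s $ i = 1) \<and> t = (\<chi> j. s $ j * (\<Prod>i\<in>{i. b i \<and> j \<in> N i}. (s $ i)\<^sup>2))}" for b A
  proof -
    obtain fl where fl': "\<forall>t\<in>torus. \<theta> (I b t) =
      (\<chi> j. (if fl j then cnj (t $ j) else t $ j) * (\<Prod>i\<in>{i. b i \<and> j \<in> N i}. (if fl i then cnj (t $ i) else t $ i)\<^sup>2))"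
      using \<Phi>[of b] by (rule exE)
    note fl = bspec[OF fl']
    define F where "F t = (\<chi> i. if fl i then cnj (t $ i) else t $ i)" for t :: "'n cspace"
    have F: "F t \<in> torus" if "t \<in> torus" for t using that by (simp add: F_def torus_def)
    have F1: "F t $ i = 1 \<longleftrightarrow> t $ i = 1" for t i using complex_cnj_cancel_iff[of "t $ i" 1] by (simp add: F_def)
    have FF: "F (F t) = t" for t by (simp add: F_def vec_eq_iff)
    have flF: "\<theta> (I b t) = (\<chi> j. F t $ j * (\<Prod>i\<in>{i. b i \<and> j \<in> N i}. (F t $ i)\<^sup>2))" if "t \<in> torus" for t
      unfolding fl[OF that] F_def by simp
    show ?thesis
    proof (intro set_eqI iffI)
      fix y assume "y \<in> \<theta> ` {t \<in> torus. \<forall>i. i \<notin> A \<longrightarrow> \<Theta> b t $ i = 1}"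
      then obtain t where t: "t \<in> torus" "\<And>i. i \<notin> A \<Longrightarrow> \<Theta> b t $ i = 1" "y = \<theta> t" by blast
      have bt: "\<Theta> b t \<in> torus" by (rule torus_automorphism_in[OF auto t(1)])
      have "y = (\<chi> j. F (\<Theta> b t) $ j * (\<Prod>i\<in>{i. b i \<and> j \<in> N i}. (F (\<Theta> b t) $ i)\<^sup>2))"
        using flF[OF bt] I\<Theta>[OF t(1)] t(3) by simp
      then show "y \<in> {t. \<exists>s\<in>torus. (\<forall>i. i \<notin> A \<longrightarrow> s $ i = 1) \<and> t = (\<chi> j. s $ j * (\<Prod>i\<in>{i. b i \<and> j \<in> N i}. (s $ i)\<^sup>2))}"
        using F[OF bt] F1 t(2) by blast
    next
      fix y assume "y \<in> {t. \<exists>s\<in>torus. (\<forall>i. i \<notin> A \<longrightarrow> s $ i = 1) \<and> t = (\<chi> j. s $ j * (\<Prod>i\<in>{i. b i \<and> j \<in> N i}. (s $ i)\<^sup>2))}"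
      then obtain s where s: "s \<in> torus" "\<And>i. i \<notin> A \<Longrightarrow> s $ i = 1"
        "y = (\<chi> j. s $ j * (\<Prod>i\<in>{i. b i \<and> j \<in> N i}. (s $ i)\<^sup>2))" by blast
      have "y = \<theta> (I b (F s))" unfolding flF[OF F[OF s(1)]] FF by (rule s(3))
      moreover have "I b (F s) \<in> {t \<in> torus. \<forall>i. i \<notin> A \<longrightarrow> \<Theta> b t $ i = 1}"
        using It[OF F[OF s(1)]] \<Theta>I[OF F[OF s(1)]] F1 s(2) by simp
      ultimately show "y \<in> \<theta> ` {t \<in> torus. \<forall>i. i \<notin> A \<longrightarrow> \<Theta> b t $ i = 1}" by blast
    qed
  qed
  show thesis
    by (rule that[OF acyclic image[unfolded \<theta>_def]])
qed

section \<open>A section of the orbit projection\<close>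

text \<open>Away from the zeros of the modulus the phase lifts to a real function, which extends by
  Tietze's theorem; continuity at the zeros is automatic.\<close>

lemma extend_with_prescribed_modulus:
  fixes w :: "'a::euclidean_space \<Rightarrow> complex" and \<rho> :: "'a \<Rightarrow> real"
  assumes \<rho>: "continuous_on Q \<rho>" "\<And>y. y \<in> Q \<Longrightarrow> 0 \<le> \<rho> y"
    and D: "closedin (top_of_set Q) D" and w: "continuous_on D w" "\<And>y. y \<in> D \<Longrightarrow> norm (w y) = \<rho> y"
    and contr: "contractible {y \<in> D. \<rho> y \<noteq> 0}"
  obtains w' where "continuous_on Q w'" "\<And>y. y \<in> Q \<Longrightarrow> norm (w' y) = \<rho> y" "\<And>y. y \<in> D \<Longrightarrow> w' y = w y"
proof -
  define D' where "D' = {y \<in> D. \<rho> y \<noteq> 0}"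
  define Q' where "Q' = {y \<in> Q. \<rho> y \<noteq> 0}"
  have DQ: "D \<subseteq> Q" using D closedin_imp_subset by blast
  have cD': "continuous_on D' (\<lambda>y. w y / of_real (\<rho> y))"
    by (intro continuous_intros continuous_on_subset[OF w(1)] continuous_on_subset[OF \<rho>(1)])
      (use DQ in \<open>auto simp: D'_def\<close>)
  have "w y / of_real (\<rho> y) \<noteq> 0" if "y \<in> D'" for y using that w(2)[of y] by (auto simp: D'_def)
  then obtain g where g: "continuous_on D' g" "\<And>y. y \<in> D' \<Longrightarrow> w y / of_real (\<rho> y) = exp (g y)"
    using continuous_logarithm_on_contractible[OF cD' contr[folded D'_def]] by blast
  obtain T where T: "closed T" "D = Q \<inter> T" using D unfolding closedin_closed by blast
  have "D' = Q' \<inter> T" unfolding D'_def Q'_def T(2) by blast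
  \<comment> \<open>Tietze's theorem is applied in \<open>Q'\<close>, where \<open>D'\<close> is
    closed. The extended phase \<open>G\<close> may behave badly near the zeros of
    \<open>\<rho>\<close>; the factor \<open>\<rho>\<close> makes up for it.\<close>
  then have clD': "closedin (top_of_set Q') D'" using T(1) by (simp add: closedin_closed_Int)
  have "continuous_on D' (\<lambda>y. Im (g y))" by (intro continuous_intros g(1))
  then obtain G where G: "continuous_on Q' G" "\<And>y. y \<in> D' \<Longrightarrow> G y = Im (g y)"
    using Tietze_unbounded[OF _ clD'] by blast
  define w' where "w' y = (if \<rho> y = 0 then 0 else of_real (\<rho> y) * cis (G y))" for y
  have nw': "norm (w' y) = \<rho> y" if "y \<in> Q" for y using \<rho>(2)[OF that] by (simp add: w'_def norm_mult)
  show thesis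
  proof (rule that)
    show "norm (w' y) = \<rho> y" if "y \<in> Q" for y by (rule nw'[OF that])
    show "w' y = w y" if y: "y \<in> D" for y
    proof (cases "\<rho> y = 0")
      case True
      then show ?thesis using w(2)[OF y] by (simp add: w'_def)
    next
      case False
      then have yD': "y \<in> D'" using y by (simp add: D'_def)
      have pos: "\<rho> y > 0" using False \<rho>(2)[of y] y DQ by force
      have "norm (exp (g y)) = 1" unfolding g(2)[OF yD', symmetric] norm_divide w(2)[OF y] using pos by simp
      then have "Re (g y) = 0" by simp
      then have "exp (g y) = cis (Im (g y))" by (simp add: exp_eq_polar)
      then have "w y = of_real (\<rho> y) * cis (G y)" using g(2)[OF yD'] False G(2)[OF yD'] by (simp add: field_simps)
      then show ?thesis using False by (simp add: w'_def)
    qed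
    show "continuous_on Q w'"
      unfolding continuous_on_eq_continuous_within
    proof
      fix y assume y: "y \<in> Q"
      show "continuous (at y within Q) w'"
      proof (cases "\<rho> y = 0")
        case True
        have "(\<rho> \<longlongrightarrow> 0) (at y within Q)" using \<rho>(1) y True unfolding continuous_on_def by metis
        moreover have "\<forall>\<^sub>F z in at y within Q. \<rho> z = norm (w' z)"
          unfolding eventually_at_filter using nw' by (intro always_eventually) simp
        ultimately have "((\<lambda>z. norm (w' z)) \<longlongrightarrow> 0) (at y within Q)"
          by (rule Lim_transform_eventually)
        then have "(w' \<longlongrightarrow> 0) (at y within Q)" by (rule tendsto_norm_zero_cancel)
        then show ?thesis unfolding continuous_within using True by (simp add: w'_def)
      next
        case False
        have "continuous_on Q' (\<lambda>z. of_real (\<rho> z) * cis (G z))"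
          by (intro continuous_intros G(1) continuous_on_subset[OF \<rho>(1)]) (auto simp: Q'_def)
        then have cQ': "continuous_on Q' w'"
          by (rule continuous_on_eq) (simp add: w'_def Q'_def)
        have "openin (top_of_set Q) (Q \<inter> \<rho> -` (- {0}))"
          by (rule continuous_openin_preimage_gen[OF \<rho>(1) open_Compl[OF closed_singleton]])
        moreover have "Q \<inter> \<rho> -` (- {0}) = Q'" by (auto simp: Q'_def)
        ultimately obtain W where W: "open W" "Q' = Q \<inter> W" unfolding openin_open by auto
        have yQ': "y \<in> Q'" using y False by (simp add: Q'_def)
        then have "at y within Q' = at y within Q"
          by (intro at_within_nhd[of y W]) (use W in auto)
        then show ?thesis using cQ' yQ' unfolding continuous_on_eq_continuous_within by metis
      qed
    qed
  qed
qed

text \<open>The part of the boundary along which a box meets boxes treated before it;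
  \<open>I\<close> lists the directions in which there are such boxes.\<close>

definition low_faces :: "'n::finite rspace \<Rightarrow> 'n rspace \<Rightarrow> 'n set \<Rightarrow> 'n rspace set" where
  "low_faces a b I = {y \<in> cbox a b. \<exists>i\<in>I. y $ i = a $ i}"

lemma closed_low_faces: "closed (low_faces a b I)"
proof -
  have "low_faces a b I = cbox a b \<inter> (\<Union>i\<in>I. {y. y $ i = a $ i})" by (auto simp: low_faces_def)
  moreover have "closed {y :: 'a rspace. y $ i = a $ i}" for i by (intro closed_Collect_eq continuous_intros)
  ultimately show ?thesis by (auto intro!: closed_Int closed_UN closed_cbox)
qed

definition subbox :: "'n::finite rspace \<Rightarrow> 'n rspace \<Rightarrow> bool" where
  "subbox a b \<longleftrightarrow> (\<forall>i. 0 \<le> a $ i \<and> a $ i < b $ i \<and> b $ i \<le> 1)"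

lemma subbox_subset: "subbox a b \<Longrightarrow> cbox a b \<subseteq> cbox 0 1"
  unfolding subbox_def mem_box_cart subset_iff by (simp, meson order_trans)

text \<open>The set is star-shaped. With \<open>Z\<close> the facets belonging to one chart
  coordinate, this is the domain on which the phase of that coordinate is prescribed.\<close>

lemma contractible_low_faces:
  fixes a b :: "'n::finite rspace"
  assumes box: "subbox a b" and I: "\<And>i. i \<in> I \<Longrightarrow> a $ i > 0"
  shows "contractible {y \<in> low_faces a b I. cube_facets_at y \<inter> Z = {}}"
proof (cases "I = {}")
  case True
  then show ?thesis by (simp add: low_faces_def)
next
  case False
  \<comment> \<open>The star centre: low in the directions \<open>I\<close>, central in the others.
    As \<open>a $ i > 0\<close> on \<open>I\<close>, it lies on no facet of the cube, so a segment
    from \<open>c\<close> can meet a facet in its other endpoint only.\<close>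
  define c where "c = (\<chi> i. if i \<in> I then a $ i else (a $ i + b $ i) / 2)"
  have box': "0 \<le> a $ i" "a $ i < b $ i" "b $ i \<le> 1" for i using box by (auto simp: subbox_def)
  have cb: "c \<in> cbox a b" unfolding mem_box_cart c_def using box' by (auto simp: less_imp_le field_simps)
  have c01: "0 < c $ i \<and> c $ i < 1" for i
    using I[of i] box'[of i] by (auto simp: c_def field_simps)
  have Zc: "cube_facets_at c = {}"
    unfolding cube_facets_at_def of_bool_def using c01 by (auto dest: less_imp_neq split: if_splits) (metis less_irrefl)+
  have cC: "c \<in> cbox 0 1" using cb subbox_subset[OF box] by blast
  have "starlike {y \<in> low_faces a b I. cube_facets_at y \<inter> Z = {}}"
    unfolding starlike_def
  proof (intro bexI[of _ c] ballI subsetI)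
    show "c \<in> {y \<in> low_faces a b I. cube_facets_at y \<inter> Z = {}}"
      using cb Zc False by (auto simp: low_faces_def c_def)
    fix y z assume y: "y \<in> {y \<in> low_faces a b I. cube_facets_at y \<inter> Z = {}}" and z: "z \<in> closed_segment c y"
    obtain u where u: "0 \<le> u" "u \<le> 1" "z = (1 - u) *\<^sub>R c + u *\<^sub>R y" using z by (auto simp: in_segment)
    obtain i where i: "i \<in> I" "y $ i = a $ i" and yb: "y \<in> cbox a b" using y by (auto simp: low_faces_def)
    have zb: "z \<in> cbox a b" unfolding u(3) using convexD_alt[OF convex_box(1) cb yb] u by simp
    have "c $ i = a $ i" using i(1) by (simp add: c_def)
    then have "z $ i = a $ i" unfolding u(3) using i(2) by (simp add: algebra_simps)
    then have zl: "z \<in> low_faces a b I" using zb i(1) by (auto simp: low_faces_def)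
    have yC: "y \<in> cbox 0 1" using yb subbox_subset[OF box] by blast
    have "cube_facets_at z \<inter> Z = {}"
      using cube_facets_at_convex_combination[OF cC yC, of u] u Zc y
      by (cases "u = 0"; cases "u = 1") auto
    then show "z \<in> {y \<in> low_faces a b I. cube_facets_at y \<inter> Z = {}}" using zl by simp
  qed
  then show ?thesis by (rule starlike_imp_contractible)
qed

context torus_manifold_over_cube
begin

section \<open>Extending sections box by box\<close>

definition section_on :: "'n rspace set \<Rightarrow> ('n rspace \<Rightarrow> 'm) \<Rightarrow> bool" where
  "section_on S s \<longleftrightarrow> continuous_map (top_of_set S) X s \<and> (\<forall>y\<in>S. p (s y) = y)"

lemma section_on_in: "section_on S s \<Longrightarrow> y \<in> S \<Longrightarrow> s y \<in> topspace X"
  unfolding section_on_def using continuous_map_image_subset_topspace by fastforce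

lemma section_on_subset: "section_on S s \<Longrightarrow> T \<subseteq> S \<Longrightarrow> section_on T s"
  unfolding section_on_def
  by (metis continuous_map_from_subtopology_mono subsetD)

lemma section_on_paste:
  assumes A: "section_on A s" "closed A" and B: "section_on B s'" "closed B"
    and agree: "\<And>y. y \<in> A \<Longrightarrow> y \<in> B \<Longrightarrow> s y = s' y"
  shows "section_on (A \<union> B) (\<lambda>y. if y \<in> A then s y else s' y)"
  unfolding section_on_def
proof (intro conjI ballI)
  let ?T = "\<lambda>c. if c then A else B" and ?f = "\<lambda>c. if c then s else s'"
  show "continuous_map (top_of_set (A \<union> B)) X (\<lambda>y. if y \<in> A then s y else s' y)"
  proof (rule pasting_lemma_closed[where I = "UNIV :: bool set" and T = ?T and f = ?f])
    fix c :: bool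
    show "closedin (top_of_set (A \<union> B)) (?T c)"
      using A(2) B(2) by (cases c) (auto intro: closed_subset)
    have "A \<inter> (A \<union> B) = A" "B \<inter> (A \<union> B) = B" by auto
    then show "continuous_map (subtopology (top_of_set (A \<union> B)) (?T c)) X (?f c)"
      using A(1) B(1) by (cases c) (simp_all add: subtopology_subtopology section_on_def Int_commute)
  next
    fix i j :: bool and x assume "x \<in> topspace (top_of_set (A \<union> B)) \<inter> ?T i \<inter> ?T j"
    then show "?f i x = ?f j x" using agree[of x] by (cases i; cases j) auto
  next
    fix x assume "x \<in> topspace (top_of_set (A \<union> B))"
    then show "\<exists>j. j \<in> UNIV \<and> x \<in> ?T j \<and> (if x \<in> A then s x else s' x) = ?f j x"
      by (intro exI[of _ "x \<in> A"]) auto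
  qed simp
  fix y assume "y \<in> A \<union> B"
  then show "p (if y \<in> A then s y else s' y) = y" using A(1) B(1) by (auto simp: section_on_def)
qed

text \<open>Prescribing values on an arbitrary union of low faces is what bisection can carry along:
  a cut adds one low face to the upper half. Low faces in the boundary of the cube are left out,
  since no box precedes them.\<close>

definition extension_box :: "'n rspace \<Rightarrow> 'n rspace \<Rightarrow> bool" where
  "extension_box a b \<longleftrightarrow> (\<forall>I s. (\<forall>i\<in>I. a $ i > 0) \<longrightarrow> section_on (low_faces a b I) s \<longrightarrow>
     (\<exists>s'. section_on (cbox a b) s' \<and> (\<forall>y\<in>low_faces a b I. s' y = s y)))"

text \<open>Inside one chart a section is a choice of phases for coordinates whose moduli are given
  functions on the cube, so each coordinate can be extended separately. The modulus with index
  \<open>j\<close> vanishes exactly on the facet matched with \<open>j\<close>, if there is one, so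
  \<open>contractible_low_faces\<close> applies.\<close>

lemma extension_box_local:
  assumes y0: "y0 \<in> cbox 0 1"
  obtains d where "d > 0" "\<And>a b. subbox a b \<Longrightarrow> cbox a b \<subseteq> ball y0 d \<Longrightarrow> extension_box a b"
proof -
  obtain x0 where x0: "x0 \<in> topspace X" "p x0 = y0" using p_surj[OF y0] .
  obtain U \<phi> \<theta> where xU: "x0 \<in> U" and c: "orbit_chart X act p U \<phi> \<theta>" using charts[OF x0(1)] by blast
  obtain r where r: "\<And>x i. x \<in> U \<Longrightarrow> r (p x) i = norm (\<phi> x $ i)"
    and contr: "\<And>i. continuous_on (p ` U) (\<lambda>y. r y i)" using chart_moduli[OF c] by metis
  obtain g where cg: "continuous_map (top_of_set (\<phi> ` U)) X g" and g: "\<And>x. x \<in> U \<Longrightarrow> g (\<phi> x) = x"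
    using chart_inverse[OF c] by metis
  obtain d \<sigma> where d: "d > 0" and inj: "inj_on \<sigma> (cube_facets_at (p x0))"
    and dU: "\<And>x. x \<in> topspace X \<Longrightarrow> dist (p x) (p x0) < d \<Longrightarrow> x \<in> U"
    and dZ: "\<And>x. x \<in> topspace X \<Longrightarrow> dist (p x) (p x0) < d \<Longrightarrow> {i. \<phi> x $ i = 0} = \<sigma> ` cube_facets_at (p x)"
    and dS: "\<And>x. x \<in> topspace X \<Longrightarrow> dist (p x) (p x0) < d \<Longrightarrow> cube_facets_at (p x) \<subseteq> cube_facets_at (p x0)"
    using chart_corner_structure[OF c xU] by metis
  have UX: "U \<subseteq> topspace X" by (rule orbit_chartD(8)[OF c])
  show thesis
  proof (rule that[OF d])
    fix a b :: "'n rspace" assume box: "subbox a b" and small: "cbox a b \<subseteq> ball y0 d"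
    have liftU: "x \<in> U" "{i. \<phi> x $ i = 0} = \<sigma> ` cube_facets_at (p x)" "cube_facets_at (p x) \<subseteq> cube_facets_at y0"
      if "x \<in> topspace X" "p x \<in> cbox a b" for x
    proof -
      have "dist (p x) (p x0) < d" using small that(2) x0(2) by (auto simp: dist_commute)
      then show "x \<in> U" "{i. \<phi> x $ i = 0} = \<sigma> ` cube_facets_at (p x)" "cube_facets_at (p x) \<subseteq> cube_facets_at y0"
        using dU dZ dS that(1) x0(2) by auto
    qed
    have over: "\<exists>x\<in>U. p x = y" if y: "y \<in> cbox a b" for y
    proof -
      have yC: "y \<in> cbox 0 1" using y subbox_subset[OF box] by blast
      obtain x where x: "x \<in> topspace X" "p x = y" using p_surj[OF yC] .
      then show ?thesis using liftU(1)[of x] y by blast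
    qed
    have QW: "cbox a b \<subseteq> p ` U" using over by blast
    have rzero: "r y j \<noteq> 0 \<longleftrightarrow> cube_facets_at y \<inter> {f \<in> cube_facets_at y0. \<sigma> f = j} = {}" if y: "y \<in> cbox a b" for y j
    proof -
      obtain x where x: "x \<in> U" "p x = y" using over[OF y] by blast
      have xX: "x \<in> topspace X" using x UX by blast
      have "r y j = 0 \<longleftrightarrow> j \<in> \<sigma> ` cube_facets_at y" using r[OF x(1), of j] x(2) liftU(2)[OF xX] y by auto
      then show ?thesis using liftU(3)[OF xX] x(2) y by auto
    qed
    show "extension_box a b"
      unfolding extension_box_def
    proof (intro allI impI)
      fix I s assume I: "\<forall>i\<in>I. a $ i > 0" and s: "section_on (low_faces a b I) s"
      let ?D = "low_faces a b I"
      have DQ: "?D \<subseteq> cbox a b" by (auto simp: low_faces_def)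
      have clD: "closedin (top_of_set (cbox a b)) ?D" by (rule closed_subset[OF DQ closed_low_faces])
      have ps: "p (s y) = y" if "y \<in> ?D" for y using s that by (simp add: section_on_def)
      have sU: "s y \<in> U" if y: "y \<in> ?D" for y
        using liftU(1)[OF section_on_in[OF s y]] ps[OF y] DQ y by auto
      have "continuous_map (top_of_set ?D) (subtopology X U) s"
        using s sU by (simp add: continuous_map_in_subtopology section_on_def image_subset_iff Pi_iff)
      moreover have "continuous_map (subtopology X U) (top_of_set (\<phi> ` U)) \<phi>"
        using orbit_chartD(3)[OF c] homeomorphic_imp_continuous_map by blast
      ultimately have "continuous_map (top_of_set ?D) (top_of_set (\<phi> ` U)) (\<phi> \<circ> s)" by (rule continuous_map_compose)
      then have cw: "continuous_on ?D (\<lambda>y. \<phi> (s y))" by (simp add: continuous_map_in_subtopology o_def)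
      have "\<exists>w'. continuous_on (cbox a b) w' \<and> (\<forall>y\<in>cbox a b. norm (w' y) = r y j) \<and> (\<forall>y\<in>?D. w' y = \<phi> (s y) $ j)" for j
      proof -
        have c1: "continuous_on (cbox a b) (\<lambda>y. r y j)" by (rule continuous_on_subset[OF contr QW])
        have c2: "0 \<le> r y j" if "y \<in> cbox a b" for y using over[OF that] r by fastforce
        have c3: "continuous_on ?D (\<lambda>y. \<phi> (s y) $ j)" by (rule continuous_on_component[OF cw])
        have c4: "norm (\<phi> (s y) $ j) = r y j" if "y \<in> ?D" for y using r[OF sU[OF that], of j] ps[OF that] by simp
        have "{y \<in> ?D. r y j \<noteq> 0} = {y \<in> ?D. cube_facets_at y \<inter> {f \<in> cube_facets_at y0. \<sigma> f = j} = {}}"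
          using rzero DQ by blast
        then have c5: "contractible {y \<in> ?D. r y j \<noteq> 0}" using contractible_low_faces[OF box] I by simp
        obtain w' where "continuous_on (cbox a b) w'" "\<And>y. y \<in> cbox a b \<Longrightarrow> norm (w' y) = r y j"
          "\<And>y. y \<in> ?D \<Longrightarrow> w' y = \<phi> (s y) $ j"
          using extend_with_prescribed_modulus[OF c1 c2 clD c3 c4 c5] by metis
        then show ?thesis by blast
      qed
      then obtain w where w: "\<And>j. continuous_on (cbox a b) (w j)" "\<And>j y. y \<in> cbox a b \<Longrightarrow> norm (w j y) = r y j"
        "\<And>j y. y \<in> ?D \<Longrightarrow> w j y = \<phi> (s y) $ j" by metis
      define v where "v y = (\<chi> j. w j y)" for y
      have contv: "continuous_on (cbox a b) v" unfolding v_def by (rule continuous_on_vec_lambda[OF w(1)])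
      have vU: "\<exists>x\<in>U. v y = \<phi> x \<and> p x = y" if y: "y \<in> cbox a b" for y
      proof -
        obtain x where x: "x \<in> U" "p x = y" using over[OF y] by blast
        \<comment> \<open>Vectors with equal moduli differ by a torus element, taken to be 1 where
          they vanish. So \<open>v y\<close> is the chart value of a point in the orbit of
          \<open>x\<close>.\<close>
        define \<tau> where "\<tau> = (\<chi> j. if \<phi> x $ j = 0 then 1 else v y $ j / \<phi> x $ j)"
        have nv: "norm (v y $ j) = norm (\<phi> x $ j)" for j using w(2)[OF y, of j] r[OF x(1), of j] x(2) by (simp add: v_def)
        have "\<tau> \<in> torus" using nv by (simp add: torus_def \<tau>_def norm_divide)
        moreover have "\<theta> ` torus = torus" using orbit_chartD(4)[OF c] unfolding torus_automorphism_def bij_betw_def by blast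
        ultimately obtain t where t: "t \<in> torus" "\<theta> t = \<tau>" by (metis imageE)
        have "v y $ j = \<tau> $ j * \<phi> x $ j" for j using nv[of j] by (cases "\<phi> x $ j = 0") (simp_all add: \<tau>_def)
        then have "v y = \<phi> (act t x)" unfolding orbit_chartD(6)[OF c t(1) x(1)] t(2) by (simp add: vec_eq_iff)
        moreover have "act t x \<in> U" by (rule orbit_chartD(5)[OF c t(1) x(1)])
        moreover have "p (act t x) = y" using p_act[OF t(1)] x UX by blast
        ultimately show ?thesis by blast
      qed
      have "section_on (cbox a b) (\<lambda>y. g (v y))"
        unfolding section_on_def
      proof (intro conjI ballI)
        have "continuous_map (top_of_set (cbox a b)) (top_of_set (\<phi> ` U)) v"
          using contv vU by (auto simp: continuous_map_in_subtopology)
        from continuous_map_compose[OF this cg] show "continuous_map (top_of_set (cbox a b)) X (\<lambda>y. g (v y))"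
          by (simp add: o_def)
        fix y assume "y \<in> cbox a b"
        then show "p (g (v y)) = y" using vU g by fastforce
      qed
      moreover have "g (v y) = s y" if y: "y \<in> ?D" for y
      proof -
        have "v y = \<phi> (s y)" using w(3)[OF y] by (simp add: v_def vec_eq_iff)
        then show ?thesis using g[OF sU[OF y]] by simp
      qed
      ultimately show "\<exists>s'. section_on (cbox a b) s' \<and> (\<forall>y\<in>?D. s' y = s y)" by blast
    qed
  qed
qed

text \<open>Extend over the lower half first. The upper half then starts from the cut, where the new
  section is prescribed, together with the parts of the old low faces above the cut.\<close>

lemma extension_box_bisect:
  assumes box: "subbox a b" and m: "a $ k < m" "m < b $ k"
    and 1: "extension_box a (\<chi> i. if i = k then m else b $ i)"
    and 2: "extension_box (\<chi> i. if i = k then m else a $ i) b"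
  shows "extension_box a b"
  unfolding extension_box_def
proof (intro allI impI)
  fix I s assume I: "\<forall>i\<in>I. a $ i > 0" and s: "section_on (low_faces a b I) s"
  define b1 where "b1 = (\<chi> i. if i = k then m else b $ i)"
  define a2 where "a2 = (\<chi> i. if i = k then m else a $ i)"
  have Q1: "y \<in> cbox a b1 \<longleftrightarrow> y \<in> cbox a b \<and> y $ k \<le> m" for y
  proof -
    have "y $ i \<le> b1 $ i \<longleftrightarrow> y $ i \<le> b $ i \<and> (i = k \<longrightarrow> y $ k \<le> m)" for i
      using m by (auto simp: b1_def)
    then show ?thesis unfolding mem_box_cart by blast
  qed
  have Q2: "y \<in> cbox a2 b \<longleftrightarrow> y \<in> cbox a b \<and> m \<le> y $ k" for y
  proof -
    have "a2 $ i \<le> y $ i \<longleftrightarrow> a $ i \<le> y $ i \<and> (i = k \<longrightarrow> m \<le> y $ k)" for i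
      using m by (auto simp: a2_def)
    then show ?thesis unfolding mem_box_cart by blast
  qed
  have "low_faces a b1 I \<subseteq> low_faces a b I" using Q1 by (auto simp: low_faces_def)
  then have "section_on (low_faces a b1 I) s" by (rule section_on_subset[OF s])
  then have "\<exists>s1. section_on (cbox a b1) s1 \<and> (\<forall>y\<in>low_faces a b1 I. s1 y = s y)"
    using 1[folded b1_def, unfolded extension_box_def] I by simp
  then obtain s1 where s1: "section_on (cbox a b1) s1" "\<And>y. y \<in> low_faces a b1 I \<Longrightarrow> s1 y = s y" by blast
  define A where "A = {y \<in> cbox a b. y $ k = m}"
  \<comment> \<open>The low face in direction \<open>k\<close> lies below the cut, hence
    \<open>I - {k}\<close>.\<close>
  define B where "B = low_faces a b (I - {k}) \<inter> {y. m \<le> y $ k}"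
  have "closed {y :: 'n rspace. y $ k = m}" "closed {y :: 'n rspace. m \<le> y $ k}"
    by (intro closed_Collect_eq closed_Collect_le continuous_intros)+
  moreover have "A = cbox a b \<inter> {y. y $ k = m}" by (auto simp: A_def)
  ultimately have clA: "closed A" and clB: "closed B"
    unfolding B_def using closed_low_faces by (auto intro: closed_Int)
  have AB: "low_faces a2 b (insert k I) = A \<union> B"
  proof (intro set_eqI iffI)
    fix y assume "y \<in> low_faces a2 b (insert k I)"
    then obtain i where "y \<in> cbox a b" "m \<le> y $ k" "i \<in> insert k I" "y $ i = a2 $ i" unfolding low_faces_def Q2 by blast
    then show "y \<in> A \<union> B" by (cases "i = k") (auto simp: A_def B_def low_faces_def a2_def)
  next
    fix y assume "y \<in> A \<union> B"
    then have "y \<in> cbox a2 b" "\<exists>i\<in>insert k I. y $ i = a2 $ i"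
      unfolding Q2 by (auto simp: A_def B_def low_faces_def a2_def)
    then show "y \<in> low_faces a2 b (insert k I)" by (simp add: low_faces_def)
  qed
  have A1: "section_on A s1" by (rule section_on_subset[OF s1(1)]) (auto simp: A_def Q1)
  have B1: "section_on B s" by (rule section_on_subset[OF s]) (auto simp: B_def low_faces_def)
  have "s1 y = s y" if "y \<in> A" "y \<in> B" for y
    using that by (intro s1(2)) (auto simp: A_def B_def low_faces_def Q1)
  from section_on_paste[OF A1 clA B1 clB this]
  have "section_on (low_faces a2 b (insert k I)) (\<lambda>y. if y \<in> A then s1 y else s y)" unfolding AB .
  moreover have "0 < m" using m(1) box by (auto simp: subbox_def intro: le_less_trans)
  then have "\<forall>i\<in>insert k I. a2 $ i > 0" using I by (simp add: a2_def)
  ultimately have "\<exists>s2. section_on (cbox a2 b) s2 \<and>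
      (\<forall>y\<in>low_faces a2 b (insert k I). s2 y = (if y \<in> A then s1 y else s y))"
    using 2[folded a2_def, unfolded extension_box_def, rule_format, of "insert k I"] by blast
  then obtain s2 where s2: "section_on (cbox a2 b) s2" "\<And>y. y \<in> A \<union> B \<Longrightarrow> s2 y = (if y \<in> A then s1 y else s y)"
    unfolding AB by blast
  have agree: "s1 y = s2 y" if "y \<in> cbox a b1" "y \<in> cbox a2 b" for y
  proof -
    have "y \<in> A" using that unfolding Q1 Q2 by (simp add: A_def)
    then show ?thesis using s2(2) by simp
  qed
  have Q: "cbox a b1 \<union> cbox a2 b = cbox a b" using Q1 Q2 by (auto simp: linear)
  have "section_on (cbox a b) (\<lambda>y. if y \<in> cbox a b1 then s1 y else s2 y)"
    using section_on_paste[OF s1(1) closed_cbox s2(1) closed_cbox agree] unfolding Q .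
  moreover have "(if y \<in> cbox a b1 then s1 y else s2 y) = s y" if y: "y \<in> low_faces a b I" for y
  proof (cases "y \<in> cbox a b1")
    case True
    then show ?thesis using s1(2)[of y] y by (auto simp: low_faces_def)
  next
    case False
    have "y \<in> cbox a b" using y by (simp add: low_faces_def)
    then have "m < y $ k" using False Q1 by auto
    moreover from this have "y \<in> B" using y m by (auto simp: B_def low_faces_def)
    ultimately show ?thesis using False s2(2)[of y] by (auto simp: A_def)
  qed
  ultimately show "\<exists>s'. section_on (cbox a b) s' \<and> (\<forall>y\<in>low_faces a b I. s' y = s y)" by blast
qed

text \<open>Bisect one direction at a time; \<open>K\<close> holds the directions in which the side
  may still have length \<open>2 * \<eta>\<close>.\<close>

lemma extension_box_double:
  assumes small: "\<And>a b. subbox a b \<Longrightarrow> \<forall>i. b $ i - a $ i \<le> \<eta> \<Longrightarrow> extension_box a b"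
    and box: "subbox a b" and side: "\<forall>i. b $ i - a $ i \<le> 2 * \<eta>"
  shows "extension_box a b"
proof -
  have "extension_box a b" if "finite K" "subbox a b" "\<forall>i. b $ i - a $ i \<le> (if i \<in> K then 2 * \<eta> else \<eta>)" for K a b
    using that
  proof (induction K arbitrary: a b rule: finite_induct)
    case empty
    then show ?case using small by simp
  next
    case (insert k K)
    define m where "m = (a $ k + b $ k) / 2"
    have box: "0 \<le> a $ i" "a $ i < b $ i" "b $ i \<le> 1" for i using insert.prems(1) by (auto simp: subbox_def)
    have m: "a $ k < m" "m < b $ k" using box[of k] by (auto simp: m_def)
    have side: "b $ i - a $ i \<le> (if i \<in> insert k K then 2 * \<eta> else \<eta>)" for i using insert.prems(2) by blast
    have mk: "m - a $ k \<le> \<eta>" "b $ k - m \<le> \<eta>" using side[of k] by (auto simp: m_def field_simps)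
    show ?case
    proof (rule extension_box_bisect[OF insert.prems(1) m]; rule insert.IH)
      show "subbox a (\<chi> i. if i = k then m else b $ i)" "subbox (\<chi> i. if i = k then m else a $ i) b"
      proof -
        have "0 \<le> a $ i \<and> a $ i < (if i = k then m else b $ i) \<and> (if i = k then m else b $ i) \<le> 1"
          "0 \<le> (if i = k then m else a $ i) \<and> (if i = k then m else a $ i) < b $ i \<and> b $ i \<le> 1" for i
          using box[of i] box[of k] m by (cases "i = k"; simp)+
        then show "subbox a (\<chi> i. if i = k then m else b $ i)" "subbox (\<chi> i. if i = k then m else a $ i) b"
          unfolding subbox_def by simp_all
      qed
      show "\<forall>i. (\<chi> i. if i = k then m else b $ i) $ i - a $ i \<le> (if i \<in> K then 2 * \<eta> else \<eta>)"
      proof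
        fix i show "(\<chi> i. if i = k then m else b $ i) $ i - a $ i \<le> (if i \<in> K then 2 * \<eta> else \<eta>)"
          using side[of i] mk insert.hyps(2) by (cases "i = k") simp_all
      qed
      show "\<forall>i. b $ i - (\<chi> i. if i = k then m else a $ i) $ i \<le> (if i \<in> K then 2 * \<eta> else \<eta>)"
      proof
        fix i show "b $ i - (\<chi> i. if i = k then m else a $ i) $ i \<le> (if i \<in> K then 2 * \<eta> else \<eta>)"
          using side[of i] mk insert.hyps(2) by (cases "i = k") simp_all
      qed
    qed
  qed
  from this[of UNIV] show ?thesis using box side by simp
qed

lemma section_exists:
  obtains s where "continuous_map (top_of_set (cbox 0 1)) X s" "\<And>y. y \<in> cbox 0 1 \<Longrightarrow> p (s y) = y"
proof -
  have "\<forall>y\<in>cbox 0 1. \<exists>d>0. \<forall>a b. subbox a b \<longrightarrow> cbox a b \<subseteq> ball y d \<longrightarrow> extension_box a b"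
    using extension_box_local by metis
  then obtain d where d: "\<And>y. y \<in> cbox 0 1 \<Longrightarrow> d y > 0"
    "\<And>y a b. y \<in> cbox 0 1 \<Longrightarrow> subbox a b \<Longrightarrow> cbox a b \<subseteq> ball y (d y) \<Longrightarrow> extension_box a b" by metis
  have cover: "cbox 0 1 \<subseteq> \<Union>((\<lambda>y. ball y (d y)) ` cbox 0 (1 :: 'n rspace))"
  proof
    fix y :: "'n rspace" assume y: "y \<in> cbox 0 1"
    then have "y \<in> ball y (d y)" using d(1) by simp
    then show "y \<in> \<Union>((\<lambda>y. ball y (d y)) ` cbox 0 1)" using y by blast
  qed
  obtain e where e': "e > 0" "\<And>x. x \<in> cbox 0 1 \<Longrightarrow> \<exists>G\<in>(\<lambda>y. ball y (d y)) ` cbox 0 (1 :: 'n rspace). ball x e \<subseteq> G"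
    by (rule Heine_Borel_lemma[OF compact_cbox cover]) auto
  then have e: "e > 0" "\<And>x. x \<in> cbox 0 1 \<Longrightarrow> \<exists>y\<in>cbox 0 1. ball x e \<subseteq> ball y (d y)" by auto
  \<comment> \<open>\<open>e\<close> is a Lebesgue number of the cover. A box with sides at most
    \<open>\<eta>\<close> has points within \<open>e / 2\<close> of its lowest corner, by comparison
    with the sum norm.\<close>
  define \<eta> where "\<eta> = e / (2 * real CARD('n))"
  have \<eta>: "\<eta> > 0" using e(1) by (simp add: \<eta>_def)
  have base: "extension_box a b" if box: "subbox a b" and side: "\<forall>i. b $ i - a $ i \<le> \<eta>" for a b
  proof -
    have ab: "a \<in> cbox a b" using box by (auto simp: subbox_def mem_box_cart less_imp_le)
    then have "a \<in> cbox 0 1" using subbox_subset[OF box] by blast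
    then obtain y where y: "y \<in> cbox 0 1" "ball a e \<subseteq> ball y (d y)" using e(2) by blast
    have "cbox a b \<subseteq> ball a e"
    proof
      fix z assume z: "z \<in> cbox a b"
      have "norm (z - a) \<le> (\<Sum>i\<in>UNIV. \<bar>(z - a) $ i\<bar>)" by (rule norm_le_l1_cart)
      also have "\<dots> \<le> (\<Sum>i\<in>(UNIV :: 'n set). \<eta>)"
      proof (rule sum_mono)
        fix i :: 'n
        have "a $ i \<le> z $ i" "z $ i \<le> b $ i" using z by (auto simp: mem_box_cart)
        then show "\<bar>(z - a) $ i\<bar> \<le> \<eta>" using side[rule_format, of i] by simp
      qed
      also have "\<dots> = e / 2" by (simp add: \<eta>_def)
      finally show "z \<in> ball a e" using e(1) by (simp add: dist_norm norm_minus_commute)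
    qed
    then show ?thesis using d(2)[OF y(1) box] y(2) by blast
  qed
  have all: "extension_box a b" if "subbox a b" "\<forall>i. b $ i - a $ i \<le> 2 ^ n * \<eta>" for n a b
    using that
  proof (induction n arbitrary: a b)
    case 0
    then show ?case using base by simp
  next
    case (Suc n)
    show ?case
      by (rule extension_box_double[of "2 ^ n * \<eta>"]) (use Suc in \<open>auto simp: mult.assoc\<close>)
  qed
  obtain n where "1 / \<eta> < 2 ^ n" using real_arch_pow[of 2 "1 / \<eta>"] by auto
  then have "1 \<le> 2 ^ n * \<eta>" using \<eta> by (simp add: field_simps)
  \<comment> \<open>The whole cube is used with \<open>I\<close> empty, so nothing is prescribed in
    advance.\<close>
  then have "extension_box 0 1" by (intro all) (auto simp: subbox_def)
  moreover have "section_on (low_faces 0 1 {}) (\<lambda>_. undefined)"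
    by (simp add: section_on_def low_faces_def)
  ultimately obtain s where "section_on (cbox 0 1) s" unfolding extension_box_def by blast
  then show thesis using that unfolding section_on_def by blast
qed

end

section \<open>Bott towers\<close>

lemma bott_mult_one: "bott_mult a 1 q = q"
  by (cases q) (simp add: bott_mult_def vec_eq_iff)

lemma bott_mult_mult: "bott_mult a (s * t) q = bott_mult a s (bott_mult a t q)"
  by (cases q) (simp add: bott_mult_def vec_eq_iff power_int_mult_distrib prod.distrib mult_ac)

lemma norm_bott_mult:
  assumes "t \<in> torus" shows "norm (fst (bott_mult a t q) $ j) = norm (fst q $ j)" "norm (snd (bott_mult a t q) $ j) = norm (snd q $ j)"
  using assms by (cases q; simp add: bott_mult_def torus_def norm_mult norm_power_int flip: prod_norm)+

lemma bott_mult_spheres: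
  assumes "t \<in> torus" "q \<in> spheres" shows "bott_mult a t q \<in> spheres"
  using assms(2) norm_bott_mult[OF assms(1), of a q] unfolding spheres_def
  by (cases q; cases "bott_mult a t q") simp

lemma bott_orbit_eqI:
  assumes t: "t \<in> torus" shows "bott_orbit a (bott_mult a t q) = bott_orbit a q"
proof
  show "bott_orbit a (bott_mult a t q) \<subseteq> bott_orbit a q"
    unfolding bott_orbit_def using torus_mult[OF _ t] by (auto simp flip: bott_mult_mult)
  show "bott_orbit a q \<subseteq> bott_orbit a (bott_mult a t q)"
  proof
    fix r assume "r \<in> bott_orbit a q"
    then obtain s where s: "s \<in> torus" "r = bott_mult a s q" unfolding bott_orbit_def by blast
    have "bott_mult a (s * torus_cnj t) (bott_mult a t q) = bott_mult a (s * (torus_cnj t * t)) q"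
      by (simp only: mult.assoc flip: bott_mult_mult)
    also have "\<dots> = r" using torus_cnj(2)[OF t] s(2) by (simp add: mult.commute)
    finally show "r \<in> bott_orbit a (bott_mult a t q)"
      unfolding bott_orbit_def using torus_mult[OF s(1) torus_cnj(1)[OF t]] by (metis imageI)
  qed
qed

lemma bott_orbit_eq_iff: "bott_orbit a q = bott_orbit a r \<longleftrightarrow> (\<exists>t\<in>torus. bott_mult a t q = r)"
proof
  assume "bott_orbit a q = bott_orbit a r"
  moreover have "r \<in> bott_orbit a r" unfolding bott_orbit_def using torus_one bott_mult_one by (metis imageI)
  ultimately have "r \<in> bott_orbit a q" by simp
  then show "\<exists>t\<in>torus. bott_mult a t q = r" unfolding bott_orbit_def by blast
qed (use bott_orbit_eqI in metis)

lemma continuous_bott_mult: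
  "continuous_on (torus \<times> S) (\<lambda>(t, q). bott_mult a t q)"
proof -
  have nz: "fst x $ i \<noteq> 0" if "x \<in> torus \<times> S" for x :: "'a cspace \<times> 'a cspace \<times> 'a cspace" and i
  proof
    assume "fst x $ i = 0"
    moreover have "norm (fst x $ i) = 1" using that by (auto simp: torus_def)
    ultimately show False by simp
  qed
  have "continuous_on (torus \<times> S) (\<lambda>x. (\<Prod>i\<in>{..<j}. fst x $ i powi (- a i j)) * fst x $ j * fst (snd x) $ j)" for j
    using nz by (intro continuous_intros) auto
  moreover have "continuous_on (torus \<times> S) (\<lambda>x. fst x $ j * snd (snd x) $ j)" for j
    by (intro continuous_intros)
  ultimately have "continuous_on (torus \<times> S) (\<lambda>x.
      ((\<chi> j. (\<Prod>i\<in>{..<j}. fst x $ i powi (- a i j)) * fst x $ j * fst (snd x) $ j), (\<chi> j. fst x $ j * snd (snd x) $ j)))"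
    by (intro continuous_on_Pair continuous_on_vec_lambda)
  moreover have "bott_mult a (fst x) (snd x) = ((\<chi> j. (\<Prod>i\<in>{..<j}. fst x $ i powi (- a i j)) * fst x $ j * fst (snd x) $ j), (\<chi> j. fst x $ j * snd (snd x) $ j))"
    for x :: "'a cspace \<times> 'a cspace \<times> 'a cspace"
    by (simp add: bott_mult_def vec_eq_iff case_prod_beta)
  ultimately show ?thesis by (simp add: case_prod_beta)
qed

text \<open>The orbits through a compact set fill the image of \<open>torus \<times> C\<close>,
  which is compact. This later makes the map \<open>qB\<close> onto the tower closed, and hence a
  quotient map.\<close>

lemma closedin_bott_orbit_image:
  assumes C: "compact C" "C \<subseteq> spheres"
  shows "closedin (bott_tower a) (bott_orbit a ` C)"
proof -
  have "{q \<in> spheres. bott_orbit a q \<in> bott_orbit a ` C} = (\<lambda>(t, q). bott_mult a t q) ` (torus \<times> C)"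
  proof (intro set_eqI iffI)
    fix q assume "q \<in> {q \<in> spheres. bott_orbit a q \<in> bott_orbit a ` C}"
    then obtain c where c: "c \<in> C" "bott_orbit a c = bott_orbit a q" by auto
    then obtain t where "t \<in> torus" "bott_mult a t c = q" using bott_orbit_eq_iff by blast
    then show "q \<in> (\<lambda>(t, q). bott_mult a t q) ` (torus \<times> C)" using c(1) by force
  next
    fix q assume "q \<in> (\<lambda>(t, q). bott_mult a t q) ` (torus \<times> C)"
    then obtain t c where tc: "t \<in> torus" "c \<in> C" "q = bott_mult a t c" by auto
    then have "c \<in> spheres" using C(2) by blast
    then have "bott_mult a t c \<in> spheres" by (rule bott_mult_spheres[OF tc(1)])
    then show "q \<in> {q \<in> spheres. bott_orbit a q \<in> bott_orbit a ` C}"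
      unfolding tc(3) using tc(2) bott_orbit_eqI[OF tc(1), of a c] by simp
  qed
  moreover have "compact ((\<lambda>(t, q). bott_mult a t q) ` (torus \<times> C))"
    by (rule compact_continuous_image[OF continuous_bott_mult compact_Times[OF compact_torus C(1)]])
  ultimately have "closedin (top_of_set spheres) {q \<in> spheres. bott_orbit a q \<in> bott_orbit a ` C}"
    by (metis (no_types, lifting) closed_subset compact_imp_closed mem_Collect_eq subsetI)
  moreover have "bott_orbit a ` C \<subseteq> topspace (bott_tower a)" unfolding topspace_bott_tower using C(2) by blast
  ultimately show ?thesis using quotient_map_bott_orbit[of a] unfolding quotient_map_closedin by simp
qed

section \<open>Permuting the coordinates of the cube\<close>

lemma cube_permutation:
  fixes \<tau> :: "'n::finite \<Rightarrow> 'n"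
  assumes \<tau>: "bij \<tau>"
  defines "L \<equiv> \<lambda>y :: 'n rspace. \<chi> i. y $ \<tau> i"
  shows "linear L" "bij L" "L ` cbox 0 1 = cbox 0 1"
proof -
  show "linear L" unfolding L_def by (rule linearI) (simp_all add: vec_eq_iff)
  have inv: "L (\<chi> i. y $ inv \<tau> i) = y" "(\<chi> i. L y $ inv \<tau> i) = y" for y
    using \<tau> by (simp_all add: L_def vec_eq_iff bij_is_surj bij_is_inj surj_f_inv_f inv_f_f)
  show "bij L" by (rule bij_betw_byWitness[where f' = "\<lambda>y. \<chi> i. y $ inv \<tau> i"]) (use inv in auto)
  show "L ` cbox 0 1 = cbox 0 1"
  proof
    show "L ` cbox 0 1 \<subseteq> cbox 0 1" by (auto simp: L_def mem_cube)
    show "cbox 0 1 \<subseteq> L ` cbox 0 1"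
    proof
      fix y :: "'n rspace" assume "y \<in> cbox 0 1"
      then have "(\<chi> i. y $ inv \<tau> i) \<in> cbox 0 1" by (simp add: mem_cube)
      then show "y \<in> L ` cbox 0 1" using inv(1)[of y] by (metis imageI)
    qed
  qed
qed

text \<open>Sorting the indices renames the coordinates of the cube, and the identification of the
  cube with \<open>P\<close> has to follow.\<close>

lemma face_homeomorphism_permute:
  fixes \<tau> :: "'n::finite \<Rightarrow> 'n" and h :: "'n rspace \<Rightarrow> 'p::euclidean_space"
  assumes h: "face_homeomorphism (cbox 0 1) P h" and \<tau>: "bij \<tau>"
  shows "face_homeomorphism (cbox 0 1) P (\<lambda>y. h (\<chi> i. y $ \<tau> i))"
proof -
  define L where "L = (\<lambda>y :: 'n rspace. \<chi> i. y $ \<tau> i)"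
  have L: "linear L" "bij L" "L ` cbox 0 1 = cbox 0 1" unfolding L_def by (rule cube_permutation[OF \<tau>])+
  have injL: "inj L" by (rule bij_is_inj[OF L(2)])
  obtain k where k: "homeomorphism (cbox 0 1) P h k" using h unfolding face_homeomorphism_def by blast
  have faces: "F face_of cbox 0 1 \<longleftrightarrow> h ` F face_of P" if "F \<subseteq> cbox 0 1" for F
    using h that unfolding face_homeomorphism_def by blast
  obtain l where "homeomorphism (cbox 0 1) (cbox 0 1) L l"
    using homeomorphism_compact[OF compact_cbox linear_continuous_on L(3) inj_on_subset[OF injL subset_UNIV]]
      linear_conv_bounded_linear L(1) by blast
  then have "homeomorphism (cbox 0 1) P (h \<circ> L) (l \<circ> k)" using k by (rule homeomorphism_compose)
  moreover have "F face_of cbox 0 1 \<longleftrightarrow> (h \<circ> L) ` F face_of P" if F: "F \<subseteq> cbox 0 1" for F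
  proof -
    have "F face_of cbox 0 1 \<longleftrightarrow> L ` F face_of cbox 0 1"
      using face_of_linear_image[OF L(1) injL, of F "cbox 0 1"] unfolding L(3) by simp
    also have "\<dots> \<longleftrightarrow> h ` (L ` F) face_of P" by (rule faces) (use F L(3) in blast)
    finally show ?thesis by (simp add: image_comp)
  qed
  ultimately have "face_homeomorphism (cbox 0 1) P (h \<circ> L)" unfolding face_homeomorphism_def by blast
  then show ?thesis by (simp add: L_def o_def)
qed

text \<open>The left side describes a stabilizer in \<open>M\<close> over \<open>y\<close>, the right side the one in the Bott tower,
  before the indices are sorted.\<close>

lemma bott_stabilizer_iff:
  fixes N :: "'n::finite \<Rightarrow> 'n set" and y :: "'n rspace"
  assumes \<tau>: "\<tau> \<in> torus"
  shows "(\<exists>s\<in>torus. (\<forall>i. i \<notin> {i. y $ i = 0 \<or> y $ i = 1} \<longrightarrow> s $ i = 1) \<and>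
        \<tau> = (\<chi> j. s $ j * (\<Prod>i\<in>{i. y $ i = 1 \<and> j \<in> N i}. (s $ i)\<^sup>2))) \<longleftrightarrow>
      (\<exists>v\<in>torus. \<forall>j. (y $ j \<noteq> 0 \<longrightarrow> \<tau> $ j = v $ j * (\<Prod>i\<in>{i. j \<in> N i}. (v $ i)\<^sup>2)) \<and> (y $ j \<noteq> 1 \<longrightarrow> v $ j = 1))"
    (is "?L \<longleftrightarrow> ?R")
proof
  assume ?L
  then obtain s where s: "s \<in> torus" "\<And>i. y $ i \<noteq> 0 \<Longrightarrow> y $ i \<noteq> 1 \<Longrightarrow> s $ i = 1"
    "\<And>j. \<tau> $ j = s $ j * (\<Prod>i\<in>{i. y $ i = 1 \<and> j \<in> N i}. (s $ i)\<^sup>2)" by auto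
  \<comment> \<open>In the tower \<open>v\<close> has to fix the coordinates of the second half,
    which are nonzero unless \<open>y $ j = 1\<close>. So only the entries of \<open>s\<close> at
    facets of that side are kept.\<close>
  define v where "v = (\<chi> j. if y $ j = 1 then s $ j else 1)"
  have "(\<Prod>i\<in>{i. j \<in> N i}. (v $ i)\<^sup>2) = (\<Prod>i\<in>{i. y $ i = 1 \<and> j \<in> N i}. (s $ i)\<^sup>2)" for j
    by (rule prod.mono_neutral_cong_right) (auto simp: v_def)
  moreover have "v $ j = s $ j" if "y $ j \<noteq> 0" for j using s(2)[OF that] by (simp add: v_def)
  ultimately have "\<forall>j. (y $ j \<noteq> 0 \<longrightarrow> \<tau> $ j = v $ j * (\<Prod>i\<in>{i. j \<in> N i}. (v $ i)\<^sup>2)) \<and> (y $ j \<noteq> 1 \<longrightarrow> v $ j = 1)"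
    using s(3) by (simp add: v_def)
  moreover have "v \<in> torus" using s(1) by (simp add: v_def torus_def)
  ultimately show ?R by blast
next
  assume ?R
  then obtain v where v: "v \<in> torus" "\<And>j. y $ j \<noteq> 0 \<Longrightarrow> \<tau> $ j = v $ j * (\<Prod>i\<in>{i. j \<in> N i}. (v $ i)\<^sup>2)"
    "\<And>j. y $ j \<noteq> 1 \<Longrightarrow> v $ j = 1" by blast
  define R where "R j = (\<Prod>i\<in>{i. y $ i = 1 \<and> j \<in> N i}. (v $ i)\<^sup>2)" for j
  have nR: "norm (R j) = 1" for j using v(1) by (simp add: R_def torus_def norm_power flip: prod_norm)
  have R: "(\<Prod>i\<in>{i. j \<in> N i}. (v $ i)\<^sup>2) = R j" for j
    unfolding R_def by (rule prod.mono_neutral_right) (auto, metis v(3) one_power2)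
  \<comment> \<open>Where \<open>y $ j = 0\<close>, the entry of \<open>\<tau>\<close> is not
    constrained by \<open>v\<close>; the free entry of \<open>s\<close> absorbs it.\<close>
  define s where "s = (\<chi> j. if y $ j = 0 then \<tau> $ j / R j else v $ j)"
  have "s \<in> torus" using v(1) \<tau> nR by (simp add: s_def torus_def norm_divide)
  moreover have "\<forall>i. i \<notin> {i. y $ i = 0 \<or> y $ i = 1} \<longrightarrow> s $ i = 1" using v(3) by (simp add: s_def)
  moreover have "\<tau> $ j = s $ j * (\<Prod>i\<in>{i. y $ i = 1 \<and> j \<in> N i}. (s $ i)\<^sup>2)" for j
  proof -
    have "(\<Prod>i\<in>{i. y $ i = 1 \<and> j \<in> N i}. (s $ i)\<^sup>2) = R j" unfolding R_def by (rule prod.cong) (auto simp: s_def)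
    moreover have "R j \<noteq> 0" using nR[of j] by auto
    ultimately show ?thesis using v(2)[of j] R by (simp add: s_def)
  qed
  then have "\<tau> = (\<chi> j. s $ j * (\<Prod>i\<in>{i. y $ i = 1 \<and> j \<in> N i}. (s $ i)\<^sup>2))" by (simp add: vec_eq_iff)
  ultimately show ?L by blast
qed

text \<open>The integer -2 becomes the exponent 2 under the sign in \<open>bott_mult\<close>. By the
  choice of \<open>\<rho>\<close> all predecessors of \<open>j\<close> are sent below
  \<open>\<rho> j\<close>, so the product over \<open>{..<\<rho> j}\<close> reaches each of
  them.\<close>

lemma bott_product_sorted:
  fixes N :: "'n::{finite,linorder} \<Rightarrow> 'n set"
  assumes \<rho>: "bij \<rho>" "\<And>i j. i \<in> N j \<Longrightarrow> \<rho> j < \<rho> i"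
  shows "(\<Prod>k\<in>{..<\<rho> j}. v $ k powi (- (if inv \<rho> (\<rho> j) \<in> N (inv \<rho> k) then - 2 else 0 :: int)))
    = (\<Prod>i\<in>{i. j \<in> N i}. (v $ \<rho> i :: complex)\<^sup>2)"
proof -
  have inv: "inv \<rho> (\<rho> i) = i" for i using \<rho>(1) by (simp add: bij_is_inj inv_f_f)
  have sub: "\<rho> ` {i. j \<in> N i} \<subseteq> {..<\<rho> j}" using \<rho>(2) by auto
  have "(\<Prod>i\<in>{i. j \<in> N i}. (v $ \<rho> i)\<^sup>2) = (\<Prod>k\<in>\<rho> ` {i. j \<in> N i}. (v $ k)\<^sup>2)"
    using inj_on_subset[OF bij_is_inj[OF \<rho>(1)] subset_UNIV] by (subst prod.reindex) auto
  also have "\<dots> = (\<Prod>k\<in>{..<\<rho> j}. v $ k powi (- (if inv \<rho> (\<rho> j) \<in> N (inv \<rho> k) then - 2 else 0 :: int)))"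
  proof (rule prod.mono_neutral_cong_left)
    show "\<forall>k\<in>{..<\<rho> j} - \<rho> ` {i. j \<in> N i}. v $ k powi (- (if inv \<rho> (\<rho> j) \<in> N (inv \<rho> k) then - 2 else 0 :: int)) = 1"
    proof
      fix k assume "k \<in> {..<\<rho> j} - \<rho> ` {i. j \<in> N i}"
      moreover have "\<rho> (inv \<rho> k) = k" using \<rho>(1) by (simp add: bij_is_surj surj_f_inv_f)
      ultimately have "j \<notin> N (inv \<rho> k)" by (metis DiffD2 imageI mem_Collect_eq)
      then show "v $ k powi (- (if inv \<rho> (\<rho> j) \<in> N (inv \<rho> k) then - 2 else 0 :: int)) = 1" by (simp add: inv)
    qed
  qed (use sub in \<open>auto simp: inv\<close>)
  finally show ?thesis ..
qed

text \<open>Every orbit has a representative whose second half is real and nonnegative: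
  \<open>u\<close> removes the phases of \<open>w\<close>. What remains is a torus element together
  with the moduli, which form a point of the cube.\<close>

lemma spheres_parametrization:
  fixes z w :: "'n::{finite,linorder} cspace"
  assumes zw: "(z, w) \<in> spheres"
  obtains \<tau> y where "\<tau> \<in> torus" "y \<in> cbox 0 1"
    "bott_orbit a (z, w) = bott_orbit a (\<tau> * (\<chi> k. of_real (sqrt (y $ k))), (\<chi> k. of_real (sqrt (1 - y $ k))))"
proof -
  define u where "u = (\<chi> k. if w $ k = 0 then 1 else cnj (w $ k) / of_real (norm (w $ k)))"
  have u: "u \<in> torus" by (simp add: u_def torus_def norm_divide)
  define z' where "z' = fst (bott_mult a u (z, w))"
  have uw: "u * w = (\<chi> k. of_real (norm (w $ k)))"
  proof -
    have "u $ k * w $ k = of_real (norm (w $ k))" for k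
    proof (cases "w $ k = 0")
      case False
      have "cnj (w $ k) * w $ k = (of_real (norm (w $ k)))\<^sup>2"
        using complex_norm_square[of "w $ k"] by (simp add: mult.commute)
      then show ?thesis using False by (simp add: u_def field_simps power2_eq_square)
    qed simp
    then show ?thesis by (simp add: vec_eq_iff)
  qed
  have bu: "bott_mult a u (z, w) = (z', \<chi> k. of_real (norm (w $ k)))"
    by (simp add: z'_def bott_mult_def uw)
  have nz': "norm (z' $ k) = norm (z $ k)" for k using norm_bott_mult(1)[OF u, of a "(z, w)" k] by (simp add: z'_def)
  define y where "y = (\<chi> k. (norm (z $ k))\<^sup>2)"
  have sum1: "(norm (z $ k))\<^sup>2 + (norm (w $ k))\<^sup>2 = 1" for k using zw by (simp add: spheres_def)
  have y01: "y \<in> cbox 0 1" unfolding mem_cube y_def using sum1 by (simp, metis le_add_same_cancel1 zero_le_power2)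
  define \<tau> where "\<tau> = (\<chi> k. if z $ k = 0 then 1 else z' $ k / of_real (norm (z $ k)))"
  have \<tau>: "\<tau> \<in> torus" using nz' by (simp add: \<tau>_def torus_def norm_divide)
  have "1 - (norm (z $ k))\<^sup>2 = (norm (w $ k))\<^sup>2" for k using sum1[of k] by simp
  then have w': "(\<chi> k. of_real (sqrt (1 - y $ k))) = (\<chi> k. complex_of_real (norm (w $ k)))" by (simp add: y_def vec_eq_iff)
  have "\<tau> $ k * of_real (norm (z $ k)) = z' $ k" for k using nz'[of k] by (auto simp: \<tau>_def)
  then have z'': "\<tau> * (\<chi> k. of_real (sqrt (y $ k))) = z'" by (simp add: vec_eq_iff y_def)
  show thesis
    by (rule that[OF \<tau> y01]) (simp only: w' z'' bott_orbit_eqI[OF u] flip: bu)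
qed

section \<open>Comparison of stabilizers with those of a Bott tower\<close>

context torus_manifold_over_cube
begin

text \<open>A single parametrization \<open>\<gamma>\<close> of the circle becomes diagonal at all
  vertices at once, which is what relates the coordinates at different vertices.\<close>

lemma vertex_automorphisms:
  assumes circle: "circle_subgroup S" and semifree: "semifree X act S"
    and isolated: "has_isolated_fixed_points X act S"
  obtains \<Theta> \<gamma> where "\<And>b. torus_automorphism (\<Theta> b)"
    "\<And>b x. x \<in> topspace X \<Longrightarrow> cube_facets_at (p x) \<subseteq> cube_facets_at (vertex b) \<Longrightarrow>
       stab x = {t \<in> torus. \<forall>i. (i, b i) \<notin> cube_facets_at (p x) \<longrightarrow> \<Theta> b t $ i = 1}"
    "\<And>s. s \<in> sphere 0 1 \<Longrightarrow> \<gamma> s \<in> torus" "\<And>b s. s \<in> sphere 0 1 \<Longrightarrow> \<Theta> b (\<gamma> s) = (\<chi> i. s)"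
proof -
  obtain \<gamma> :: "complex \<Rightarrow> 'n cspace" where \<gamma>: "continuous_on (sphere 0 1) \<gamma>" "inj_on \<gamma> (sphere 0 1)"
    "\<And>s t. s \<in> sphere 0 1 \<Longrightarrow> t \<in> sphere 0 1 \<Longrightarrow> \<gamma> (s * t) = \<gamma> s * \<gamma> t" "\<gamma> ` sphere 0 1 = S" "S \<subseteq> torus"
    using circle unfolding circle_subgroup_def by blast
  have sub: "\<gamma> ` sphere 0 1 \<subseteq> torus" using \<gamma>(4,5) by simp
  let ?st = "\<lambda>b \<theta>. \<forall>x. x \<in> topspace X \<longrightarrow> cube_facets_at (p x) \<subseteq> cube_facets_at (vertex b) \<longrightarrow>
       stab x = {t \<in> torus. \<forall>i. (i, b i) \<notin> cube_facets_at (p x) \<longrightarrow> \<theta> t $ i = 1}"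
  have "\<exists>\<theta>. torus_automorphism \<theta> \<and> ?st b \<theta> \<and> (\<forall>s\<in>sphere 0 1. \<theta> (\<gamma> s) = (\<chi> i. s))" for b
  proof (rule semifree_vertex_automorphism[OF \<gamma>(1,2,3) sub, of b])
    show "semifree X act (\<gamma> ` sphere 0 1)" "has_isolated_fixed_points X act (\<gamma> ` sphere 0 1)"
      using semifree isolated \<gamma>(4) by simp_all
    fix \<theta> assume "torus_automorphism \<theta>"
      and "\<And>x. x \<in> topspace X \<Longrightarrow> cube_facets_at (p x) \<subseteq> cube_facets_at (vertex b) \<Longrightarrow>
       stab x = {t \<in> torus. \<forall>i. (i, b i) \<notin> cube_facets_at (p x) \<longrightarrow> \<theta> t $ i = 1}"
      and "\<And>s. s \<in> sphere 0 1 \<Longrightarrow> \<theta> (\<gamma> s) = (\<chi> i. s)"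
    then show ?thesis by (intro exI[of _ \<theta>] conjI allI impI ballI)
  qed
  then have "\<forall>b. \<exists>\<theta>. torus_automorphism \<theta> \<and> ?st b \<theta> \<and> (\<forall>s\<in>sphere 0 1. \<theta> (\<gamma> s) = (\<chi> i. s))" by (rule allI)
  then have "\<exists>\<Theta>. \<forall>b. torus_automorphism (\<Theta> b) \<and> ?st b (\<Theta> b) \<and> (\<forall>s\<in>sphere 0 1. \<Theta> b (\<gamma> s) = (\<chi> i. s))" by (rule choice)
  then obtain \<Theta> where \<Theta>: "\<forall>b. torus_automorphism (\<Theta> b) \<and> ?st b (\<Theta> b) \<and> (\<forall>s\<in>sphere 0 1. \<Theta> b (\<gamma> s) = (\<chi> i. s))"
    by (rule exE)
  show thesis
  proof (rule that)
    show "torus_automorphism (\<Theta> b)" for b by (rule conjunct1[OF spec[OF \<Theta>]])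
    show "\<gamma> s \<in> torus" if "s \<in> sphere 0 1" for s using sub that by blast
    show "\<Theta> b (\<gamma> s) = (\<chi> i. s)" if "s \<in> sphere 0 1" for b s
      using conjunct2[OF conjunct2[OF spec[OF \<Theta>]]] that by (rule bspec)
    fix b x assume "x \<in> topspace X" "cube_facets_at (p x) \<subseteq> cube_facets_at (vertex b)"
    then show "stab x = {t \<in> torus. \<forall>i. (i, b i) \<notin> cube_facets_at (p x) \<longrightarrow> \<Theta> b t $ i = 1}"
      using conjunct1[OF conjunct2[OF spec[OF \<Theta>]], of b] by simp
  qed
qed

lemma act_eq_iff_stab:
  assumes t: "t \<in> torus" "t' \<in> torus" and x: "x \<in> topspace X"
  shows "act t x = act t' x \<longleftrightarrow> torus_cnj t' * t \<in> stab x"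
proof -
  have c: "torus_cnj t' \<in> torus" by (rule torus_cnj(1)[OF t(2)])
  have "act (torus_cnj t' * t) x = x \<longleftrightarrow> act (torus_cnj t') (act t x) = x" by (simp only: act_mult[OF c t(1) x])
  also have "\<dots> \<longleftrightarrow> act t x = act t' x"
  proof
    assume 1: "act (torus_cnj t') (act t x) = x"
    have "act t' (act (torus_cnj t') (act t x)) = act (t' * torus_cnj t') (act t x)"
      by (rule act_mult[OF t(2) c act_in[OF t(1) x], symmetric])
    also have "\<dots> = act t x" unfolding torus_cnj(2)[OF t(2)] by (rule act_one[OF act_in[OF t(1) x]])
    finally show "act t x = act t' x" using 1 by simp
  next
    assume "act t x = act t' x"
    then have "act (torus_cnj t') (act t x) = act (torus_cnj t' * t') x" by (simp only: act_mult[OF c t(2) x])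
    also have "\<dots> = x" using torus_cnj(2)[OF t(2)] act_one[OF x] by (simp add: mult.commute)
    finally show "act (torus_cnj t') (act t x) = x" .
  qed
  finally show ?thesis using torus_mult[OF c t(1)] by (simp add: stab_def)
qed

text \<open>With respect to \<open>\<theta>\<close>, the stabilizers are those of a Bott tower.\<close>

lemma bott_stabilizers:
  assumes "circle_subgroup S" "semifree X act S" "has_isolated_fixed_points X act S"
  obtains N :: "'n \<Rightarrow> 'n set" and \<theta> :: "'n cspace \<Rightarrow> 'n cspace" where "torus_automorphism \<theta>"
    "\<And>K. K \<noteq> {} \<Longrightarrow> \<exists>i\<in>K. \<forall>j\<in>K. i \<notin> N j"
    "\<And>x u. x \<in> topspace X \<Longrightarrow> u \<in> torus \<Longrightarrow> u \<in> stab x \<longleftrightarrow>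
      (\<exists>v\<in>torus. \<forall>j. (p x $ j \<noteq> 0 \<longrightarrow> \<theta> u $ j = v $ j * (\<Prod>i\<in>{i. j \<in> N i}. (v $ i)\<^sup>2)) \<and> (p x $ j \<noteq> 1 \<longrightarrow> v $ j = 1))"
proof -
  obtain \<Theta> \<gamma> where \<Theta>: "\<And>b. torus_automorphism (\<Theta> b)"
    "\<And>b x. x \<in> topspace X \<Longrightarrow> cube_facets_at (p x) \<subseteq> cube_facets_at (vertex b) \<Longrightarrow>
       stab x = {t \<in> torus. \<forall>i. (i, b i) \<notin> cube_facets_at (p x) \<longrightarrow> \<Theta> b t $ i = 1}"
    "\<And>s. s \<in> sphere 0 1 \<Longrightarrow> \<gamma> s \<in> torus" "\<And>b s. s \<in> sphere 0 1 \<Longrightarrow> \<Theta> b (\<gamma> s) = (\<chi> i. s)"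
  proof (rule vertex_automorphisms[OF assms])
    fix \<Theta> :: "('n \<Rightarrow> bool) \<Rightarrow> 'n cspace \<Rightarrow> 'n cspace" and \<gamma>
    assume *: "\<And>b. torus_automorphism (\<Theta> b)"
      "\<And>b x. x \<in> topspace X \<Longrightarrow> cube_facets_at (p x) \<subseteq> cube_facets_at (vertex b) \<Longrightarrow>
         stab x = {t \<in> torus. \<forall>i. (i, b i) \<notin> cube_facets_at (p x) \<longrightarrow> \<Theta> b t $ i = 1}"
      "\<And>s. s \<in> sphere 0 1 \<Longrightarrow> \<gamma> s \<in> torus" "\<And>b s. s \<in> sphere 0 1 \<Longrightarrow> \<Theta> b (\<gamma> s) = (\<chi> i. s)"
    show thesis by (rule that[OF *])
  qed
  have facet: "{t \<in> torus. \<forall>j. j \<noteq> i \<longrightarrow> \<Theta> b t $ j = 1} = {t \<in> torus. \<forall>j. j \<noteq> i \<longrightarrow> \<Theta> b' t $ j = 1}"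
    if bi: "b i = b' i" for b b' i
  proof -
    have Zs: "{(i, b i)} \<subseteq> cube_facets_at (vertex b)" "{(i, b i)} \<subseteq> cube_facets_at (vertex b')"
      unfolding vertex(2) using bi by auto
    obtain y where y: "y \<in> cbox 0 1" "cube_facets_at y = {(i, b i)}"
      using cube_facets_at_nearby[OF vertex(1) Zs(1) zero_less_one] .
    obtain x where x: "x \<in> topspace X" "p x = y" using p_surj[OF y(1)] .
    have Zx: "cube_facets_at (p x) = {(i, b i)}" using x(2) y(2) by simp
    have "{t \<in> torus. \<forall>j. j \<noteq> i \<longrightarrow> \<Theta> b t $ j = 1} = stab x"
      using \<Theta>(2)[OF x(1), of b] Zs(1) unfolding Zx by auto
    moreover have "{t \<in> torus. \<forall>j. j \<noteq> i \<longrightarrow> \<Theta> b' t $ j = 1} = stab x"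
      using \<Theta>(2)[OF x(1), of b'] Zs(2) bi unfolding Zx by auto
    ultimately show ?thesis by simp
  qed
  show thesis
  proof (rule vertex_automorphisms_normal_form[of \<Theta> \<gamma>, OF \<Theta>(1) facet \<Theta>(3,4)])
    fix N :: "'n \<Rightarrow> 'n set"
    assume acyclic: "\<And>K. K \<noteq> {} \<Longrightarrow> \<exists>i\<in>K. \<forall>j\<in>K. i \<notin> N j"
      and image: "\<And>b A. \<Theta> (\<lambda>_. False) ` {t \<in> torus. \<forall>i. i \<notin> A \<longrightarrow> \<Theta> b t $ i = 1} =
      {t. \<exists>s\<in>torus. (\<forall>i. i \<notin> A \<longrightarrow> s $ i = 1) \<and> t = (\<chi> j. s $ j * (\<Prod>i\<in>{i. b i \<and> j \<in> N i}. (s $ i)\<^sup>2))}"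
    define \<theta> where "\<theta> = \<Theta> (\<lambda>_. False)"
    have \<theta>: "torus_automorphism \<theta>" unfolding \<theta>_def by (rule \<Theta>(1))
    then have inj: "inj_on \<theta> torus" unfolding torus_automorphism_def bij_betw_def by blast
    show thesis
    proof (rule that[OF \<theta> acyclic])
      fix x and u :: "'n cspace" assume x: "x \<in> topspace X" and u: "u \<in> torus"
      \<comment> \<open>A vertex of the face of \<open>p x\<close>, with \<open>False\<close> at the
        free indices; thus \<open>b i\<close> holds exactly where the coordinate is 1.\<close>
      define b where "b i \<longleftrightarrow> p x $ i = 1" for i
      have Z: "(i, b i) \<in> cube_facets_at (p x) \<longleftrightarrow> p x $ i = 0 \<or> p x $ i = 1" for i
        by (auto simp: cube_facets_at_def b_def)
      have "cube_facets_at (p x) \<subseteq> cube_facets_at (vertex b)"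
        unfolding vertex(2) by (auto simp: cube_facets_at_def b_def of_bool_def split: if_splits)
      then have st: "stab x = {t \<in> torus. \<forall>i. i \<notin> {i. p x $ i = 0 \<or> p x $ i = 1} \<longrightarrow> \<Theta> b t $ i = 1}"
        using \<Theta>(2)[OF x, of b] Z by simp
      have "u \<in> stab x \<longleftrightarrow> \<theta> u \<in> \<theta> ` stab x"
        by (rule inj_on_image_mem_iff[OF inj u stab_subset, symmetric])
      also have "\<dots> \<longleftrightarrow> (\<exists>s\<in>torus. (\<forall>i. i \<notin> {i. p x $ i = 0 \<or> p x $ i = 1} \<longrightarrow> s $ i = 1) \<and>
          \<theta> u = (\<chi> j. s $ j * (\<Prod>i\<in>{i. p x $ i = 1 \<and> j \<in> N i}. (s $ i)\<^sup>2)))"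
        unfolding st \<theta>_def image by (simp only: mem_Collect_eq b_def)
      also have "\<dots> \<longleftrightarrow> (\<exists>v\<in>torus. \<forall>j. (p x $ j \<noteq> 0 \<longrightarrow> \<theta> u $ j = v $ j * (\<Prod>i\<in>{i. j \<in> N i}. (v $ i)\<^sup>2)) \<and> (p x $ j \<noteq> 1 \<longrightarrow> v $ j = 1))"
        by (rule bott_stabilizer_iff[OF torus_automorphism_in[OF \<theta> u]])
      finally show "u \<in> stab x \<longleftrightarrow>
        (\<exists>v\<in>torus. \<forall>j. (p x $ j \<noteq> 0 \<longrightarrow> \<theta> u $ j = v $ j * (\<Prod>i\<in>{i. j \<in> N i}. (v $ i)\<^sup>2)) \<and> (p x $ j \<noteq> 1 \<longrightarrow> v $ j = 1))" .
    qed
  qed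
qed

end

text \<open>Both spaces are quotients of \<open>TC\<close>, the torus times the cube:
  \<open>X\<close> through the section, the tower through the points whose second half is real and
  nonnegative. The two maps have the same fibres because the stabilizers agree, so the quotients are
  homeomorphic.\<close>

lemma equivalent_to_bott_tower:
  fixes X :: "'m topology" and act :: "'n::{finite,linorder} cspace \<Rightarrow> 'm \<Rightarrow> 'm" and p :: "'m \<Rightarrow> 'n rspace"
  assumes M: "torus_manifold_over_cube X act p"
    and S: "circle_subgroup S" "semifree X act S" "has_isolated_fixed_points X act S"
  obtains a :: "'n \<Rightarrow> 'n \<Rightarrow> int" and \<rho> \<theta> f where "bij \<rho>" "torus_automorphism \<theta>" "homeomorphic_map X (bott_tower a) f"
    "\<And>t x. t \<in> torus \<Longrightarrow> x \<in> topspace X \<Longrightarrow> f (act t x) = bott_act (\<theta> t) (f x)"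
    "\<And>x. x \<in> topspace X \<Longrightarrow> bott_proj (f x) \<in> cbox 0 1 \<and> (\<chi> i. bott_proj (f x) $ \<rho> i) = p x"
proof -
  interpret torus_manifold_over_cube X act p by (rule M)
  obtain N \<theta>0 where \<theta>0: "torus_automorphism \<theta>0" and acyclic: "\<And>K. K \<noteq> {} \<Longrightarrow> \<exists>i\<in>K. \<forall>j\<in>K. i \<notin> N j"
    and st: "\<And>x u. x \<in> topspace X \<Longrightarrow> u \<in> torus \<Longrightarrow> u \<in> stab x \<longleftrightarrow>
      (\<exists>v\<in>torus. \<forall>j. (p x $ j \<noteq> 0 \<longrightarrow> \<theta>0 u $ j = v $ j * (\<Prod>i\<in>{i. j \<in> N i}. (v $ i)\<^sup>2)) \<and> (p x $ j \<noteq> 1 \<longrightarrow> v $ j = 1))"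
  proof (rule bott_stabilizers[OF S])
    fix N :: "'n \<Rightarrow> 'n set" and \<theta>0
    assume *: "torus_automorphism \<theta>0" "\<And>K. K \<noteq> {} \<Longrightarrow> \<exists>i\<in>K. \<forall>j\<in>K. i \<notin> N j"
      "\<And>x u. x \<in> topspace X \<Longrightarrow> u \<in> torus \<Longrightarrow> u \<in> stab x \<longleftrightarrow>
        (\<exists>v\<in>torus. \<forall>j. (p x $ j \<noteq> 0 \<longrightarrow> \<theta>0 u $ j = v $ j * (\<Prod>i\<in>{i. j \<in> N i}. (v $ i)\<^sup>2)) \<and> (p x $ j \<noteq> 1 \<longrightarrow> v $ j = 1))"
    show thesis by (rule that[OF *])
  qed
  obtain \<rho> :: "'n \<Rightarrow> 'n" where \<rho>: "bij \<rho>" "\<And>i j. i \<in> N j \<Longrightarrow> \<rho> j < \<rho> i"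
    using topological_sort[OF acyclic] by metis
  have inv: "inv \<rho> (\<rho> i) = i" "\<rho> (inv \<rho> i) = i" for i
    using \<rho>(1) by (simp_all add: bij_is_inj inv_f_f bij_is_surj surj_f_inv_f)
  \<comment> \<open>The indices are renamed by \<open>\<rho>\<close>, which puts all nonzero entries
    at pairs \<open>k < l\<close>.\<close>
  define a :: "'n \<Rightarrow> 'n \<Rightarrow> int" where "a k l = (if inv \<rho> l \<in> N (inv \<rho> k) then - 2 else 0)" for k l
  define \<theta> where "\<theta> = (\<lambda>t. \<chi> k. t $ inv \<rho> k) \<circ> \<theta>0"
  have \<theta>: "torus_automorphism \<theta>" unfolding \<theta>_def
    by (rule torus_automorphism_compose[OF torus_automorphism_permute[OF bij_imp_bij_inv[OF \<rho>(1)]] \<theta>0])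
  have \<theta>k: "\<theta> t $ k = \<theta>0 t $ inv \<rho> k" for t k by (simp add: \<theta>_def)
  have \<theta>m: "\<theta> (t * t') = \<theta> t * \<theta> t'" if "t \<in> torus" "t' \<in> torus" for t t'
    using \<theta> that unfolding torus_automorphism_def by blast
  have \<theta>0m: "\<theta>0 (t * t') = \<theta>0 t * \<theta>0 t'" if "t \<in> torus" "t' \<in> torus" for t t'
    using \<theta>0 that unfolding torus_automorphism_def by blast
  have n\<theta>: "norm (\<theta> t $ k) = 1" if "t \<in> torus" for t k using torus_automorphism_in[OF \<theta> that] by (simp add: torus_def)
  obtain s where s: "continuous_map (top_of_set (cbox 0 1)) X s" "\<And>y. y \<in> cbox 0 1 \<Longrightarrow> p (s y) = y"
    using section_exists by metis
  have sX: "s y \<in> topspace X" if "y \<in> cbox 0 1" for y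
    using continuous_map_image_subset_topspace[OF s(1)] that by auto
  define TC where "TC = (torus :: 'n cspace set) \<times> cbox (0 :: 'n rspace) 1"
  have compTC: "compact TC" unfolding TC_def by (rule compact_Times[OF compact_torus compact_cbox])
  define qX where "qX = (\<lambda>(t, y). act t (s y))"
  have cont_qX: "continuous_map (top_of_set TC) X qX"
  proof -
    have "continuous_map (top_of_set TC) (top_of_set torus) fst"
      by (auto simp: continuous_map_in_subtopology TC_def intro: continuous_intros)
    moreover have "continuous_map (top_of_set TC) (top_of_set (cbox 0 1)) snd"
      by (auto simp: continuous_map_in_subtopology TC_def intro: continuous_intros)
    then have "continuous_map (top_of_set TC) X (s \<circ> snd)" using s(1) by (rule continuous_map_compose)
    ultimately have "continuous_map (top_of_set TC) (prod_topology (top_of_set torus) X) (\<lambda>z. (fst z, (s \<circ> snd) z))"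
      by (rule continuous_map_pairedI)
    from continuous_map_compose[OF this continuous_act] show ?thesis
      by (simp add: qX_def o_def case_prod_unfold)
  qed
  have surj_qX: "\<exists>t y. (t, y) \<in> TC \<and> x = qX (t, y) \<and> p x = y" if x: "x \<in> topspace X" for x
  proof -
    have px: "p x \<in> cbox 0 1" by (rule p_in[OF x])
    obtain t where "t \<in> torus" "x = act t (s (p x))" using p_eqD[OF sX[OF px] x s(2)[OF px]] .
    then show ?thesis using px by (intro exI[of _ t] exI[of _ "p x"]) (simp add: TC_def qX_def)
  qed
  have img_qX: "qX ` topspace (top_of_set TC) = topspace X"
  proof
    show "qX ` topspace (top_of_set TC) \<subseteq> topspace X" by (rule continuous_map_image_subset_topspace[OF cont_qX])
    show "topspace X \<subseteq> qX ` topspace (top_of_set TC)" using surj_qX by auto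
  qed
  have "compact_space (top_of_set TC)" using compTC by (intro compact_space_subtopology) simp
  then have quot_qX: "quotient_map (top_of_set TC) X qX"
    by (rule continuous_imp_quotient_map[OF cont_qX _ Hausdorff img_qX])
  define R where "R y = (\<chi> k. complex_of_real (sqrt (y $ inv \<rho> k)))" for y :: "'n rspace"
  define R' where "R' y = (\<chi> k. complex_of_real (sqrt (1 - y $ inv \<rho> k)))" for y :: "'n rspace"
  define E where "E = (\<lambda>(t, y). (\<theta> t * R y, R' y))"
  have contE: "continuous_on TC E"
  proof -
    have "continuous_on TC (\<lambda>z. \<theta> (fst z))"
      by (rule continuous_on_compose2[of torus \<theta>]) (use \<theta> in \<open>auto simp: torus_automorphism_def TC_def intro: continuous_intros\<close>)
    then have "continuous_on TC (\<lambda>z. \<theta> (fst z) $ k * complex_of_real (sqrt (snd z $ inv \<rho> k)))" for k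
      by (intro continuous_intros)
    then have "continuous_on TC (\<lambda>z. \<chi> k. \<theta> (fst z) $ k * complex_of_real (sqrt (snd z $ inv \<rho> k)))" by (rule continuous_on_vec_lambda)
    moreover have "continuous_on TC (\<lambda>z. complex_of_real (sqrt (1 - snd z $ inv \<rho> k)))" for k
      by (intro continuous_intros)
    then have "continuous_on TC (\<lambda>z. R' (snd z))" unfolding R'_def by (rule continuous_on_vec_lambda)
    ultimately have "continuous_on TC (\<lambda>z. (\<chi> k. \<theta> (fst z) $ k * complex_of_real (sqrt (snd z $ inv \<rho> k)), R' (snd z)))"
      by (rule continuous_on_Pair)
    moreover have "E z = (\<chi> k. \<theta> (fst z) $ k * complex_of_real (sqrt (snd z $ inv \<rho> k)), R' (snd z))" for z
      by (simp add: E_def case_prod_beta R_def vec_eq_iff)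
    ultimately show ?thesis by simp
  qed
  have nR: "(norm (R y $ k))\<^sup>2 = y $ inv \<rho> k" "(norm (R' y $ k))\<^sup>2 = 1 - y $ inv \<rho> k" if "y \<in> cbox 0 1" for y k
    using that by (simp_all add: R_def R'_def mem_cube)
  have E_spheres: "E z \<in> spheres" if "z \<in> TC" for z
    using that n\<theta> by (auto simp: E_def TC_def spheres_def norm_mult nR)
  define qB where "qB = bott_orbit a \<circ> E"
  have cont_qB: "continuous_map (top_of_set TC) (bott_tower a) qB"
    unfolding qB_def
  proof (rule continuous_map_compose)
    show "continuous_map (top_of_set TC) (top_of_set spheres) E"
      using contE E_spheres by (auto simp: continuous_map_in_subtopology)
    show "continuous_map (top_of_set spheres) (bott_tower a) (bott_orbit a)"
      by (rule quotient_imp_continuous_map[OF quotient_map_bott_orbit])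
  qed
  \<comment> \<open>Closedness does for the tower what the Hausdorff property does for
    \<open>X\<close>: it turns a continuous surjection from \<open>TC\<close> into a quotient
    map.\<close>
  have closed_qB: "closed_map (top_of_set TC) (bott_tower a) qB"
    unfolding closed_map_def
  proof (intro allI impI)
    fix C assume C: "closedin (top_of_set TC) C"
    then have CT: "C \<subseteq> TC" using closedin_imp_subset by blast
    have "compact C" using C compTC closedin_compact by blast
    then have "compact (E ` C)" using continuous_on_subset[OF contE CT] compact_continuous_image by blast
    moreover have "E ` C \<subseteq> spheres" using CT E_spheres by blast
    ultimately have "closedin (bott_tower a) (bott_orbit a ` E ` C)" by (rule closedin_bott_orbit_image)
    then show "closedin (bott_tower a) (qB ` C)" by (simp add: qB_def image_comp)
  qed
  have img_qB: "qB ` topspace (top_of_set TC) = topspace (bott_tower a)"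
  proof
    show "qB ` topspace (top_of_set TC) \<subseteq> topspace (bott_tower a)" by (rule continuous_map_image_subset_topspace[OF cont_qB])
    show "topspace (bott_tower a) \<subseteq> qB ` topspace (top_of_set TC)"
    proof
      fix o' assume "o' \<in> topspace (bott_tower a)"
      then obtain z w where zw: "(z, w) \<in> spheres" "o' = bott_orbit a (z, w)" unfolding topspace_bott_tower by auto
      obtain \<tau> y where ty: "\<tau> \<in> torus" "y \<in> cbox 0 1"
        "bott_orbit a (z, w) = bott_orbit a (\<tau> * (\<chi> k. of_real (sqrt (y $ k))), (\<chi> k. of_real (sqrt (1 - y $ k))))"
        using spheres_parametrization[OF zw(1)] .
      have "\<theta> ` torus = torus" using \<theta> unfolding torus_automorphism_def bij_betw_def by blast
      then obtain t where t: "t \<in> torus" "\<theta> t = \<tau>" using ty(1) by (metis imageE)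
      define y' where "y' = (\<chi> i. y $ \<rho> i)"
      have "y' \<in> cbox 0 1" using ty(2) by (simp add: y'_def mem_cube)
      moreover have "E (t, y') = (\<tau> * (\<chi> k. of_real (sqrt (y $ k))), (\<chi> k. of_real (sqrt (1 - y $ k))))"
        by (simp add: E_def R_def R'_def y'_def inv t(2))
      ultimately show "o' \<in> qB ` topspace (top_of_set TC)"
        using t(1) zw(2) ty(3) by (intro image_eqI[of _ _ "(t, y')"]) (simp_all add: qB_def TC_def)
    qed
  qed
  have quot_qB: "quotient_map (top_of_set TC) (bott_tower a) qB"
    by (rule continuous_closed_imp_quotient_map[OF cont_qB closed_qB img_qB])
  have proj_qB: "bott_proj (qB (t, y)) = (\<chi> k. y $ inv \<rho> k)" if "(t, y) \<in> TC" for t y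
    using that n\<theta> by (auto simp: qB_def E_def bott_proj_orbit TC_def norm_mult nR)
  have p_qX: "p (qX (t, y)) = y" if "(t, y) \<in> TC" for t y
    using that p_act sX s(2) by (auto simp: qX_def TC_def)
  have fibre: "qX (t, y) = qX (t', y) \<longleftrightarrow> qB (t, y) = qB (t', y)" if t: "t \<in> torus" "t' \<in> torus" and y: "y \<in> cbox 0 1" for t t' y
  proof -
    \<comment> \<open>The quotient of \<open>t\<close> and \<open>t'\<close>: the points
      \<open>qX (t, y)\<close> and \<open>qX (t', y)\<close> coincide when it lies in the stabilizer
      of \<open>s y\<close>.\<close>
    define u where "u = torus_cnj t' * t"
    have u: "u \<in> torus" unfolding u_def by (rule torus_mult[OF torus_cnj(1)[OF t(2)] t(1)])
    have "t = t' * u" unfolding u_def using torus_cnj(2)[OF t(2)] by (simp flip: mult.assoc)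
    then have \<theta>u: "\<theta>0 t $ j = \<theta>0 t' $ j * \<theta>0 u $ j" for j using \<theta>0m[OF t(2) u] by simp
    have nz: "\<theta>0 t' $ j \<noteq> 0" for j using torus_automorphism_in[OF \<theta>0 t(2)] unfolding torus_def by (metis (mono_tags, lifting) mem_Collect_eq norm_zero zero_neq_one)
    \<comment> \<open>In coordinate \<open>j\<close> the equation for the first half is void where
      \<open>y $ j = 0\<close>, the one for the second half where \<open>y $ j = 1\<close>. What
      remains is the description of the stabilizer, with the entries of \<open>v\<close> renamed by
      \<open>\<rho>\<close>.\<close>
    have bm: "bott_mult a v (E (t', y)) = E (t, y) \<longleftrightarrow>
      (\<forall>j. (y $ j \<noteq> 0 \<longrightarrow> \<theta>0 u $ j = v $ \<rho> j * (\<Prod>i\<in>{i. j \<in> N i}. (v $ \<rho> i)\<^sup>2)) \<and> (y $ j \<noteq> 1 \<longrightarrow> v $ \<rho> j = 1))" for v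
    proof -
      let ?P = "\<lambda>j. \<Prod>i\<in>{i. j \<in> N i}. (v $ \<rho> i)\<^sup>2"
      have bp: "(\<Prod>i\<in>{..<\<rho> j}. v $ i powi (- a i (\<rho> j))) = ?P j" for j
        unfolding a_def by (rule bott_product_sorted[OF \<rho>])
      have "bott_mult a v (E (t', y)) = E (t, y) \<longleftrightarrow>
        (\<forall>k. (\<Prod>i\<in>{..<k}. v $ i powi (- a i k)) * v $ k * (\<theta> t' $ k * R y $ k) = \<theta> t $ k * R y $ k \<and> v $ k * R' y $ k = R' y $ k)"
        by (simp add: bott_mult_def E_def vec_eq_iff all_conj_distrib)
      also have "\<dots> \<longleftrightarrow> (\<forall>j. (\<Prod>i\<in>{..<\<rho> j}. v $ i powi (- a i (\<rho> j))) * v $ \<rho> j * (\<theta> t' $ \<rho> j * R y $ \<rho> j) = \<theta> t $ \<rho> j * R y $ \<rho> j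
          \<and> v $ \<rho> j * R' y $ \<rho> j = R' y $ \<rho> j)" (is "(\<forall>k. ?Q k) \<longleftrightarrow> (\<forall>j. ?Q (\<rho> j))")
        using inv(2) by metis
      also have "\<dots> \<longleftrightarrow> (\<forall>j. ?P j * v $ \<rho> j * (\<theta>0 t' $ j * sqrt (y $ j)) = \<theta>0 t $ j * sqrt (y $ j)
          \<and> v $ \<rho> j * sqrt (1 - y $ j) = sqrt (1 - y $ j))"
        unfolding bp \<theta>k R_def R'_def vec_lambda_beta inv(1) ..
      also have "\<dots> \<longleftrightarrow> (\<forall>j. (y $ j \<noteq> 0 \<longrightarrow> \<theta>0 u $ j = v $ \<rho> j * ?P j) \<and> (y $ j \<noteq> 1 \<longrightarrow> v $ \<rho> j = 1))"
      proof -
        have "?P j * v $ \<rho> j * (\<theta>0 t' $ j * sqrt (y $ j)) = \<theta>0 t $ j * sqrt (y $ j) \<longleftrightarrow>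
            (y $ j \<noteq> 0 \<longrightarrow> \<theta>0 u $ j = v $ \<rho> j * ?P j)" for j
        proof -
          have "?P j * v $ \<rho> j * (\<theta>0 t' $ j * sqrt (y $ j)) = \<theta>0 t $ j * sqrt (y $ j) \<longleftrightarrow>
            (\<theta>0 t' $ j * sqrt (y $ j)) * (v $ \<rho> j * ?P j) = (\<theta>0 t' $ j * sqrt (y $ j)) * \<theta>0 u $ j"
            unfolding \<theta>u by (simp only: mult_ac)
          also have "\<dots> \<longleftrightarrow> y $ j = 0 \<or> v $ \<rho> j * ?P j = \<theta>0 u $ j" using nz[of j] by (simp only: mult_cancel_left) simp
          finally show ?thesis by (auto simp only:)
        qed
        moreover have "v $ \<rho> j * sqrt (1 - y $ j) = sqrt (1 - y $ j) \<longleftrightarrow> (y $ j \<noteq> 1 \<longrightarrow> v $ \<rho> j = 1)" for j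
          by auto
        ultimately show ?thesis by (simp only:)
      qed
      finally show ?thesis .
    qed
    have "qX (t, y) = qX (t', y) \<longleftrightarrow> u \<in> stab (s y)"
      unfolding qX_def u_def by (simp add: act_eq_iff_stab[OF t sX[OF y]])
    also have "\<dots> \<longleftrightarrow> (\<exists>v\<in>torus. \<forall>j. (y $ j \<noteq> 0 \<longrightarrow> \<theta>0 u $ j = v $ j * (\<Prod>i\<in>{i. j \<in> N i}. (v $ i)\<^sup>2)) \<and> (y $ j \<noteq> 1 \<longrightarrow> v $ j = 1))"
      using st[OF sX[OF y] u] unfolding s(2)[OF y] .
    also have "\<dots> \<longleftrightarrow> (\<exists>v\<in>torus. bott_mult a v (E (t', y)) = E (t, y))"
    proof
      assume "\<exists>v\<in>torus. \<forall>j. (y $ j \<noteq> 0 \<longrightarrow> \<theta>0 u $ j = v $ j * (\<Prod>i\<in>{i. j \<in> N i}. (v $ i)\<^sup>2)) \<and> (y $ j \<noteq> 1 \<longrightarrow> v $ j = 1)"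
      then obtain v where v: "v \<in> torus"
        "\<forall>j. (y $ j \<noteq> 0 \<longrightarrow> \<theta>0 u $ j = v $ j * (\<Prod>i\<in>{i. j \<in> N i}. (v $ i)\<^sup>2)) \<and> (y $ j \<noteq> 1 \<longrightarrow> v $ j = 1)" by blast
      have "(\<chi> k. v $ inv \<rho> k) \<in> torus" using v(1) by (simp add: torus_def)
      moreover have "bott_mult a (\<chi> k. v $ inv \<rho> k) (E (t', y)) = E (t, y)" unfolding bm using v(2) by (simp add: inv(1))
      ultimately show "\<exists>v\<in>torus. bott_mult a v (E (t', y)) = E (t, y)" by blast
    next
      assume "\<exists>v\<in>torus. bott_mult a v (E (t', y)) = E (t, y)"
      then obtain v where v: "v \<in> torus" "bott_mult a v (E (t', y)) = E (t, y)" by blast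
      have "(\<chi> j. v $ \<rho> j) \<in> torus" using v(1) by (simp add: torus_def)
      moreover have "\<forall>j. (y $ j \<noteq> 0 \<longrightarrow> \<theta>0 u $ j = (\<chi> j. v $ \<rho> j) $ j * (\<Prod>i\<in>{i. j \<in> N i}. ((\<chi> j. v $ \<rho> j) $ i)\<^sup>2)) \<and> (y $ j \<noteq> 1 \<longrightarrow> (\<chi> j. v $ \<rho> j) $ j = 1)"
        using v(2) unfolding bm by simp
      ultimately show "\<exists>v\<in>torus. \<forall>j. (y $ j \<noteq> 0 \<longrightarrow> \<theta>0 u $ j = v $ j * (\<Prod>i\<in>{i. j \<in> N i}. (v $ i)\<^sup>2)) \<and> (y $ j \<noteq> 1 \<longrightarrow> v $ j = 1)" by (rule bexI[rotated])
    qed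
    also have "\<dots> \<longleftrightarrow> qB (t', y) = qB (t, y)" unfolding qB_def o_def by (rule bott_orbit_eq_iff[symmetric])
    finally show ?thesis by auto
  qed
  have fibres: "qX z = qX z' \<longleftrightarrow> qB z = qB z'" if z: "z \<in> TC" "z' \<in> TC" for z z'
  proof -
    obtain t y t' y' where eq: "z = (t, y)" "z' = (t', y')" by fastforce
    have ty: "t \<in> torus" "t' \<in> torus" "y \<in> cbox 0 1" using z by (auto simp: eq TC_def)
    have "y = y'" if "qX z = qX z'" using p_qX[of t y] p_qX[of t' y'] z that by (simp add: eq)
    moreover have "y = y'" if "qB z = qB z'"
    proof -
      have "(\<chi> k. y $ inv \<rho> k) = (\<chi> k. y' $ inv \<rho> k)" using proj_qB[of t y] proj_qB[of t' y'] z that by (simp add: eq)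
      then have "y $ inv \<rho> (\<rho> i) = y' $ inv \<rho> (\<rho> i)" for i by (simp add: vec_eq_iff)
      then show ?thesis by (simp add: inv(1) vec_eq_iff)
    qed
    ultimately show ?thesis using fibre[OF ty] unfolding eq by blast
  qed
  obtain f where f: "continuous_map X (bott_tower a) f" "\<And>z. z \<in> TC \<Longrightarrow> f (qX z) = qB z"
    using quotient_map_lift_exists[OF quot_qX cont_qB] fibres by (metis topspace_euclidean_subtopology)
  obtain f' where f': "continuous_map (bott_tower a) X f'" "\<And>z. z \<in> TC \<Longrightarrow> f' (qB z) = qX z"
    using quotient_map_lift_exists[OF quot_qB cont_qX] fibres by (metis topspace_euclidean_subtopology)
  have "homeomorphic_maps X (bott_tower a) f f'"
    unfolding homeomorphic_maps_def
  proof (intro conjI f(1) f'(1) ballI)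
    fix x assume "x \<in> topspace X"
    then have "x \<in> qX ` TC" using img_qX by simp
    then obtain z where "z \<in> TC" "x = qX z" by blast
    then show "f' (f x) = x" using f(2) f'(2) by simp
  next
    fix x assume "x \<in> topspace (bott_tower a)"
    then have "x \<in> qB ` TC" using img_qB by simp
    then obtain z where "z \<in> TC" "x = qB z" by blast
    then show "f (f' x) = x" using f(2) f'(2) by simp
  qed
  then have hom: "homeomorphic_map X (bott_tower a) f" using homeomorphic_map_maps by blast
  show thesis
  proof (rule that[OF \<rho>(1) \<theta> hom])
    fix t :: "'n cspace" and x assume t: "t \<in> torus" and x: "x \<in> topspace X"
    obtain t0 y where ty: "(t0, y) \<in> TC" "x = qX (t0, y)" using surj_qX[OF x] by blast
    have t0: "t0 \<in> torus" "y \<in> cbox 0 1" using ty(1) by (auto simp: TC_def)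
    have "act t x = qX (t * t0, y)" unfolding ty(2) qX_def using act_mult[OF t t0(1) sX[OF t0(2)]] by simp
    moreover have "(t * t0, y) \<in> TC" using torus_mult[OF t t0(1)] t0(2) by (simp add: TC_def)
    ultimately have "f (act t x) = qB (t * t0, y)" using f(2) by simp
    also have "\<dots> = bott_act (\<theta> t) (qB (t0, y))"
      unfolding qB_def o_def E_def by (simp add: bott_act_orbit \<theta>m[OF t t0(1)] mult.assoc)
    also have "qB (t0, y) = f x" using f(2)[OF ty(1)] ty(2) by simp
    finally show "f (act t x) = bott_act (\<theta> t) (f x)" .
  next
    fix x assume x: "x \<in> topspace X"
    obtain t0 y where ty: "(t0, y) \<in> TC" "x = qX (t0, y)" "p x = y" using surj_qX[OF x] by blast
    have "bott_proj (f x) = (\<chi> k. y $ inv \<rho> k)" using f(2)[OF ty(1)] proj_qB[OF ty(1)] ty(2) by simp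
    moreover have "y \<in> cbox 0 1" using ty(1) by (simp add: TC_def)
    ultimately show "bott_proj (f x) \<in> cbox 0 1 \<and> (\<chi> i. bott_proj (f x) $ \<rho> i) = p x"
      by (simp add: mem_cube inv ty(3))
  qed
qed

text \<open>Since \<open>h\<close> matches the labelled facets, as many facets of \<open>P\<close>
  pass through a point as facets of the cube through its preimage. This turns
  \<open>preserves_corners\<close> into the cardinality clause of
  \<open>orbit_chart\<close>.\<close>

lemma quasitoric_manifold_over_cube:
  fixes act :: "'n::finite cspace \<Rightarrow> 'm \<Rightarrow> 'm" and h :: "'n rspace \<Rightarrow> 'p::euclidean_space"
  assumes M: "quasitoric_manifold X A act P \<pi>" and G: "cubical_facets P G"
    and hk: "homeomorphism (cbox 0 1) P h k"
    and hG: "\<And>y f. y \<in> cbox 0 1 \<Longrightarrow> h y \<in> G f \<longleftrightarrow> f \<in> cube_facets_at y"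
  shows "torus_manifold_over_cube X act (k \<circ> \<pi>)"
proof -
  have quo: "quotient_map X (top_of_set P) \<pi>" and orb: "\<And>x y. x \<in> topspace X \<Longrightarrow> y \<in> topspace X \<Longrightarrow> \<pi> x = \<pi> y \<longleftrightarrow> (\<exists>t\<in>torus. y = act t x)"
    using M unfolding quasitoric_manifold_def orbit_projection_def by blast+
  have \<pi>P: "\<pi> x \<in> P" if "x \<in> topspace X" for x
    using quotient_imp_surjective_map[OF quo] that by auto
  have hk': "h (k z) = z" "k z \<in> cbox 0 1" if "z \<in> P" for z
    using hk that unfolding homeomorphism_def by blast+
  show ?thesis
  proof
    show "Hausdorff_space X" "compact_space X" "torus_action X act"
      using M unfolding quasitoric_manifold_def closed_smooth_manifold_def smooth_manifold_def by blast+
    have "homeomorphic_maps (top_of_set P) (top_of_set (cbox 0 1)) k h"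
      using hk unfolding homeomorphism_def homeomorphic_maps_def
      by (auto simp: continuous_map_in_subtopology)
    then have "homeomorphic_map (top_of_set P) (top_of_set (cbox 0 1)) k" using homeomorphic_map_maps by blast
    then have "quotient_map (top_of_set P) (top_of_set (cbox 0 1)) k" unfolding homeomorphic_map_def by blast
    with quo show "quotient_map X (top_of_set (cbox 0 1)) (k \<circ> \<pi>)" by (rule quotient_map_compose)
    show "(k \<circ> \<pi>) x = (k \<circ> \<pi>) y \<longleftrightarrow> (\<exists>t\<in>torus. y = act t x)" if "x \<in> topspace X" "y \<in> topspace X" for x y
    proof -
      have "k (\<pi> x) = k (\<pi> y) \<longleftrightarrow> \<pi> x = \<pi> y" using hk'(1)[OF \<pi>P] that by metis
      then show ?thesis using orb[OF that] by simp
    qed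
    fix x assume x: "x \<in> topspace X"
    obtain U \<phi> \<theta> where U: "x \<in> U" "standard_chart X A act U \<phi> \<theta>"
      using M x unfolding quasitoric_manifold_def locally_standard_def by blast
    have "card {i. \<phi> z $ i = 0} = card (cube_facets_at ((k \<circ> \<pi>) z))" if z: "z \<in> U" for z
    proof -
      have "openin X U" using U(2) by (simp add: standard_chart_def is_chart_def)
      then have zX: "z \<in> topspace X" using z openin_subset by blast
      have "{F. F facet_of P \<and> \<pi> z \<in> F} = G ` {f. \<pi> z \<in> G f}"
        using G unfolding cubical_facets_def by blast
      also have "{f. \<pi> z \<in> G f} = cube_facets_at ((k \<circ> \<pi>) z)"
        using hG[OF hk'(2)[OF \<pi>P[OF zX]]] hk'(1)[OF \<pi>P[OF zX]] by auto
      finally have "card {F. F facet_of P \<and> \<pi> z \<in> F} = card (cube_facets_at ((k \<circ> \<pi>) z))"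
        using G card_image[of G "cube_facets_at ((k \<circ> \<pi>) z)"] inj_on_subset unfolding cubical_facets_def by (metis subset_UNIV)
      moreover have "card {i. \<phi> z $ i = 0} = card {F. F facet_of P \<and> \<pi> z \<in> F}"
        using M U(2) z unfolding quasitoric_manifold_def preserves_corners_def by blast
      ultimately show ?thesis by simp
    qed
    then have "orbit_chart X act (k \<circ> \<pi>) U \<phi> \<theta>"
      using U(2) unfolding orbit_chart_def standard_chart_def by blast
    then show "\<exists>U \<phi> \<theta>. x \<in> U \<and> orbit_chart X act (k \<circ> \<pi>) U \<phi> \<theta>" using U(1) by blast
  qed
qed

theorem theorem4p3:
  fixes X :: "'m topology"
    and A :: "('m, 'n::{finite,linorder} cspace) chart set"
    and act :: "'n cspace \<Rightarrow> 'm \<Rightarrow> 'm"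
    and P :: "'p::euclidean_space set"
    and \<pi> :: "'m \<Rightarrow> 'p"
  assumes "quasitoric_manifold X A act P \<pi>"
    and "combinatorially_equivalent P (cbox 0 1 :: ('n rspace) set)"
    and "\<exists>S. circle_subgroup S \<and> semifree X act S \<and> has_isolated_fixed_points X act S"
  shows "\<exists>(a :: 'n \<Rightarrow> 'n \<Rightarrow> int) (h :: 'n rspace \<Rightarrow> 'p).
           face_homeomorphism (cbox 0 1) P h \<and>
           equivalent_over X act \<pi> (bott_tower a) bott_act (h \<circ> bott_proj)"
proof -
  have poly: "polytope P" and dim: "aff_dim P = int CARD('n)" and quo: "quotient_map X (top_of_set P) \<pi>"
    using assms(1) unfolding quasitoric_manifold_def simple_polytope_def orbit_projection_def by blast+
  obtain G :: "'n \<times> bool \<Rightarrow> 'p set" where G: "cubical_facets P G"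
    using cubical_facets_exist[OF poly assms(2)] .
  obtain h :: "'n rspace \<Rightarrow> 'p" where h: "face_homeomorphism (cbox 0 1) P h"
    and hG: "\<And>y f. y \<in> cbox 0 1 \<Longrightarrow> h y \<in> G f \<longleftrightarrow> f \<in> cube_facets_at y"
    using cubical_polytope_homeomorphism[OF poly dim G] by metis
  obtain k where hk: "homeomorphism (cbox 0 1) P h k" using h unfolding face_homeomorphism_def by blast
  obtain S where S: "circle_subgroup S" "semifree X act S" "has_isolated_fixed_points X act S" using assms(3) by blast
  obtain a :: "'n \<Rightarrow> 'n \<Rightarrow> int" and \<rho> \<theta> f where f: "bij \<rho>" "torus_automorphism \<theta>" "homeomorphic_map X (bott_tower a) f"
    "\<And>t x. t \<in> torus \<Longrightarrow> x \<in> topspace X \<Longrightarrow> f (act t x) = bott_act (\<theta> t) (f x)"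
    "\<And>x. x \<in> topspace X \<Longrightarrow> bott_proj (f x) \<in> cbox 0 1 \<and> (\<chi> i. bott_proj (f x) $ \<rho> i) = (k \<circ> \<pi>) x"
  proof (rule equivalent_to_bott_tower[OF quasitoric_manifold_over_cube[OF assms(1) G hk hG] S])
    fix a :: "'n \<Rightarrow> 'n \<Rightarrow> int" and \<rho> \<theta> f
    assume *: "bij \<rho>" "torus_automorphism \<theta>" "homeomorphic_map X (bott_tower a) f"
      "\<And>t x. t \<in> torus \<Longrightarrow> x \<in> topspace X \<Longrightarrow> f (act t x) = bott_act (\<theta> t) (f x)"
      "\<And>x. x \<in> topspace X \<Longrightarrow> bott_proj (f x) \<in> cbox 0 1 \<and> (\<chi> i. bott_proj (f x) $ \<rho> i) = (k \<circ> \<pi>) x"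
    show thesis by (rule that[OF *])
  qed
  \<comment> \<open>The sorting permutation is absorbed into the identification of the cube with
    \<open>P\<close>, so the equivalence covers the identity of \<open>P\<close>.\<close>
  have "((\<lambda>y. h (\<chi> i. y $ \<rho> i)) \<circ> bott_proj) (f x) = \<pi> x" if x: "x \<in> topspace X" for x
  proof -
    have "\<pi> x \<in> P" using quotient_imp_surjective_map[OF quo] x by auto
    then show ?thesis using f(5)[OF x] hk unfolding homeomorphism_def by simp
  qed
  then have "equivalent_over X act \<pi> (bott_tower a) bott_act ((\<lambda>y. h (\<chi> i. y $ \<rho> i)) \<circ> bott_proj)"
    unfolding equivalent_over_def using f(2-4) by blast
  then show ?thesis using face_homeomorphism_permute[OF h f(1)] by blast
qed

end
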